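(* For each $n\ge 1$ let $\gamma_n=(\varepsilon_1,\dots,\varepsilon_n)$ be chosen uniformly at random from the set $\mathcal{M}_n$ of Motzkin paths of length $n$, and let $A_n(t)$, $L_n(t)$, $D_n(t)$, $t\in[0,1]$, be the numbers of ascent steps, level steps and descent steps, respectively, among the first $\lfloor nt\rfloor$ steps of $\gamma_n$. Then, as $n\to\infty$, the finite-dimensional distributions of the $\mathbb{R}^3$-valued process $$\frac{1}{\sqrt{2n}}\left(A_n(t)-\frac{nt}{3},\; L_n(t)-\frac{nt}{3},\; D_n(t)-\frac{nt}{3}\right)_{t\in[0,1]}$$ converge to the finite-dimensional distributions of $$\left(\frac{1}{2\sqrt{3}}B_t^{ex}+\frac{1}{6}B_t,\; -\frac{1}{3}B_t,\; \frac{1}{6}B_t-\frac{1}{2\sqrt{3}}B_t^{ex}\right)_{t\in[0,1]},$$ where $(B_t)_{t\in[0,1]}$ is a Brownian motion, $(B_t^{ex})_{t\in[0,1]}$ is a Brownian excursion, and the processes $(B_t)_{t\in[0,1]}$ and $(B_t^{ex})_{t\in[0,1]}$ are independent.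
   Context: A Motzkin path of length $n$ is a lattice path from $(0,0)$ to $(n,0)$ that does not fall below the horizontal axis and uses only ascents $(1,1)$, descents $(1,-1)$ and level steps $(1,0)$. It is identified with the sequence $\gamma_n=(\varepsilon_1,\dots,\varepsilon_n)\in\{-1,0,1\}^n$ of vertical increments, so that $\varepsilon_1+\dots+\varepsilon_k\ge 0$ for all $k\le n$ and $\varepsilon_1+\dots+\varepsilon_n=0$. $\mathcal{M}_n$ is the (finite) set of all such sequences. Put $\varepsilon_j^+=1_{\{\varepsilon_j=1\}}$, $\varepsilon_j^-=1_{\{\varepsilon_j=-1\}}$, $\delta_j=1_{\{\varepsilon_j=0\}}$, and for $t\in[0,1]$ $$A_n(t)=\sum_{k=1}^{\lfloor nt\rfloor}\varepsilon_k^+,\qquad D_n(t)=\sum_{k=1}^{\lfloor nt\rfloor}\varepsilon_k^-,\qquad L_n(t)=\sum_{k=1}^{\lfloor nt\rfloor}\delta_k .$$ Brownian motion means standard Brownian motion started at $0$. The Brownian excursion $(B^{ex}_t)_{t\in[0,1]}$ is the process with $B^{ex}_0=B^{ex}_1=0$ such that for $0<s_1<\dots<s_d<1$ the vector $(B^{ex}_{s_1},\dots,B^{ex}_{s_d})$ has density on $(0,\infty)^d$ $$\sqrt{8\pi}\,\ell_{s_1}(x_1)\,\ell_{1-s_d}(x_d)\prod_{k=1}^{d-1}g_{s_{k+1}-s_k}(x_k,x_{k+1}),$$ where $\ell_t(y)=\frac{1}{\sqrt{2\pi t^3}}\,y\,e^{-y^2/(2t)}$ and $g_t(y_1,y_2)=\frac{1}{\sqrt{2\pi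 t}}\left(e^{-(y_1-y_2)^2/(2t)}-e^{-(y_1+y_2)^2/(2t)}\right)$ for $t,y,y_1,y_2>0$. Convergence of finite-dimensional distributions means that for every finite set of times in $[0,1]$ the corresponding random vectors converge in distribution. *)

theory Defs
  imports "HOL-Probability.Probability"
begin

text \<open>A path is the list of its vertical increments, so the increment \<open>\<epsilon>\<^sub>k\<close>
  (with \<open>1 \<le> k \<le> n\<close>) is \<open>\<gamma> ! (k - 1)\<close>.\<close>

definition motzkin_paths :: "nat \<Rightarrow> int list set" where
  "motzkin_paths n = {\<gamma>. length \<gamma> = n \<and> set \<gamma> \<subseteq> {-1, 0, 1} \<and>
     (\<forall>k\<le>n. 0 \<le> (\<Sum>j=1..k. \<gamma> ! (j - 1))) \<and> (\<Sum>j=1..n. \<gamma> ! (j - 1)) = 0}"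

lemma finite_motzkin_paths: "finite (motzkin_paths n)"
  by (rule finite_subset[OF _ finite_lists_length_eq[of "{-1, 0, 1}" n]])
    (auto simp: motzkin_paths_def)

lemma motzkin_paths_nonempty: "motzkin_paths n \<noteq> {}"
proof -
  have "(\<Sum>j=1..k. replicate n (0::int) ! (j - 1)) = 0" if "k \<le> n" for k
    using that by (intro sum.neutral) auto
  then have "replicate n 0 \<in> motzkin_paths n"
    by (auto simp: motzkin_paths_def)
  then show ?thesis by blast
qed

text \<open>\<open>steps e n \<gamma> t\<close> is the number of steps with increment \<open>e\<close> among the first
  \<open>\<lfloor>n t\<rfloor>\<close> steps of \<open>\<gamma>\<close>.\<close>

definition steps :: "int \<Rightarrow> nat \<Rightarrow> int list \<Rightarrow> real \<Rightarrow> real" where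
  "steps e n \<gamma> t = (\<Sum>k=1..nat \<lfloor>real n * t\<rfloor>. of_bool (\<gamma> ! (k - 1) = e))"

abbreviation ascents :: "nat \<Rightarrow> int list \<Rightarrow> real \<Rightarrow> real" where
  "ascents \<equiv> steps 1"

abbreviation levels :: "nat \<Rightarrow> int list \<Rightarrow> real \<Rightarrow> real" where
  "levels \<equiv> steps 0"

abbreviation descents :: "nat \<Rightarrow> int list \<Rightarrow> real \<Rightarrow> real" where
  "descents \<equiv> steps (- 1)"

text \<open>Standard Brownian motion on the time interval \<open>[0,1]\<close>.\<close>

definition brownian_motion :: "'a measure \<Rightarrow> (real \<Rightarrow> 'a \<Rightarrow> real) \<Rightarrow> bool" where
  "brownian_motion M B \<longleftrightarrow> prob_space M \<and>
     (\<forall>t\<in>{0..1}. B t \<in> borel_measurable M) \<and>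
     (AE \<omega> in M. B 0 \<omega> = 0) \<and>
     (\<forall>s t. 0 \<le> s \<and> s < t \<and> t \<le> 1 \<longrightarrow>
        distributed M lborel (\<lambda>\<omega>. B t \<omega> - B s \<omega>) (normal_density 0 (sqrt (t - s)))) \<and>
     (\<forall>(d::nat) (s :: nat \<Rightarrow> real). strict_mono_on {..d} s \<and> s ` {..d} \<subseteq> {0..1} \<longrightarrow>
        prob_space.indep_vars M (\<lambda>_. borel) (\<lambda>k \<omega>. B (s (Suc k)) \<omega> - B (s k) \<omega>) {..<d}) \<and>
     (AE \<omega> in M. continuous_on {0..1} (\<lambda>t. B t \<omega>))"

definition ex_ell :: "real \<Rightarrow> real \<Rightarrow> real" where
  "ex_ell t y = 1 / sqrt (2 * pi * t ^ 3) * y * exp (- y\<^sup>2 / (2 * t))"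

definition ex_g :: "real \<Rightarrow> real \<Rightarrow> real \<Rightarrow> real" where
  "ex_g t y z = 1 / sqrt (2 * pi * t) *
     (exp (- (y - z)\<^sup>2 / (2 * t)) - exp (- (y + z)\<^sup>2 / (2 * t)))"

text \<open>Times and coordinates are indexed by \<open>0, \<dots>, d - 1\<close>; the density vanishes outside
  \<open>(0,\<infinity>)\<^sup>d\<close>.\<close>

definition excursion_density :: "nat \<Rightarrow> (nat \<Rightarrow> real) \<Rightarrow> (nat \<Rightarrow> real) \<Rightarrow> real" where
  "excursion_density d s x =
     (if \<forall>k<d. 0 < x k
      then sqrt (8 * pi) * ex_ell (s 0) (x 0) * ex_ell (1 - s (d - 1)) (x (d - 1)) *
        (\<Prod>k<d - 1. ex_g (s (k + 1) - s k) (x k) (x (k + 1)))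
      else 0)"

text \<open>The excursion is specified through its finite-dimensional distributions only;
  no path continuity is required.\<close>

definition brownian_excursion :: "'a measure \<Rightarrow> (real \<Rightarrow> 'a \<Rightarrow> real) \<Rightarrow> bool" where
  "brownian_excursion M X \<longleftrightarrow> prob_space M \<and>
     (\<forall>t\<in>{0..1}. X t \<in> borel_measurable M) \<and>
     (AE \<omega> in M. X 0 \<omega> = 0 \<and> X 1 \<omega> = 0) \<and>
     (\<forall>(d::nat) (s :: nat \<Rightarrow> real). 1 \<le> d \<and> strict_mono_on {..<d} s \<and> s ` {..<d} \<subseteq> {0<..<1} \<longrightarrow>
        distributed M (\<Pi>\<^sub>M k\<in>{..<d}. lborel) (\<lambda>\<omega>. \<lambda>k\<in>{..<d}. X (s k) \<omega>)
          (excursion_density d s))"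

text \<open>Independence of the processes \<open>(X\<^sub>t)\<close> and \<open>(Y\<^sub>t)\<close>, \<open>t \<in> [0,1]\<close>, as random elements of the
  product space of all functions on \<open>[0,1]\<close>.\<close>

definition indep_processes ::
    "'a measure \<Rightarrow> (real \<Rightarrow> 'a \<Rightarrow> real) \<Rightarrow> (real \<Rightarrow> 'a \<Rightarrow> real) \<Rightarrow> bool" where
  "indep_processes M X Y \<longleftrightarrow>
     prob_space.indep_var M
       (\<Pi>\<^sub>M t\<in>{0..1}. borel) (\<lambda>\<omega>. \<lambda>t\<in>{0..1}. X t \<omega>)
       (\<Pi>\<^sub>M t\<in>{0..1}. borel) (\<lambda>\<omega>. \<lambda>t\<in>{0..1}. Y t \<omega>)"

text \<open>The library's \<^const>\<open>weak_conv_m\<close> covers only measures on the real line.\<close>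

definition weak_conv :: "(nat \<Rightarrow> 'b::topological_space measure) \<Rightarrow> 'b measure \<Rightarrow> bool" where
  "weak_conv \<mu> \<nu> \<longleftrightarrow>
     (\<forall>f :: 'b \<Rightarrow> real. continuous_on UNIV f \<and> bounded (range f) \<longrightarrow>
        (\<lambda>n. integral\<^sup>L (\<mu> n) f) \<longlonglongrightarrow> integral\<^sup>L \<nu> f)"

definition conv_in_distribution ::
    "(nat \<Rightarrow> 'c measure) \<Rightarrow> (nat \<Rightarrow> 'c \<Rightarrow> 'b::topological_space) \<Rightarrow>
      'a measure \<Rightarrow> ('a \<Rightarrow> 'b) \<Rightarrow> bool" where
  "conv_in_distribution P X M Y \<longleftrightarrow>
     weak_conv (\<lambda>n. distr (P n) borel (X n)) (distr M borel Y)"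

end

theory Submission
  imports Defs "HOL-Real_Asymp.Real_Asymp"
begin

text \<open>Weighting each level step by \<open>z\<close>, the paths of length \<open>m\<close> from height \<open>a\<close> to height \<open>b\<close> that
  stay nonnegative have total weight
  \<open>1/\<pi> \<integral> (z + 2 cos u)\<^sup>m sin ((a + 1) u) sin ((b + 1) u) du\<close> over \<open>[-\<pi>, \<pi>]\<close>:
  both sides agree at \<open>m = 0\<close>, satisfy the same recurrence in \<open>m\<close> and vanish at \<open>b = -1\<close>.
  With \<open>z = exp (i \<theta> / sqrt (2 n))\<close> and heights of order
  \<open>sqrt (2 n / 3)\<close>, dominated convergence turns this integral into a Gaussian factor in \<open>\<theta>\<close> times the
  kernel \<open>g\<close> (or \<open>\<ell>\<close>, if one of the endpoints is \<open>0\<close>) of the excursion densities. Cutting a Motzkin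
  path at the given times, the joint characteristic function of level counts and heights is a sum of
  products of such kernels, that is, the integral of a step function. It converges pointwise, and it
  is dominated by its value at \<open>\<theta> = 0\<close>, which is a sequence of probability densities converging
  to the excursion density; Scheffe's lemma then gives the convergence of the characteristic
  functions. The ascents and descents are linear in the level count and the height.\<close>

subsection \<open>Characteristic functions on Euclidean spaces\<close>

text \<open>Why the limit processes are independent: for a single uniform step in {-1, 0, 1} the
  level indicator and the increment are uncorrelated, since the increment is symmetric and vanishes
  on level steps. The limiting exponent of the one-step characteristic function therefore has no
  cross term, and it splits into a factor in \<theta> and a kernel in the heights; nonnegativity
  constrains the heights only. The constants are one-step variances: 2/9 for the level indicator,
  which after division by 2 is the variance of -B/3 at time 1, and 2/3 for the increment, which
  gives the height limit \<open>Bex / sqrt 3\<close>, of which ascents and descents see plus and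
  minus one half.

  Level counts are not Markovian across the given times, but their increments over blocks are
  additive. This is why the characteristic function is taken with one frequency per block for the
  levels and one frequency per cut for the heights: each block then contributes exactly one
  kernel.\<close>

inductive_set trig_polynomials :: "('b::euclidean_space \<Rightarrow> complex) set" where
  monomial: "(\<lambda>x. c * iexp (t \<bullet> x)) \<in> trig_polynomials"
| add: "f \<in> trig_polynomials \<Longrightarrow> g \<in> trig_polynomials \<Longrightarrow> (\<lambda>x. f x + g x) \<in> trig_polynomials"

lemma trig_polynomials_const: "(\<lambda>x. c) \<in> trig_polynomials"
  using trig_polynomials.monomial[of c 0] by simp

lemma trig_polynomials_mult:
  assumes "f \<in> trig_polynomials" "g \<in> trig_polynomials"
  shows "(\<lambda>x. f x * g x) \<in> trig_polynomials"
proof -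
  have monomial: "(\<lambda>x. c * iexp (t \<bullet> x) * g x) \<in> trig_polynomials" for c t
    using assms(2)
  proof (induction rule: trig_polynomials.induct)
    case (monomial d s)
    have "(\<lambda>x. c * iexp (t \<bullet> x) * (d * iexp (s \<bullet> x))) = (\<lambda>x. (c * d) * iexp ((t + s) \<bullet> x))"
      by (auto simp: inner_add_left exp_add algebra_simps)
    then show ?case
      by (metis trig_polynomials.monomial)
  next
    case (add f g)
    then show ?case
      by (simp add: distrib_left trig_polynomials.add)
  qed
  show ?thesis
    using assms(1)
    by (induction rule: trig_polynomials.induct)
      (simp_all add: monomial distrib_right trig_polynomials.add)
qed

lemma trig_polynomials_sum:
  "(\<And>i. i \<in> I \<Longrightarrow> f i \<in> trig_polynomials) \<Longrightarrow> (\<lambda>x. \<Sum>i\<in>I. f i x) \<in> trig_polynomials"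
  by (induction I rule: infinite_finite_induct)
    (auto intro: trig_polynomials_const trig_polynomials.add)

lemma trig_polynomials_sin:
  "(\<lambda>x. complex_of_real (sin (k * (x \<bullet> b)))) \<in> trig_polynomials"
proof -
  have "complex_of_real (sin (k * (x \<bullet> b))) =
      (- \<i> / 2) * iexp ((k *\<^sub>R b) \<bullet> x) + (\<i> / 2) * iexp ((- k *\<^sub>R b) \<bullet> x)" for x
    by (simp add: sin_of_real[symmetric] sin_exp_eq inner_commute field_simps)
  then show ?thesis
    by (simp only: trig_polynomials.intros)
qed

text \<open>Trigonometric polynomials form an algebra containing the coordinate sines, and a
  polynomial function is built from linear maps and constants by sums and products.\<close>

lemma trig_polynomials_polynomial_sin:
  fixes p :: "'b::euclidean_space \<Rightarrow> real"
  assumes "real_polynomial_function p"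
  shows "(\<lambda>x. complex_of_real (p (\<Sum>b\<in>Basis. sin (k * (x \<bullet> b)) *\<^sub>R b))) \<in> trig_polynomials"
  using assms
proof (induction rule: real_polynomial_function.induct)
  case (linear f)
  then interpret bounded_linear f .
  have "complex_of_real (f (\<Sum>b\<in>Basis. sin (k * (x \<bullet> b)) *\<^sub>R b)) =
      (\<Sum>b\<in>Basis. of_real (f b) * of_real (sin (k * (x \<bullet> b))))" for x :: 'b
    by (simp add: sum scaleR mult.commute)
  then show ?case
    by (auto intro!: trig_polynomials_sum trig_polynomials_mult trig_polynomials_const
        trig_polynomials_sin)
next
  case (const c)
  show ?case
    by (rule trig_polynomials_const)
next
  case (add f g)
  then show ?case
    by (simp add: trig_polynomials.add)
next
  case (mult f g)
  then show ?case
    by (simp add: trig_polynomials_mult)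
qed

text \<open>Convergence of characteristic functions is the monomial case and linearity does the
  rest. Integrability is carried along because additivity of the integral asks for it.\<close>

lemma trig_polynomials_tendsto:
  fixes \<mu> :: "nat \<Rightarrow> 'b::euclidean_space measure"
  assumes "\<And>n. prob_space (\<mu> n)" "\<And>n. sets (\<mu> n) = sets borel"
    and "prob_space \<nu>" "sets \<nu> = sets borel"
    and lim: "\<And>t. (\<lambda>n. \<integral>x. iexp (t \<bullet> x) \<partial>\<mu> n) \<longlonglongrightarrow> (\<integral>x. iexp (t \<bullet> x) \<partial>\<nu>)"
    and "f \<in> trig_polynomials"
  shows "(\<forall>n. integrable (\<mu> n) f) \<and> integrable \<nu> f \<and> (\<lambda>n. integral\<^sup>L (\<mu> n) f) \<longlonglongrightarrow> integral\<^sup>L \<nu> f"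
  using assms(6)
proof (induction rule: trig_polynomials.induct)
  case (monomial c t)
  have "integrable N (\<lambda>x. iexp (t \<bullet> x))" if "prob_space N" "sets N = sets borel" for N
  proof -
    interpret prob_space N by fact
    note [measurable_cong] = that(2)
    show ?thesis
      by (rule integrable_const_bound[of _ 1]) (auto simp: norm_exp_i_times)
  qed
  with assms show ?case
    by (auto intro!: tendsto_intros)
next
  case (add f g)
  then show ?case
    by (auto intro!: tendsto_intros)
qed

text \<open>Tightness comes from the one-dimensional continuity theorem applied to the coordinates. On a
  cube \<open>[-R,R]\<^sup>d\<close> the map \<open>x \<mapsto> (sin (\<pi> x\<^sub>b / (2 R)))\<^sub>b\<close> is injective, so that a polynomial in these
  sines, which is a trigonometric polynomial bounded on the whole space, approximates the test
  function on the cube.\<close>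

lemma levy_continuity_euclidean:
  fixes \<mu> :: "nat \<Rightarrow> 'b::euclidean_space measure"
  assumes prob: "\<And>n. prob_space (\<mu> n)" and sets: "\<And>n. sets (\<mu> n) = sets borel"
    and prob': "prob_space \<nu>" and sets': "sets \<nu> = sets borel"
    and lim: "\<And>t. (\<lambda>n. \<integral>x. iexp (t \<bullet> x) \<partial>\<mu> n) \<longlonglongrightarrow> (\<integral>x. iexp (t \<bullet> x) \<partial>\<nu>)"
  shows "weak_conv \<mu> \<nu>"
  unfolding weak_conv_def
proof (intro allI impI)
  fix f :: "'b \<Rightarrow> real"
  assume f: "continuous_on UNIV f \<and> bounded (range f)"
  note [measurable_cong] = sets sets'
  from f obtain C where C: "\<And>x. \<bar>f x\<bar> \<le> C"
    by (auto simp: bounded_iff)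
  have C0: "0 \<le> C" using C[of 0] by simp
  interpret N: prob_space \<nu> by fact
  interpret P: prob_space "\<mu> n" for n by fact
  have fm [measurable]: "f \<in> borel_measurable borel"
    using f by (auto intro: borel_measurable_continuous_onI)
  \<comment> \<open>\<open>T R\<close> is a continuous substitute for the indicator of the
    complement of a cube: it vanishes on the cube of half-side \<open>R\<close> and is at least 1
    outside that of half-side \<open>R + 1\<close>. As a sum of functions of single coordinates it
    is within reach of the one-dimensional theorem.\<close>
  define T where "T R x = (\<Sum>b\<in>Basis. min 1 (max 0 (\<bar>x \<bullet> b\<bar> - R)))" for R and x :: 'b
  have T0: "0 \<le> T R x" for R x
    unfolding T_def by (intro sum_nonneg) auto
  have T_bd: "T R x \<le> DIM('b)" for R x
    unfolding T_def by (rule order_trans[OF sum_bounded_above[where K=1]]) auto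
  have T1: "1 \<le> T R x" if "b \<in> Basis" "R + 1 \<le> \<bar>x \<bullet> b\<bar>" for R x b
  proof -
    have "1 \<le> min 1 (max 0 (\<bar>x \<bullet> b\<bar> - R))" using that by auto
    also have "\<dots> \<le> T R x"
      unfolding T_def using that(1)
      by (intro member_le_sum) auto
    finally show ?thesis .
  qed
  have T_meas [measurable]: "T R \<in> borel_measurable borel" for R
    unfolding T_def by measurable
  have T_int: "integrable (\<mu> n) (T R)" "integrable \<nu> (T R)" for n R
    using T0 T_bd by (auto intro!: P.integrable_const_bound[of _ "DIM('b)"]
        N.integrable_const_bound[of _ "DIM('b)"])
  have T_lim: "(\<lambda>n. integral\<^sup>L (\<mu> n) (T R)) \<longlonglongrightarrow> integral\<^sup>L \<nu> (T R)" for R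
  proof -
    define g where "g y = min 1 (max 0 (\<bar>y\<bar> - R))" for y :: real
    have g_cont: "continuous_on UNIV g"
      unfolding g_def by (intro continuous_intros)
    then have [measurable]: "g \<in> borel_measurable borel"
      by (auto intro: borel_measurable_continuous_onI)
    have g_bd: "\<bar>g y\<bar> \<le> 1" for y by (auto simp: g_def)
    have g_lim: "(\<lambda>n. \<integral>x. g (x \<bullet> b) \<partial>\<mu> n) \<longlonglongrightarrow> (\<integral>x. g (x \<bullet> b) \<partial>\<nu>)" for b
    proof -
      have rd: "real_distribution (distr (\<mu> n) borel (\<lambda>x. x \<bullet> b))" for n
        by (auto intro!: P.real_distribution_distr)
      have rd': "real_distribution (distr \<nu> borel (\<lambda>x. x \<bullet> b))"
        by (auto intro!: N.real_distribution_distr)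
      have "weak_conv_m (\<lambda>n. distr (\<mu> n) borel (\<lambda>x. x \<bullet> b)) (distr \<nu> borel (\<lambda>x. x \<bullet> b))"
      proof (rule levy_continuity[OF rd rd'])
        fix t
        show "(\<lambda>n. char (distr (\<mu> n) borel (\<lambda>x. x \<bullet> b)) t) \<longlonglongrightarrow> char (distr \<nu> borel (\<lambda>x. x \<bullet> b)) t"
          using lim[of "t *\<^sub>R b"]
          by (simp add: char_def integral_distr inner_commute)
      qed
      from weak_conv_imp_integral_bdd_continuous_conv[OF rd rd' this, of g 1] g_bd g_cont
      show ?thesis
        by (simp add: integral_distr continuous_on_eq_continuous_at)
    qed
    have "integrable (\<mu> n) (\<lambda>x. g (x \<bullet> b))" "integrable \<nu> (\<lambda>x. g (x \<bullet> b))" for n b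
      using g_bd by (auto intro!: P.integrable_const_bound[of _ 1] N.integrable_const_bound[of _ 1])
    then show ?thesis
      unfolding T_def g_def[symmetric]
      by (auto intro!: tendsto_sum g_lim simp: Bochner_Integration.integral_sum)
  qed
  have T_small: "(\<lambda>k. integral\<^sup>L \<nu> (T (real k))) \<longlonglongrightarrow> 0"
  proof -
    have "(\<lambda>k. integral\<^sup>L \<nu> (T (real k))) \<longlonglongrightarrow> integral\<^sup>L \<nu> (\<lambda>x. 0)"
    proof (rule integral_dominated_convergence[where w="\<lambda>_. DIM('b)"])
      show "AE x in \<nu>. (\<lambda>k. T (real k) x) \<longlonglongrightarrow> 0"
      proof (rule AE_I2)
        fix x :: 'b
        obtain k0 :: nat where k0: "norm x \<le> k0" using real_arch_simple by blast
        have "T (real k) x = 0" if "k \<ge> k0" for k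
          unfolding T_def
        proof (intro sum.neutral ballI)
          fix b :: 'b assume "b \<in> Basis"
          then have "\<bar>x \<bullet> b\<bar> \<le> norm x" by (rule Basis_le_norm)
          with k0 that show "min 1 (max 0 (\<bar>x \<bullet> b\<bar> - real k)) = 0" by auto
        qed
        then show "(\<lambda>k. T (real k) x) \<longlonglongrightarrow> 0"
          by (intro tendsto_eventually) (auto simp: eventually_at_top_linorder)
      qed
    qed (use T0 T_bd in \<open>auto simp: measurable_completion\<close>)
    then show ?thesis by simp
  qed
  show "(\<lambda>n. integral\<^sup>L (\<mu> n) f) \<longlonglongrightarrow> integral\<^sup>L \<nu> f"
  proof (rule LIMSEQ_I)
    fix r :: real assume r: "0 < r"
    \<comment> \<open>Error budget: replacing \<open>f\<close> by \<open>q\<close> costs at most r/8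
      + r/8 under each of the two measures, and passing from one integral of \<open>q\<close> to the
      other costs r/8. The cap at 1 bounds \<open>(2 * C + e) * (e / 2)\<close> by
      \<open>(C + 1) * e\<close>.\<close>
    define e where "e = min 1 (r / (8 * (C + 1)))"
    have e: "0 < e" "e \<le> 1" "(C + 1) * e \<le> r / 8"
    proof -
      show "0 < e" "e \<le> 1" using r C0 by (auto simp: e_def)
      have "e \<le> r / (8 * (C + 1))" by (simp add: e_def)
      then show "(C + 1) * e \<le> r / 8"
        using C0 by (simp add: pos_le_divide_eq algebra_simps)
    qed
    have e8: "e \<le> r / 8"
      using mult_right_mono[of 1 "C + 1" e] e C0 by linarith
    from order_tendstoD(2)[OF T_small, of "e / 2"] e(1)
    obtain k :: nat where k: "integral\<^sup>L \<nu> (T (real k)) < e / 2"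
      by (auto simp: eventually_at_top_linorder)
    \<comment> \<open>The shift by 1 makes \<open>T (real k)\<close> at least 1 wherever some
      coordinate exceeds \<open>R\<close>.\<close>
    define R where "R = real k + 1"
    have R: "0 < R" by (simp add: R_def)
    \<comment> \<open>\<open>h\<close> is \<open>f\<close> read through the inverse of the sine map.
      Since the sine map \<open>u\<close> below takes values in \<open>S\<close> everywhere, the
      approximation of \<open>h\<close> on \<open>S\<close> bounds \<open>p (u x)\<close> also where
      it has nothing to do with \<open>f x\<close>.\<close>
    define h where "h s = f (\<Sum>b\<in>Basis. (2 * R / pi * arcsin (s \<bullet> b)) *\<^sub>R b)" for s
    define S where "S = cbox (- One) (One :: 'b)"
    have "continuous_on S (\<lambda>s. (\<Sum>b\<in>Basis. (2 * R / pi * arcsin (s \<bullet> b)) *\<^sub>R b))"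
      unfolding S_def by (intro continuous_intros) (auto simp: mem_box)
    then have "continuous_on S h"
      unfolding h_def
      by (rule continuous_on_compose2[of UNIV f, rotated]) (use f in auto)
    then obtain p where p: "real_polynomial_function p" "\<And>s. s \<in> S \<Longrightarrow> \<bar>h s - p s\<bar> < e"
      using Stone_Weierstrass_real_polynomial_function[of S h e] e(1) by (auto simp: S_def)
    define u where "u x = (\<Sum>b\<in>Basis. sin (pi / (2 * R) * (x \<bullet> b)) *\<^sub>R b)" for x :: 'b
    have uS: "u x \<in> S" for x
      by (auto simp: S_def mem_box u_def)
    define q where "q x = p (u x)" for x
    have q_bd: "\<bar>q x\<bar> \<le> C + e" for x
      using p(2)[OF uS[of x]] C[of "\<Sum>b\<in>Basis. (2 * R / pi * arcsin (u x \<bullet> b)) *\<^sub>R b"]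
      by (auto simp: q_def h_def)
    have q_close: "\<bar>f x - q x\<bar> < e" if "\<And>b. b \<in> Basis \<Longrightarrow> \<bar>x \<bullet> b\<bar> \<le> R" for x
    proof -
      have "arcsin (sin (pi / (2 * R) * (x \<bullet> b))) = pi / (2 * R) * (x \<bullet> b)" if b: "b \<in> Basis" for b
      proof (rule arcsin_sin)
        have "- R \<le> x \<bullet> b" "x \<bullet> b \<le> R" using \<open>\<And>b. b \<in> Basis \<Longrightarrow> \<bar>x \<bullet> b\<bar> \<le> R\<close>[OF b] by auto
        then show "- (pi / 2) \<le> pi / (2 * R) * (x \<bullet> b)" "pi / (2 * R) * (x \<bullet> b) \<le> pi / 2"
          using R mult_left_mono[of "- R" "x \<bullet> b" "pi / (2 * R)"]
            mult_left_mono[of "x \<bullet> b" R "pi / (2 * R)"] by auto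
      qed
      then have "(\<Sum>b\<in>Basis. (2 * R / pi * arcsin (u x \<bullet> b)) *\<^sub>R b) = (\<Sum>b\<in>Basis. (x \<bullet> b) *\<^sub>R b)"
        using R by (intro sum.cong) (auto simp: u_def)
      then have "h (u x) = f x"
        by (simp add: h_def euclidean_representation)
      then show ?thesis
        using p(2)[OF uS[of x]] by (simp add: q_def)
    qed
    have q_all: "\<bar>f x - q x\<bar> \<le> e + (2 * C + e) * T (real k) x" for x
    proof (cases "\<forall>b\<in>Basis. \<bar>x \<bullet> b\<bar> \<le> R")
      case True
      then show ?thesis
        using q_close[of x] mult_nonneg_nonneg[OF _ T0, of "2 * C + e" "real k" x] C0 e(1) by auto
    next
      case False
      then have "1 \<le> T (real k) x"
        using T1[of _ "real k" x] by (force simp: R_def)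
      then have "2 * C + e \<le> (2 * C + e) * T (real k) x"
        using C0 e(1) mult_left_mono[of 1 "T (real k) x" "2 * C + e"] by simp
      then show ?thesis
        using C[of x] q_bd[of x] e(1) by auto
    qed
    have q_trig: "(\<lambda>x. complex_of_real (q x)) \<in> trig_polynomials"
      unfolding q_def u_def by (rule trig_polynomials_polynomial_sin) fact
    note q_lims = trig_polynomials_tendsto[OF prob sets prob' sets' lim q_trig]
    have q_int: "integrable (\<mu> n) q" "integrable \<nu> q" for n
      using q_lims by (auto simp: complex_of_real_integrable_eq)
    have q_lim: "(\<lambda>n. integral\<^sup>L (\<mu> n) q) \<longlonglongrightarrow> integral\<^sup>L \<nu> q"
      using q_lims by (auto simp: tendsto_of_real_iff)
    have f_int: "integrable (\<mu> n) f" "integrable \<nu> f" for n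
      using C by (auto intro!: P.integrable_const_bound[of _ C] N.integrable_const_bound[of _ C])
    have close: "\<bar>integral\<^sup>L \<rho> f - integral\<^sup>L \<rho> q\<bar> \<le> e + (2 * C + e) * integral\<^sup>L \<rho> (T (real k))"
      if "prob_space \<rho>" "integrable \<rho> f" "integrable \<rho> q" "integrable \<rho> (T (real k))" for \<rho>
    proof -
      interpret prob_space \<rho> by fact
      have "\<bar>integral\<^sup>L \<rho> f - integral\<^sup>L \<rho> q\<bar> = \<bar>\<integral>x. f x - q x \<partial>\<rho>\<bar>"
        using that by simp
      also have "\<dots> \<le> (\<integral>x. \<bar>f x - q x\<bar> \<partial>\<rho>)"
        by (rule integral_abs_bound)
      also have "\<dots> \<le> (\<integral>x. e + (2 * C + e) * T (real k) x \<partial>\<rho>)"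
        using that by (intro integral_mono q_all) auto
      also have "\<dots> = e + (2 * C + e) * integral\<^sup>L \<rho> (T (real k))"
        using that by (simp add: prob_space)
      finally show ?thesis .
    qed
    have "\<forall>\<^sub>F n in sequentially. integral\<^sup>L (\<mu> n) (T (real k)) < e / 2"
      using order_tendstoD(2)[OF T_lim k] .
    moreover have "\<forall>\<^sub>F n in sequentially. \<bar>integral\<^sup>L (\<mu> n) q - integral\<^sup>L \<nu> q\<bar> < e"
      using tendstoD[OF q_lim e(1)] by (simp add: dist_real_def)
    ultimately have "\<forall>\<^sub>F n in sequentially. norm (integral\<^sup>L (\<mu> n) f - integral\<^sup>L \<nu> f) < r"
    proof eventually_elim
      case (elim n)
      have "\<bar>integral\<^sup>L (\<mu> n) f - integral\<^sup>L (\<mu> n) q\<bar> \<le> e + (2 * C + e) * (e / 2)"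
        by (rule order_trans[OF close[OF prob f_int(1) q_int(1) T_int(1)]])
          (use elim C0 e(1) in \<open>auto intro!: mult_left_mono\<close>)
      moreover have "\<bar>integral\<^sup>L \<nu> f - integral\<^sup>L \<nu> q\<bar> \<le> e + (2 * C + e) * (e / 2)"
        by (rule order_trans[OF close[OF prob' f_int(2) q_int(2) T_int(2)]])
          (use k C0 e(1) in \<open>auto intro!: mult_left_mono\<close>)
      moreover have "(2 * C + e) * (e / 2) \<le> r / 8"
      proof -
        have "(2 * C + e) * (e / 2) \<le> (2 * C + 2) * (e / 2)"
          using e by (intro mult_right_mono) auto
        also have "\<dots> = (C + 1) * e" by (simp add: field_simps)
        finally show ?thesis using e(3) by linarith
      qed
      ultimately show ?case
        unfolding real_norm_def using elim(2) e8 r by linarith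
    qed
    then show "\<exists>no. \<forall>n\<ge>no. norm (integral\<^sup>L (\<mu> n) f - integral\<^sup>L \<nu> f) < r"
      by (simp add: eventually_at_top_linorder)
  qed
qed

text \<open>The dominating functions \<open>p n\<close> vary with \<open>n\<close>, so dominated
  convergence does not apply directly. Write \<open>q n = p n * r n\<close> with \<open>r n\<close>
  bounded by 1: the part \<open>(p n - p') * r n\<close> tends to 0 in L1 by Scheffe's lemma, and
  the part \<open>p' * r n\<close> has the fixed dominator \<open>p'\<close>.\<close>

lemma scheffe_dominated:
  fixes p :: "nat \<Rightarrow> 'a \<Rightarrow> real" and q :: "nat \<Rightarrow> 'a \<Rightarrow> complex"
  assumes [measurable]: "\<And>n. p n \<in> borel_measurable M" "\<And>n. q n \<in> borel_measurable M"
      "q' \<in> borel_measurable M"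
    and p_mass: "\<And>n. (\<integral>\<^sup>+x. ennreal (p n x) \<partial>M) = (\<integral>\<^sup>+x. ennreal (p' x) \<partial>M)"
    and p'_int: "integrable M p'" and p'_nonneg: "\<And>x. 0 \<le> p' x"
    and q_le: "\<And>n x. cmod (q n x) \<le> p n x"
    and p_lim: "AE x in M. (\<lambda>n. p n x) \<longlonglongrightarrow> p' x"
    and q_lim: "AE x in M. (\<lambda>n. q n x) \<longlonglongrightarrow> q' x"
  shows "(\<lambda>n. integral\<^sup>L M (q n)) \<longlonglongrightarrow> integral\<^sup>L M q'"
proof -
  have [measurable]: "p' \<in> borel_measurable M" using p'_int by simp
  have p_nonneg: "0 \<le> p n x" for n x
    using q_le[of n x] norm_ge_zero order_trans by blast
  have p'_fin: "(\<integral>\<^sup>+x. ennreal (p' x) \<partial>M) < \<infinity>"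
    using p'_int p'_nonneg by (simp add: nn_integral_eq_integral)
  have p_int: "integrable M (p n)" for n
    by (rule integrableI_bounded) (use p_mass[of n] p'_fin p_nonneg in auto)
  have q_int: "integrable M (q n)" for n
    by (rule Bochner_Integration.integrable_bound[OF p_int]) (use q_le p_nonneg in auto)
  have L1: "(\<lambda>n. \<integral>\<^sup>+x. norm (p n x - p' x) \<partial>M) \<longlonglongrightarrow> 0"
    by (rule Scheffe_lemma2) (use p'_int p_lim p_mass p_nonneg p'_nonneg in auto)
  define r where "r n x = (if p n x = 0 then 0 else q n x / p n x)" for n x
  have [measurable]: "r n \<in> borel_measurable M" for n
    unfolding r_def by measurable
  have q_eq: "q n x = p n x * r n x" for n x
    using q_le[of n x] by (auto simp: r_def)
  have r_le: "norm (r n x) \<le> 1" for n x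
    using q_le[of n x] p_nonneg[of n x] by (auto simp: r_def norm_divide field_simps)
  have diff_int: "integrable M (\<lambda>x. complex_of_real (p n x - p' x) * r n x)" for n
  proof (rule Bochner_Integration.integrable_bound[of M "\<lambda>x. p n x - p' x"])
    show "AE x in M. norm (complex_of_real (p n x - p' x) * r n x) \<le> norm (p n x - p' x)"
      using r_le by (auto simp: norm_mult mult_left_le simp flip: of_real_diff)
  qed (use p_int p'_int in auto)
  have p'r_int: "integrable M (\<lambda>x. complex_of_real (p' x) * r n x)" for n
  proof (rule Bochner_Integration.integrable_bound[of M p'])
    show "AE x in M. norm (complex_of_real (p' x) * r n x) \<le> norm (p' x)"
      using r_le by (auto simp: norm_mult mult_left_le)
  qed (use p'_int in auto)
  have "(\<lambda>n. \<integral>x. complex_of_real (p n x - p' x) * r n x \<partial>M) \<longlonglongrightarrow> integral\<^sup>L M (\<lambda>x. 0)"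
  proof (rule tendsto_L1_int)
    have "(\<integral>\<^sup>+x. norm (complex_of_real (p n x - p' x) * r n x - 0) \<partial>M)
        \<le> (\<integral>\<^sup>+x. norm (p n x - p' x) \<partial>M)" for n
      using r_le by (intro nn_integral_mono)
        (auto simp: norm_mult mult_left_le simp flip: of_real_diff)
    then show "(\<lambda>n. \<integral>\<^sup>+x. norm (complex_of_real (p n x - p' x) * r n x - 0) \<partial>M) \<longlonglongrightarrow> 0"
      by (intro tendsto_sandwich[OF _ _ tendsto_const L1]) auto
  qed (use diff_int in auto)
  \<comment> \<open>Where \<open>p'\<close> vanishes the ratios \<open>r n\<close> may oscillate;
    what converges is the product with \<open>p'\<close>, because it differs from \<open>q n\<close>
    by at most the distance of \<open>p n\<close> from \<open>p'\<close>.\<close>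
  moreover have "(\<lambda>n. \<integral>x. complex_of_real (p' x) * r n x \<partial>M) \<longlonglongrightarrow> integral\<^sup>L M q'"
  proof (rule integral_dominated_convergence[where w=p'])
    show "AE x in M. (\<lambda>n. complex_of_real (p' x) * r n x) \<longlonglongrightarrow> q' x"
      using p_lim q_lim
    proof eventually_elim
      case (elim x)
      have "(\<lambda>n. complex_of_real (p' x - p n x)) \<longlonglongrightarrow> 0"
        using tendsto_of_real[OF tendsto_diff[OF tendsto_const[of "p' x"] elim(1)]] by simp
      then have "(\<lambda>n. complex_of_real (p' x - p n x) * r n x) \<longlonglongrightarrow> 0"
        by (rule Lim_null_comparison[rotated, OF tendsto_norm_zero])
          (use r_le in \<open>auto simp: norm_mult mult_left_le simp flip: of_real_diff\<close>)
      from tendsto_add[OF this elim(2)] show ?case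
        by (simp add: q_eq algebra_simps)
    qed
    show "AE x in M. norm (complex_of_real (p' x) * r n x) \<le> p' x" for n
      using r_le p'_nonneg by (auto simp: norm_mult mult_left_le)
  qed (use p'_int in auto)
  ultimately have "(\<lambda>n. (\<integral>x. complex_of_real (p n x - p' x) * r n x \<partial>M)
      + (\<integral>x. complex_of_real (p' x) * r n x \<partial>M)) \<longlonglongrightarrow> 0 + integral\<^sup>L M q'"
    by (intro tendsto_add) auto
  moreover have "(\<integral>x. complex_of_real (p n x - p' x) * r n x \<partial>M)
      + (\<integral>x. complex_of_real (p' x) * r n x \<partial>M) = integral\<^sup>L M (q n)" for n
    unfolding Bochner_Integration.integral_add[OF diff_int p'r_int, symmetric]
    by (intro Bochner_Integration.integral_cong) (auto simp: q_eq algebra_simps)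
  ultimately show ?thesis by simp
qed

subsection \<open>Nonnegative paths and their kernels\<close>

definition nonneg_paths :: "nat \<Rightarrow> int \<Rightarrow> int \<Rightarrow> int list set" where
  "nonneg_paths m a b = {\<gamma>. length \<gamma> = m \<and> set \<gamma> \<subseteq> {-1, 0, 1} \<and>
     (\<forall>k\<le>m. 0 \<le> a + sum_list (take k \<gamma>)) \<and> a + sum_list \<gamma> = b}"

lemma finite_nonneg_paths: "finite (nonneg_paths m a b)"
  by (rule finite_subset[OF _ finite_lists_length_eq[of "{-1, 0, 1}" m]])
    (auto simp: nonneg_paths_def)

lemma sum_nth_eq_sum_list_take:
  "k \<le> length \<gamma> \<Longrightarrow> (\<Sum>j=1..k. f (\<gamma> ! (j - 1))) = sum_list (map f (take k \<gamma>))"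
proof -
  assume k: "k \<le> length \<gamma>"
  have "(\<Sum>j=1..k. f (\<gamma> ! (j - 1))) = (\<Sum>j=0..<k. f (\<gamma> ! j))"
    by (rule sum.reindex_bij_witness[of _ Suc "\<lambda>j. j - 1"]) auto
  also have "\<dots> = sum_list (map f (take k \<gamma>))"
    using k by (simp add: sum_list_sum_nth min_absorb2)
  finally show ?thesis .
qed

lemma motzkin_paths_eq: "motzkin_paths n = nonneg_paths n 0 0"
  unfolding motzkin_paths_def nonneg_paths_def
  using sum_nth_eq_sum_list_take[where f="\<lambda>x. x::int"]
  by (intro Collect_cong) auto

lemma nonneg_paths_0: "nonneg_paths 0 a b = (if a = b \<and> 0 \<le> a then {[]} else {})"
  by (auto simp: nonneg_paths_def)

lemma nonneg_paths_end_nonneg: "\<gamma> \<in> nonneg_paths m a b \<Longrightarrow> 0 \<le> b"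
  by (auto simp: nonneg_paths_def)

lemma nonneg_paths_end_le: "\<gamma> \<in> nonneg_paths m a b \<Longrightarrow> b \<le> a + int m"
proof -
  assume \<gamma>: "\<gamma> \<in> nonneg_paths m a b"
  have "sum_list \<gamma> \<le> int (length \<gamma>)" if "set \<gamma> \<subseteq> {-1, 0, 1}" for \<gamma> :: "int list"
    using that by (induction \<gamma>) auto
  with \<gamma> show ?thesis by (fastforce simp: nonneg_paths_def)
qed

lemma append_in_nonneg_paths:
  assumes "\<gamma> \<in> nonneg_paths m a c" "\<delta> \<in> nonneg_paths l c b"
  shows "\<gamma> @ \<delta> \<in> nonneg_paths (m + l) a b"
proof -
  have "0 \<le> a + sum_list (take k (\<gamma> @ \<delta>))" if "k \<le> m + l" for k
  proof (cases "k \<le> m")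
    case True
    then show ?thesis using assms by (auto simp: nonneg_paths_def)
  next
    case False
    with that have "0 \<le> c + sum_list (take (k - m) \<delta>)"
      using assms(2) by (auto simp: nonneg_paths_def)
    then show ?thesis
      using False assms(1) by (auto simp: nonneg_paths_def)
  qed
  then show ?thesis using assms by (auto simp: nonneg_paths_def)
qed

lemma nonneg_paths_take:
  assumes "\<gamma> \<in> nonneg_paths (m + l) a b"
  shows "take m \<gamma> \<in> nonneg_paths m a (a + sum_list (take m \<gamma>))"
  using assms set_take_subset[of m \<gamma>] by (auto simp: nonneg_paths_def min_def)

lemma nonneg_paths_drop:
  assumes "\<gamma> \<in> nonneg_paths (m + l) a b"
  shows "drop m \<gamma> \<in> nonneg_paths l (a + sum_list (take m \<gamma>)) b"
proof -
  have "sum_list (take m \<gamma>) + sum_list (take k (drop m \<gamma>)) = sum_list (take (m + k) \<gamma>)" for k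
    by (simp add: take_add)
  moreover have "sum_list (take m \<gamma>) + sum_list (drop m \<gamma>) = sum_list \<gamma>"
    by (metis append_take_drop_id sum_list_append)
  ultimately show ?thesis
    using assms set_drop_subset[of m \<gamma>] by (auto simp: nonneg_paths_def add.assoc)
qed

text \<open>Markov property at time \<open>m\<close>, with \<open>c\<close> the height at the cut.
  The range of \<open>c\<close> depends only on an upper bound \<open>N\<close>, so that all cuts of
  a path can later share the same finite box of heights.\<close>

lemma sum_nonneg_paths_split:
  fixes \<phi> :: "int list \<Rightarrow> 'c::comm_monoid_add"
  assumes "a + int m \<le> N"
  shows "(\<Sum>\<gamma>\<in>nonneg_paths (m + l) a b. \<phi> \<gamma>) =
    (\<Sum>c\<in>{0..N}. \<Sum>\<gamma>\<in>nonneg_paths m a c. \<Sum>\<delta>\<in>nonneg_paths l c b. \<phi> (\<gamma> @ \<delta>))"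
proof -
  have "(\<Sum>c\<in>{0..N}. \<Sum>\<gamma>\<in>nonneg_paths m a c. \<Sum>\<delta>\<in>nonneg_paths l c b. \<phi> (\<gamma> @ \<delta>)) =
     (\<Sum>(c, \<gamma>, \<delta>)\<in>(SIGMA c:{0..N}. nonneg_paths m a c \<times> nonneg_paths l c b). \<phi> (\<gamma> @ \<delta>))"
    by (simp add: sum.Sigma sum.cartesian_product finite_nonneg_paths)
  also have "\<dots> = (\<Sum>\<gamma>\<in>nonneg_paths (m + l) a b. \<phi> \<gamma>)"
  proof (rule sum.reindex_bij_witness[of _
        "\<lambda>\<gamma>. (a + sum_list (take m \<gamma>), take m \<gamma>, drop m \<gamma>)" "\<lambda>(c, \<gamma>, \<delta>). \<gamma> @ \<delta>"])
    fix \<gamma> assume \<gamma>: "\<gamma> \<in> nonneg_paths (m + l) a b"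
    from nonneg_paths_take[OF this] nonneg_paths_drop[OF this]
    show "(a + sum_list (take m \<gamma>), take m \<gamma>, drop m \<gamma>)
        \<in> (SIGMA c:{0..N}. nonneg_paths m a c \<times> nonneg_paths l c b)"
      using assms nonneg_paths_end_nonneg[OF nonneg_paths_take[OF \<gamma>]]
        nonneg_paths_end_le[OF nonneg_paths_take[OF \<gamma>]] by auto
  next
    fix x assume "x \<in> (SIGMA c:{0..N}. nonneg_paths m a c \<times> nonneg_paths l c b)"
    then obtain c \<gamma> \<delta> where x: "x = (c, \<gamma>, \<delta>)" "\<gamma> \<in> nonneg_paths m a c" "\<delta> \<in> nonneg_paths l c b"
      by auto
    then have "length \<gamma> = m" "a + sum_list \<gamma> = c"
      by (auto simp: nonneg_paths_def)
    with x append_in_nonneg_paths[OF x(2,3)]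
    show "(a + sum_list (take m (case x of (c, \<gamma>, \<delta>) \<Rightarrow> \<gamma> @ \<delta>)),
        take m (case x of (c, \<gamma>, \<delta>) \<Rightarrow> \<gamma> @ \<delta>), drop m (case x of (c, \<gamma>, \<delta>) \<Rightarrow> \<gamma> @ \<delta>)) = x"
      "(case x of (c, \<gamma>, \<delta>) \<Rightarrow> \<gamma> @ \<delta>) \<in> nonneg_paths (m + l) a b"
      by auto
  qed auto
  finally show ?thesis by simp
qed

section \<open>Spectral formula for the level-weighted path counts\<close>

definition path_kernel :: "complex \<Rightarrow> nat \<Rightarrow> int \<Rightarrow> int \<Rightarrow> complex" where
  "path_kernel z m a b = (\<Sum>\<gamma>\<in>nonneg_paths m a b. z ^ count_list \<gamma> 0)"

lemma path_kernel_neg: "b < 0 \<Longrightarrow> path_kernel z m a b = 0"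
  unfolding path_kernel_def by (intro sum.neutral) (auto dest: nonneg_paths_end_nonneg)

text \<open>Remove the last step. At \<open>b = -1\<close> the recurrence can fail: the left side is
  0, while paths ending at height 0 would still contribute on the right.\<close>

lemma path_kernel_Suc:
  assumes "0 \<le> b"
  shows "path_kernel z (Suc m) a b =
    path_kernel z m a (b - 1) + z * path_kernel z m a b + path_kernel z m a (b + 1)"
proof -
  have split: "nonneg_paths (Suc m) a b =
      (\<lambda>\<gamma>. \<gamma> @ [1]) ` nonneg_paths m a (b - 1) \<union> (\<lambda>\<gamma>. \<gamma> @ [0]) ` nonneg_paths m a b
      \<union> (\<lambda>\<gamma>. \<gamma> @ [-1]) ` nonneg_paths m a (b + 1)" (is "?L = ?R")
  proof
    show "?L \<subseteq> ?R"
    proof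
      fix \<gamma> assume \<gamma>: "\<gamma> \<in> nonneg_paths (Suc m) a b"
      then have len: "length \<gamma> = Suc m" and "set \<gamma> \<subseteq> {-1, 0, 1}" "a + sum_list \<gamma> = b"
        by (auto simp: nonneg_paths_def)
      then obtain \<delta> e where e: "\<gamma> = \<delta> @ [e]"
        by (metis length_Suc_conv_rev)
      with len have "take m \<gamma> = \<delta>" by simp
      with nonneg_paths_take[of \<gamma> m 1 a b] \<gamma> e have "\<delta> \<in> nonneg_paths m a (b - e)"
        by (auto simp: nonneg_paths_def)
      moreover have "e \<in> {-1, 0, 1}"
        using \<open>set \<gamma> \<subseteq> {-1, 0, 1}\<close> e by auto
      ultimately show "\<gamma> \<in> ?R" using e by auto
    qed
    have step: "[e] \<in> nonneg_paths 1 (b - e) b"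
      if "0 \<le> b - e" "e \<in> {-1, 0, 1}" for e
      using that assms by (auto simp: nonneg_paths_def le_Suc_eq)
    show "?R \<subseteq> ?L"
      using append_in_nonneg_paths[where l=1 and m=m and a=a and b=b]
        step[of 1] step[of 0] step[of "-1"] nonneg_paths_end_nonneg by fastforce
  qed
  have inj: "inj_on (\<lambda>\<gamma>. \<gamma> @ [e]) A" for e :: int and A
    by (simp add: inj_on_def)
  show ?thesis
    unfolding path_kernel_def split
    by (subst sum.union_disjoint sum.reindex[OF inj];
        auto simp: finite_nonneg_paths sum.reindex[OF inj] sum_distrib_left)+
qed

lemma integral_cos_period:
  fixes k :: int
  shows "(LINT u:{-pi..pi}|lborel. cos (k * u)) = (if k = 0 then 2 * pi else 0)"
proof (cases "k = 0")
  case False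
  have "(\<integral>u. cos (k * u) * indicator {-pi..pi} u \<partial>lborel) = sin (k * pi) / k - sin (k * - pi) / k"
    by (rule integral_FTC_Icc_real)
      (use False in \<open>auto intro!: derivative_eq_intros continuous_intros\<close>)
  then show ?thesis
    using False sin_int_times_real[of k]
    by (simp add: set_lebesgue_integral_def mult.commute)
qed (simp add: set_lebesgue_integral_def)

text \<open>For each \<open>u\<close> the function \<open>sin ((b + 1) * u)\<close> of
  \<open>b\<close> is an eigenfunction of the step operator on the half-line with zero boundary
  value at -1, with eigenvalue \<open>z + 2 * cos u\<close>; the formula is the resulting spectral
  decomposition. The value \<open>b = -1\<close> is included because the recurrence at height 0
  refers to it.\<close>

lemma path_kernel_eq_integral:
  fixes z :: complex
  assumes "0 \<le> a" "-1 \<le> b"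
  shows "path_kernel z m a b = 1 / pi * (LINT u:{-pi..pi}|lborel.
    (z + 2 * cos u) ^ m * (sin ((a + 1) * u) * sin ((b + 1) * u)))"
  using assms(2)
proof (induction m arbitrary: b)
  case 0
  have "set_integrable lborel {-pi..pi} (\<lambda>u. cos (k * u))" for k :: real
    unfolding set_integrable_def
    by (rule borel_integrable_compact) (auto intro!: continuous_intros)
  note int = this[of "real_of_int (a - b)"] this[of "real_of_int (a + b + 2)"]
  have "(LINT u:{-pi..pi}|lborel. sin ((a + 1) * u) * sin ((b + 1) * u)) =
      (LINT u:{-pi..pi}|lborel. (cos (real_of_int (a - b) * u) - cos (real_of_int (a + b + 2) * u)) / 2)"
    by (intro set_lebesgue_integral_cong) (auto simp: sin_times_sin algebra_simps)
  \<comment> \<open>The frequency \<open>a + b + 2\<close> is at least 1, so its integral vanishes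
    and only the case \<open>a = b\<close> survives.\<close>
  also have "\<dots> = ((if a - b = 0 then 2 * pi else 0) - (if a + b + 2 = 0 then 2 * pi else 0)) / 2"
    by (simp only: set_integral_divide_zero set_integral_diff(2)[OF int] integral_cos_period)
  also have "\<dots> = (if a = b then pi else 0)"
    using assms(1) 0 by auto
  finally have "(LINT u:{-pi..pi}|lborel. sin ((a + 1) * u) * sin ((b + 1) * u)) =
      (if a = b then pi else 0)" .
  then show ?case
    using assms(1) by (auto simp: path_kernel_def nonneg_paths_0 set_integral_complex_of_real
        simp flip: of_real_mult)
next
  case (Suc m)
  define f where "f b u = (z + 2 * cos u) ^ m * (sin ((a + 1) * u) * sin ((b + 1) * u))"
    for b :: int and u :: real
  have int: "set_integrable lborel {-pi..pi} (f b)" for b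
    unfolding set_integrable_def f_def
    by (rule borel_integrable_compact) (auto intro!: continuous_intros)
  show ?case
  proof (cases "b = -1")
    case True
    then show ?thesis by (simp add: path_kernel_neg)
  next
    case False
    with Suc.prems have b: "0 \<le> b" by simp
    have trig: "f (b - 1) u + z * f b u + f (b + 1) u =
      (z + 2 * cos u) ^ Suc m * (sin ((a + 1) * u) * sin ((b + 1) * u))" for u :: real
    proof -
      have "sin (b * u) + sin ((b + 2) * u) = 2 * cos u * sin ((b + 1) * u)"
        using sin_add[of "(b + 1) * u" u] sin_diff[of "(b + 1) * u" u] by (simp add: algebra_simps)
      then have "complex_of_real (sin (b * u)) + complex_of_real (sin ((b + 2) * u)) =
          2 * cos u * sin ((b + 1) * u)"
        by (metis of_real_add of_real_mult of_real_numeral)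
      moreover have "f (b - 1) u + z * f b u + f (b + 1) u =
         (z + 2 * cos u) ^ m * sin ((a + 1) * u) * (z * sin ((b + 1) * u)
           + (complex_of_real (sin (b * u)) + complex_of_real (sin ((b + 2) * u))))"
        by (simp add: f_def algebra_simps)
      ultimately show ?thesis by (simp add: algebra_simps)
    qed
    have IH: "path_kernel z m a c = 1 / pi * (LINT u:{-pi..pi}|lborel. f c u)" if "-1 \<le> c" for c
      using Suc.IH[OF that] by (simp add: f_def)
    have "path_kernel z (Suc m) a b = 1 / pi * ((LINT u:{-pi..pi}|lborel. f (b - 1) u)
        + z * (LINT u:{-pi..pi}|lborel. f b u) + (LINT u:{-pi..pi}|lborel. f (b + 1) u))"
      using b by (simp add: path_kernel_Suc IH distrib_left mult.left_commute)
    also have "(LINT u:{-pi..pi}|lborel. f (b - 1) u)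
        + z * (LINT u:{-pi..pi}|lborel. f b u) + (LINT u:{-pi..pi}|lborel. f (b + 1) u) =
        (LINT u:{-pi..pi}|lborel. f (b - 1) u + z * f b u + f (b + 1) u)"
      using int by (subst set_integral_add set_integral_mult_right; simp)+
    finally show ?thesis
      unfolding trig by simp
  qed
qed

subsection \<open>The local limit theorem\<close>

text \<open>A complex version of (1 + l/n)^m -> exp (\<tau> l). The hypothesis forces
  \<open>w n\<close> to tend to 1, so \<open>w n\<close> is eventually nonzero and its powers are
  \<open>exp (m * Ln (w n))\<close>.\<close>

lemma tendsto_power_exp:
  fixes w :: "nat \<Rightarrow> complex"
  assumes w: "(\<lambda>n. of_nat n * (w n - 1)) \<longlonglongrightarrow> l" and m: "(\<lambda>n. real (m n) / real n) \<longlonglongrightarrow> \<tau>"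
  shows "(\<lambda>n. w n ^ m n) \<longlonglongrightarrow> exp (of_real \<tau> * l)"
proof -
  have "(\<lambda>n. 1 / of_nat n * (of_nat n * (w n - 1))) \<longlonglongrightarrow> 0"
    using tendsto_mult[OF lim_1_over_n w] by simp
  then have "(\<lambda>n. w n - 1) \<longlonglongrightarrow> 0"
    by (rule Lim_transform_eventually) (auto simp: eventually_at_top_linorder intro!: exI[of _ 1])
  then have w1: "w \<longlonglongrightarrow> 1"
    using LIM_zero_cancel by blast
  \<comment> \<open>Difference quotient of \<open>Ln\<close> at 1, filled in by the derivative 1, so
    that \<open>Ln (w n) = (w n - 1) * h (w n)\<close> holds also when
    \<open>w n = 1\<close>.\<close>
  define h where "h x = (if x = 1 then 1 else (Ln x - Ln 1) / (x - 1))" for x :: complex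
  have "(Ln has_field_derivative 1) (at 1)"
    using has_field_derivative_Ln[of 1] by (simp add: complex_nonpos_Reals_iff)
  then have "((\<lambda>x. (Ln x - Ln 1) / (x - 1)) \<longlongrightarrow> 1) (at 1)"
    by (simp add: has_field_derivative_iff)
  then have "(h \<longlongrightarrow> 1) (at 1)"
    by (rule Lim_transform_eventually) (auto simp: h_def eventually_at_filter)
  then have "isCont h 1"
    by (simp add: isCont_def h_def)
  then have "(\<lambda>n. h (w n)) \<longlonglongrightarrow> 1"
    using isCont_tendsto_compose[OF _ w1, of h] by (simp add: h_def)
  with w m have "(\<lambda>n. exp (of_real (real (m n) / real n) * (of_nat n * (w n - 1)) * h (w n)))
      \<longlonglongrightarrow> exp (of_real \<tau> * l * 1)"
    by (intro tendsto_intros)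
  moreover have "\<forall>\<^sub>F n in sequentially.
      exp (of_real (real (m n) / real n) * (of_nat n * (w n - 1)) * h (w n)) = w n ^ m n"
    using eventually_gt_at_top[of "0 :: nat"] tendsto_imp_eventually_ne[OF w1 one_neq_zero]
  proof eventually_elim
    case (elim n)
    have h: "(w n - 1) * h (w n) = Ln (w n)"
      by (simp add: h_def)
    have "of_real (real (m n) / real n) * (of_nat n * (w n - 1)) * h (w n) = of_nat (m n) * ((w n - 1) * h (w n))"
      using elim(1) by simp
    then show ?case
      using elim(2) by (simp add: h exp_of_nat_mult)
  qed
  ultimately show ?thesis
    by (auto intro: Lim_transform_eventually)
qed

lemma tendsto_cos_sqrt: "(\<lambda>n. real n * (cos (k / sqrt (real n)) - 1)) \<longlonglongrightarrow> - k\<^sup>2 / 2"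
proof -
  have pos: "(\<lambda>n. real n * (cos (k / sqrt (real n)) - 1)) \<longlonglongrightarrow> - k\<^sup>2 / 2" if "0 < k" for k
    using that by (real_asymp simp: power2_eq_square)
  show ?thesis
    using pos[of k] pos[of "- k"] by (cases k "0 :: real" rule: linorder_cases) auto
qed

definition level_weight :: "real \<Rightarrow> nat \<Rightarrow> complex" where
  "level_weight \<theta> n = iexp (\<theta> / sqrt (2 * real n))"

text \<open>Standard deviation of a free walk after \<open>n\<close> uniform steps, each of variance
  2/3. In this unit the limiting kernels are those of standard Brownian motion.\<close>

definition height_scale :: "nat \<Rightarrow> real" where
  "height_scale n = sqrt (2 * real n / 3)"

text \<open>Joint characteristic function of one uniform step: of the centred level indicator at
  \<theta> / sqrt (2 n), and of the increment at \<open>u\<close>.\<close>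

definition step_symbol :: "real \<Rightarrow> nat \<Rightarrow> real \<Rightarrow> complex" where
  "step_symbol \<theta> n u =
    (level_weight \<theta> n + 2 * cos u) / 3 * iexp (- \<theta> / (3 * sqrt (2 * real n)))"

text \<open>Probabilistic normalisation of \<open>path_kernel\<close>: the expectation, over
  \<open>m\<close> free uniform steps from \<open>a\<close>, of the character of the centred level
  count, restricted to nonnegative walks ending at \<open>b\<close>.\<close>

definition norm_kernel :: "real \<Rightarrow> nat \<Rightarrow> nat \<Rightarrow> int \<Rightarrow> int \<Rightarrow> complex" where
  "norm_kernel \<theta> n m a b =
    iexp (- \<theta> * real m / (3 * sqrt (2 * real n))) * path_kernel (level_weight \<theta> n) m a b / 3 ^ m"

text \<open>Second order expansion of the one-step characteristic function. Centring removes the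
  linear term. Half of the variance 2/3, in units of \<open>height_scale\<close>, gives v^2 / 2, and
  half of the variance 2/9, in units of sqrt (2 n), gives \<theta>^2 / 18; uncorrelatedness removes
  the mixed term.\<close>

lemma step_symbol_tendsto:
  "(\<lambda>n. of_nat n * (step_symbol \<theta> n (v / height_scale n) - 1))
    \<longlonglongrightarrow> complex_of_real (- (v\<^sup>2 / 2 + \<theta>\<^sup>2 / 18))"
proof -
  \<comment> \<open>\<open>b n\<close> is the unit of phase: after centring, a level step carries
    the phase \<open>2 * b n\<close> and any other step \<open>- b n\<close>.\<close>
  define b where "b n = \<theta> / (3 * sqrt (2 * real n))" for n
  define s where "s n = v / height_scale n" for n
  have b: "b n = (\<theta> / (3 * sqrt 2)) / sqrt (real n)" for n
    by (simp add: b_def real_sqrt_mult)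
  have b2: "2 * b n = (2 * \<theta> / (3 * sqrt 2)) / sqrt (real n)" for n
    by (simp add: b)
  have s: "s n = (v * sqrt 3 / sqrt 2) / sqrt (real n)" for n
    by (simp add: s_def height_scale_def real_sqrt_mult real_sqrt_divide)
  have lb: "(\<lambda>n. real n * (cos (b n) - 1)) \<longlonglongrightarrow> - \<theta>\<^sup>2 / 36"
    using tendsto_cos_sqrt[of "\<theta> / (3 * sqrt 2)"] by (simp add: b power_divide power_mult_distrib)
  have lb2: "(\<lambda>n. real n * (cos (2 * b n) - 1)) \<longlonglongrightarrow> - \<theta>\<^sup>2 / 9"
    unfolding b2 using tendsto_cos_sqrt[of "2 * \<theta> / (3 * sqrt 2)"]
    by (simp add: power_divide power_mult_distrib)
  have ls: "(\<lambda>n. real n * (cos (s n) - 1)) \<longlonglongrightarrow> - 3 * v\<^sup>2 / 4"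
    using tendsto_cos_sqrt[of "v * sqrt 3 / sqrt 2"] by (simp add: s power_divide power_mult_distrib mult.commute)
  have b0: "b \<longlonglongrightarrow> 0"
  proof -
    have "(\<lambda>n. (\<theta> / (3 * sqrt 2)) * (1 / sqrt (real n))) \<longlonglongrightarrow> (\<theta> / (3 * sqrt 2)) * 0"
      by (intro tendsto_mult tendsto_const) real_asymp
    then show ?thesis by (simp add: b[abs_def])
  qed
  have symbol: "step_symbol \<theta> n (s n) = Complex ((cos (2 * b n) + 2 * cos (s n) * cos (b n)) / 3)
      ((sin (2 * b n) - 2 * cos (s n) * sin (b n)) / 3)" for n
  proof -
    have "level_weight \<theta> n = iexp (3 * b n)"
      by (simp add: level_weight_def b_def)
    then have "step_symbol \<theta> n (s n) = (iexp (3 * b n) * iexp (- b n) + 2 * cos (s n) * iexp (- b n)) / 3"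
      by (simp add: step_symbol_def b_def field_simps)
    also have "iexp (3 * b n) * iexp (- b n) = iexp (2 * b n)"
      by (simp add: exp_add[symmetric] algebra_simps)
    finally show ?thesis
      by (simp add: complex_eq_iff Re_exp Im_exp)
  qed
  have "(\<lambda>n. (real n * (cos (2 * b n) - 1) + 2 * (real n * (cos (s n) - 1)) * cos (b n)
      + 2 * (real n * (cos (b n) - 1))) / 3)
      \<longlonglongrightarrow> (- \<theta>\<^sup>2 / 9 + 2 * (- 3 * v\<^sup>2 / 4) * cos 0 + 2 * (- \<theta>\<^sup>2 / 36)) / 3"
    by (intro tendsto_intros lb lb2 ls b0) auto
  also have "(\<lambda>n. (real n * (cos (2 * b n) - 1) + 2 * (real n * (cos (s n) - 1)) * cos (b n)
      + 2 * (real n * (cos (b n) - 1))) / 3) =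
      (\<lambda>n. Re (of_nat n * (step_symbol \<theta> n (s n) - 1)))"
    by (auto simp: symbol field_simps)
  also have "(- \<theta>\<^sup>2 / 9 + 2 * (- 3 * v\<^sup>2 / 4) * cos 0 + 2 * (- \<theta>\<^sup>2 / 36)) / 3 = - (v\<^sup>2 / 2 + \<theta>\<^sup>2 / 18)"
    by simp
  finally have Re: "(\<lambda>n. Re (of_nat n * (step_symbol \<theta> n (s n) - 1))) \<longlonglongrightarrow> - (v\<^sup>2 / 2 + \<theta>\<^sup>2 / 18)" .
  \<comment> \<open>By the double angle formula the first order terms of the imaginary part cancel;
    what remains is 2 sin b (cos b - cos s) / 3, which is of order at most n^(-3/2).\<close>
  have "(\<lambda>n. 2 * sin (b n) * (real n * (cos (b n) - 1) - real n * (cos (s n) - 1)) / 3)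
      \<longlonglongrightarrow> 2 * sin 0 * (- \<theta>\<^sup>2 / 36 - (- 3 * v\<^sup>2 / 4)) / 3"
    by (intro tendsto_intros lb ls b0) auto
  also have "(\<lambda>n. 2 * sin (b n) * (real n * (cos (b n) - 1) - real n * (cos (s n) - 1)) / 3) =
      (\<lambda>n. Im (of_nat n * (step_symbol \<theta> n (s n) - 1)))"
    unfolding symbol sin_double by (auto simp: field_simps)
  finally have Im: "(\<lambda>n. Im (of_nat n * (step_symbol \<theta> n (s n) - 1))) \<longlonglongrightarrow> 0" by simp
  from Re Im show ?thesis
    by (simp add: tendsto_complex_iff s_def)
qed

text \<open>The dominator for the local limit has to hold up to |u| = \<pi>, where the walk without
  level steps would have a symbol of modulus 1. For negative cosine, closeness of the level weight
  to 1 gives modulus at most 2/3, and the constant 30 is chosen so that 1 - u^2 / 30 >= 2/3 for u^2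
  <= 10. For nonnegative cosine the triangle inequality reduces the claim to cos u <= 1 - u^2 /
  20.\<close>

lemma exp_gaussian_bound_step_symbol:
  assumes z: "cmod (level_weight \<theta> n - 1) \<le> 1" and u: "\<bar>u\<bar> \<le> pi"
  shows "cmod (step_symbol \<theta> n u) \<le> exp (- u\<^sup>2 / 30)"
proof -
  have norm: "cmod (step_symbol \<theta> n u) = cmod (level_weight \<theta> n + 2 * cos u) / 3"
    by (simp add: step_symbol_def norm_mult norm_divide norm_exp_i_times)
  have nlw: "cmod (level_weight \<theta> n) = 1"
    unfolding level_weight_def by (rule norm_exp_i_times)
  have u2: "u\<^sup>2 \<le> 10"
  proof -
    have "\<bar>u\<bar> \<le> 3.15" using u pi_less_4 pi_approx by simp
    then have "\<bar>u\<bar>\<^sup>2 \<le> 3.15\<^sup>2" by (intro power_mono) auto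
    then show ?thesis by (simp add: power2_eq_square)
  qed
  have "cmod (level_weight \<theta> n + 2 * cos u) / 3 \<le> 1 - u\<^sup>2 / 30"
  proof (cases "0 \<le> cos u")
    case True
    have "cos u \<le> 1 - u\<^sup>2 / 20"
    proof -
      \<comment> \<open>The Taylor remainder is at most 10 |u| / 48, which leaves 14/48 of |u|, more
        than the fifth that is claimed.\<close>
      have "\<bar>u\<bar> / 5 \<le> \<bar>sin (u / 2)\<bar>"
      proof -
        have "\<bar>sin (u / 2) - u / 2\<bar> \<le> \<bar>u / 2\<bar> ^ 3 / 6"
          using Maclaurin_sin_bound[of "u / 2" 3]
          by (simp add: sin_coeff_def eval_nat_numeral fact_numeral)
        also have "\<bar>u / 2\<bar> ^ 3 / 6 = u\<^sup>2 * (\<bar>u\<bar> / 48)"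
          by (simp add: power2_eq_square eval_nat_numeral abs_mult)
        also have "\<dots> \<le> 10 * (\<bar>u\<bar> / 48)"
          using u2 by (intro mult_right_mono) auto
        finally show ?thesis by linarith
      qed
      then have "(\<bar>u\<bar> / 5)\<^sup>2 \<le> \<bar>sin (u / 2)\<bar>\<^sup>2" by (intro power_mono) auto
      then have "u\<^sup>2 / 25 \<le> (sin (u / 2))\<^sup>2" by (simp add: power_divide)
      moreover have "0 \<le> u\<^sup>2" by simp
      moreover have "cos u = 1 - 2 * (sin (u / 2))\<^sup>2"
        using cos_double_sin[of "u / 2"] by simp
      ultimately show ?thesis by linarith
    qed
    moreover have "cmod (level_weight \<theta> n + 2 * cos u) \<le> 1 + 2 * cos u"
      using norm_triangle_ineq[of "level_weight \<theta> n" "2 * cos u"] True nlw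
      by (simp add: norm_mult)
    ultimately show ?thesis by simp
  next
    case False
    have "level_weight \<theta> n + 2 * cos u = (level_weight \<theta> n - 1) + of_real (1 + 2 * cos u)"
      by simp
    then have "cmod (level_weight \<theta> n + 2 * cos u)
        \<le> cmod (level_weight \<theta> n - 1) + \<bar>1 + 2 * cos u\<bar>"
      by (metis norm_triangle_ineq norm_of_real)
    also have "\<dots> \<le> 2"
      using z False cos_ge_minus_one[of u] by linarith
    finally show ?thesis using u2 by simp
  qed
  also have "\<dots> \<le> exp (- u\<^sup>2 / 30)"
    using exp_ge_add_one_self[of "- u\<^sup>2 / 30"] by simp
  finally show ?thesis by (simp add: norm)
qed

lemma integrable_power_gaussian:
  assumes "0 < s"
  shows "integrable lborel (\<lambda>v::real. v ^ k * exp (- s * v\<^sup>2))"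
proof -
  define \<sigma> where "\<sigma> = sqrt (1 / (2 * s))"
  have \<sigma>: "0 < \<sigma>" "2 * \<sigma>\<^sup>2 = 1 / s"
    using assms by (auto simp: \<sigma>_def)
  have "integrable lborel (\<lambda>x. sqrt (2 * pi * \<sigma>\<^sup>2) * (normal_density 0 \<sigma> x * (x - 0) ^ k))"
    using integrable_normal_moment[OF \<sigma>(1), of 0 k] by simp
  also have "(\<lambda>x. sqrt (2 * pi * \<sigma>\<^sup>2) * (normal_density 0 \<sigma> x * (x - 0) ^ k)) = (\<lambda>v. v ^ k * exp (- s * v\<^sup>2))"
    using \<sigma> assms by (auto simp: normal_density_def field_simps)
  finally show ?thesis .
qed

text \<open>Substitute \<open>u = v / height_scale n\<close> in the spectral formula; the centring
  phase and the division by \<open>3 ^ m\<close> are absorbed into the m-th power of the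
  symbol.\<close>

lemma norm_kernel_eq_integral:
  fixes a b :: int
  assumes "0 \<le> a" "0 \<le> b" "0 < n"
  shows "height_scale n * norm_kernel \<theta> n m a b = 1 / pi *
    (\<integral>v. indicator {-pi..pi} (v / height_scale n) *\<^sub>R (step_symbol \<theta> n (v / height_scale n) ^ m *
      of_real (sin ((real_of_int a + 1) * v / height_scale n) * sin ((real_of_int b + 1) * v / height_scale n))) \<partial>lborel)"
proof -
  define c where "c = height_scale n"
  have c: "0 < c" using assms by (simp add: c_def height_scale_def)
  define f where "f u = indicator {-pi..pi} u *\<^sub>R (step_symbol \<theta> n u ^ m *
      of_real (sin ((real_of_int a + 1) * u) * sin ((real_of_int b + 1) * u)))" for u :: real
  have "norm_kernel \<theta> n m a b = 1 / pi * (\<integral>u. f u \<partial>lborel)"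
  proof -
    have "iexp (- \<theta> * real m / (3 * sqrt (2 * real n))) = iexp (- \<theta> / (3 * sqrt (2 * real n))) ^ m"
      by (simp add: exp_of_nat_mult[symmetric] algebra_simps)
    then have "step_symbol \<theta> n u ^ m = iexp (- \<theta> * real m / (3 * sqrt (2 * real n))) / 3 ^ m *
        (level_weight \<theta> n + 2 * cos u) ^ m" for u :: real
      by (simp add: step_symbol_def power_mult_distrib power_divide)
    then have "f u = iexp (- \<theta> * real m / (3 * sqrt (2 * real n))) / 3 ^ m * (indicator {-pi..pi} u *\<^sub>R
        ((level_weight \<theta> n + 2 * cos u) ^ m * (sin ((real_of_int a + 1) * u) * sin ((real_of_int b + 1) * u))))" for u :: real
      by (simp add: f_def)
    then have "(\<integral>u. f u \<partial>lborel) = iexp (- \<theta> * real m / (3 * sqrt (2 * real n))) / 3 ^ m *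
        (LINT u:{-pi..pi}|lborel. (level_weight \<theta> n + 2 * cos u) ^ m * (sin ((real_of_int a + 1) * u) * sin ((real_of_int b + 1) * u)))"
      unfolding set_lebesgue_integral_def by (simp only: integral_mult_right_zero)
    then show ?thesis
      using path_kernel_eq_integral[of a b "level_weight \<theta> n" m] assms
      by (simp add: norm_kernel_def)
  qed
  also have "(\<integral>u. f u \<partial>lborel) = \<bar>1 / c\<bar> *\<^sub>R (\<integral>v. f (0 + 1 / c * v) \<partial>lborel)"
    using c by (intro lborel_integral_real_affine) auto
  finally show ?thesis
    using c unfolding c_def[symmetric] by (simp add: f_def scaleR_conv_of_real field_simps)
qed

text \<open>The factors \<open>\<alpha>\<close> and \<open>\<beta>\<close> allow one statement for
  all kinds of endpoints. An endpoint of the order of \<open>height_scale\<close> takes factor 1 and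
  limit \<open>sin (x * v)\<close>; the endpoint 0 takes factor \<open>height_scale\<close> and
  limit \<open>v\<close>. The bound \<open>1 + \<bar>v\<bar>\<close> covers both.\<close>

lemma local_limit:
  fixes a b :: "nat \<Rightarrow> int" and m :: "nat \<Rightarrow> nat" and \<alpha> \<beta> :: "nat \<Rightarrow> real"
    and F G :: "real \<Rightarrow> real"
  assumes a: "\<And>n. 0 \<le> a n" and b: "\<And>n. 0 \<le> b n"
    and m: "(\<lambda>n. real (m n) / real n) \<longlonglongrightarrow> \<tau>" and \<tau>: "0 < \<tau>"
    and F: "\<And>v. (\<lambda>n. \<alpha> n * sin ((real_of_int (a n) + 1) * v / height_scale n)) \<longlonglongrightarrow> F v"
    and F_le: "\<And>n (v :: real). \<bar>\<alpha> n * sin ((real_of_int (a n) + 1) * v / height_scale n)\<bar> \<le> 1 + \<bar>v\<bar>"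
    and G: "\<And>v. (\<lambda>n. \<beta> n * sin ((real_of_int (b n) + 1) * v / height_scale n)) \<longlonglongrightarrow> G v"
    and G_le: "\<And>n (v :: real). \<bar>\<beta> n * sin ((real_of_int (b n) + 1) * v / height_scale n)\<bar> \<le> 1 + \<bar>v\<bar>"
  shows "(\<lambda>n. \<alpha> n * \<beta> n * height_scale n * norm_kernel \<theta> n (m n) (a n) (b n)) \<longlonglongrightarrow>
    exp (- \<theta>\<^sup>2 * \<tau> / 18) * (1 / pi * (\<integral>v. exp (- \<tau> * v\<^sup>2 / 2) * (F v * G v) \<partial>lborel))"
proof -
  define c where "c n = height_scale n" for n
  have c: "0 < c n" if "0 < n" for n using that by (simp add: c_def height_scale_def)
  define f where "f n v = indicator {-pi..pi} (v / c n) *\<^sub>R (step_symbol \<theta> n (v / c n) ^ m n *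
      of_real ((\<alpha> n * sin ((real_of_int (a n) + 1) * v / c n)) * (\<beta> n * sin ((real_of_int (b n) + 1) * v / c n))))" for n and v :: real
  have lw: "(\<lambda>n. level_weight \<theta> n) \<longlonglongrightarrow> 1"
  proof -
    have "(\<lambda>n. 1 / sqrt (2 * real n)) \<longlonglongrightarrow> 0" by real_asymp
    from tendsto_mult_right_zero[OF this, of \<theta>]
    have "(\<lambda>n. iexp (\<theta> / sqrt (2 * real n))) \<longlonglongrightarrow> iexp 0"
      by (intro tendsto_intros) simp
    then show ?thesis by (simp add: level_weight_def[abs_def])
  qed
  then have "\<forall>\<^sub>F n in sequentially. cmod (level_weight \<theta> n - 1) < 1"
    by (metis (no_types, lifting) dist_norm tendstoD zero_less_one eventually_mono)
  moreover have "\<forall>\<^sub>F n in sequentially. \<tau> / 2 < real (m n) / real n"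
    using m \<tau> by (intro order_tendstoD(1)[of _ \<tau>]) auto
  ultimately have "\<forall>\<^sub>F n in sequentially. 0 < n \<and> cmod (level_weight \<theta> n - 1) \<le> 1 \<and> \<tau> / 2 * n \<le> m n"
    using eventually_gt_at_top[of "0 :: nat"]
    by eventually_elim (auto simp: field_simps)
  then obtain N where N: "\<And>n. N \<le> n \<Longrightarrow> 0 < n \<and> cmod (level_weight \<theta> n - 1) \<le> 1 \<and> \<tau> / 2 * n \<le> m n"
    by (auto simp: eventually_at_top_linorder)
  \<comment> \<open>The two sine factors give (1 + |v|)^2 <= 2 + 2 v^2. With m >= \<tau> n / 2 and
    c^2 = 2 n / 3, the exponent m (v / c)^2 / 30 is at least \<tau> v^2 / 40. Both need
    \<open>n\<close> beyond \<open>N\<close>, so dominated convergence is applied to the shifted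
    sequence below.\<close>
  have f_bound: "norm (f n v) \<le> (2 + 2 * v\<^sup>2) * exp (- (\<tau> / 40) * v\<^sup>2)" if n: "N \<le> n" for n and v :: real
  proof (cases "\<bar>v / c n\<bar> \<le> pi")
    case False
    then have "v / c n \<notin> {-pi..pi}" by (auto simp: abs_le_iff)
    then show ?thesis by (simp add: f_def)
  next
    case True
    have c2: "(c n)\<^sup>2 = 2 * real n / 3" by (simp add: c_def height_scale_def)
    have "norm (step_symbol \<theta> n (v / c n)) ^ m n \<le> exp (- (v / c n)\<^sup>2 / 30) ^ m n"
      using N[OF n] True by (intro power_mono exp_gaussian_bound_step_symbol) auto
    also have "\<dots> = exp (- (real (m n) * (v / c n)\<^sup>2 / 30))"
      by (simp add: exp_of_nat_mult[symmetric])
    also have "\<dots> \<le> exp (- (\<tau> / 2 * real n * (v / c n)\<^sup>2 / 30))"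
      using mult_right_mono[of "\<tau> / 2 * real n" "real (m n)" "(v / c n)\<^sup>2"] N[OF n] by simp
    also have "\<tau> / 2 * real n * (v / c n)\<^sup>2 / 30 = \<tau> / 40 * v\<^sup>2"
      using N[OF n] by (simp add: power_divide c2 field_simps)
    finally have 1: "norm (step_symbol \<theta> n (v / c n)) ^ m n \<le> exp (- (\<tau> / 40 * v\<^sup>2))" .
    have "\<bar>\<alpha> n * sin ((real_of_int (a n) + 1) * v / c n)\<bar> * \<bar>\<beta> n * sin ((real_of_int (b n) + 1) * v / c n)\<bar> \<le> (1 + \<bar>v\<bar>) * (1 + \<bar>v\<bar>)"
      using F_le G_le unfolding c_def by (intro mult_mono) auto
    also have "\<dots> \<le> 2 + 2 * v\<^sup>2"
      using zero_le_power2[of "1 - \<bar>v\<bar>"] by (simp add: power2_eq_square algebra_simps)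
    finally have 2: "\<bar>\<alpha> n * sin ((real_of_int (a n) + 1) * v / c n)\<bar> * \<bar>\<beta> n * sin ((real_of_int (b n) + 1) * v / c n)\<bar> \<le> 2 + 2 * v\<^sup>2" .
    have "norm (f n v) \<le> norm (step_symbol \<theta> n (v / c n)) ^ m n *
        (\<bar>\<alpha> n * sin ((real_of_int (a n) + 1) * v / c n)\<bar> * \<bar>\<beta> n * sin ((real_of_int (b n) + 1) * v / c n)\<bar>)"
      by (simp add: f_def norm_mult norm_power abs_mult indicator_def)
    also have "\<dots> \<le> exp (- (\<tau> / 40 * v\<^sup>2)) * (2 + 2 * v\<^sup>2)"
      using 1 2 by (intro mult_mono) auto
    finally show ?thesis by (simp add: mult.commute)
  qed
  have f_meas [measurable]: "f n \<in> borel_measurable lborel" for n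
    unfolding f_def step_symbol_def by measurable
  have f_lim: "(\<lambda>n. f n v) \<longlonglongrightarrow> of_real (exp (- \<theta>\<^sup>2 * \<tau> / 18)) * of_real (exp (- \<tau> * v\<^sup>2 / 2) * (F v * G v))" for v :: real
  proof -
    have "(\<lambda>n. step_symbol \<theta> n (v / c n) ^ m n) \<longlonglongrightarrow> exp (of_real \<tau> * complex_of_real (- (v\<^sup>2 / 2 + \<theta>\<^sup>2 / 18)))"
      unfolding c_def by (rule tendsto_power_exp[OF step_symbol_tendsto m])
    moreover have "(\<lambda>n. complex_of_real ((\<alpha> n * sin ((real_of_int (a n) + 1) * v / c n)) * (\<beta> n * sin ((real_of_int (b n) + 1) * v / c n)))) \<longlonglongrightarrow> of_real (F v * G v)"
      unfolding c_def by (intro tendsto_of_real tendsto_mult F G)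
    ultimately have "(\<lambda>n. step_symbol \<theta> n (v / c n) ^ m n * complex_of_real ((\<alpha> n * sin ((real_of_int (a n) + 1) * v / c n)) * (\<beta> n * sin ((real_of_int (b n) + 1) * v / c n))))
       \<longlonglongrightarrow> exp (of_real \<tau> * complex_of_real (- (v\<^sup>2 / 2 + \<theta>\<^sup>2 / 18))) * of_real (F v * G v)"
      by (rule tendsto_mult)
    moreover have "(\<lambda>n. v * (1 / c n)) \<longlonglongrightarrow> v * 0"
      unfolding c_def height_scale_def by (intro tendsto_mult tendsto_const) real_asymp
    then have "\<forall>\<^sub>F n in sequentially. \<bar>v / c n\<bar> < pi"
      by (intro order_tendstoD(2)[OF tendsto_rabs[of _ 0, simplified]]) auto
    then have "\<forall>\<^sub>F n in sequentially. step_symbol \<theta> n (v / c n) ^ m n * complex_of_real ((\<alpha> n * sin ((real_of_int (a n) + 1) * v / c n)) * (\<beta> n * sin ((real_of_int (b n) + 1) * v / c n))) = f n v"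
    proof eventually_elim
      case (elim n)
      then have "v / c n \<in> {-pi..pi}"
        unfolding abs_less_iff atLeastAtMost_iff by linarith
      then show ?case by (simp add: f_def)
    qed
    moreover have "exp (of_real \<tau> * complex_of_real (- (v\<^sup>2 / 2 + \<theta>\<^sup>2 / 18))) =
        complex_of_real (exp (- \<theta>\<^sup>2 * \<tau> / 18)) * of_real (exp (- \<tau> * v\<^sup>2 / 2))"
      unfolding of_real_mult[symmetric] exp_of_real exp_add[symmetric]
      by (simp add: field_simps)
    ultimately show ?thesis
      by (auto simp: mult.assoc intro: Lim_transform_eventually)
  qed
  have FG_meas: "(\<lambda>v. of_real (exp (- \<theta>\<^sup>2 * \<tau> / 18)) * complex_of_real (exp (- \<tau> * v\<^sup>2 / 2) * (F v * G v)))
      \<in> borel_measurable lborel"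
    by (rule borel_measurable_LIMSEQ_metric[OF f_meas f_lim])
  have "(\<lambda>n. \<integral>v. f (n + N) v \<partial>lborel) \<longlonglongrightarrow>
      (\<integral>v. of_real (exp (- \<theta>\<^sup>2 * \<tau> / 18)) * of_real (exp (- \<tau> * v\<^sup>2 / 2) * (F v * G v)) \<partial>lborel)"
  proof (rule integral_dominated_convergence[where w="\<lambda>v. (2 + 2 * v\<^sup>2) * exp (- (\<tau> / 40) * v\<^sup>2)"])
    have "integrable lborel (\<lambda>v. 2 * (v ^ 0 * exp (- (\<tau> / 40) * v\<^sup>2)) + 2 * (v ^ 2 * exp (- (\<tau> / 40) * v\<^sup>2)))"
      using \<tau> by (intro Bochner_Integration.integrable_add integrable_mult_right integrable_power_gaussian) auto
    then show "integrable lborel (\<lambda>v. (2 + 2 * v\<^sup>2) * exp (- (\<tau> / 40) * v\<^sup>2))"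
      by (simp add: algebra_simps)
  qed (use f_bound LIMSEQ_ignore_initial_segment[OF f_lim] FG_meas in auto)
  then have "(\<lambda>n. \<integral>v. f n v \<partial>lborel) \<longlonglongrightarrow>
      (\<integral>v. of_real (exp (- \<theta>\<^sup>2 * \<tau> / 18)) * of_real (exp (- \<tau> * v\<^sup>2 / 2) * (F v * G v)) \<partial>lborel)"
    by (rule LIMSEQ_offset)
  then have "(\<lambda>n. 1 / pi * (\<integral>v. f n v \<partial>lborel)) \<longlonglongrightarrow> complex_of_real (1 / pi) *
      (\<integral>v. complex_of_real (exp (- \<theta>\<^sup>2 * \<tau> / 18)) * complex_of_real (exp (- \<tau> * v\<^sup>2 / 2) * (F v * G v)) \<partial>lborel)"
    by (intro tendsto_intros)
  moreover have "\<forall>\<^sub>F n in sequentially. 1 / pi * (\<integral>v. f n v \<partial>lborel) =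
      \<alpha> n * \<beta> n * height_scale n * norm_kernel \<theta> n (m n) (a n) (b n)"
    using eventually_gt_at_top[of "0 :: nat"]
  proof eventually_elim
    case (elim n)
    have "f n v = (\<alpha> n * \<beta> n) * (indicator {-pi..pi} (v / c n) *\<^sub>R (step_symbol \<theta> n (v / c n) ^ m n *
      of_real (sin ((real_of_int (a n) + 1) * v / c n) * sin ((real_of_int (b n) + 1) * v / c n))))" for v :: real
      by (simp add: f_def)
    then have A: "(\<integral>v. f n v \<partial>lborel) = (\<alpha> n * \<beta> n) * (\<integral>v. (indicator {-pi..pi} (v / c n) *\<^sub>R (step_symbol \<theta> n (v / c n) ^ m n *
      of_real (sin ((real_of_int (a n) + 1) * v / c n) * sin ((real_of_int (b n) + 1) * v / c n)))) \<partial>lborel)"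
      (is "_ = _ * ?I")
      by (simp only: integral_mult_right_zero)
    have B: "complex_of_real (height_scale n) * norm_kernel \<theta> n (m n) (a n) (b n) = complex_of_real (1 / pi) * ?I"
      unfolding c_def by (rule norm_kernel_eq_integral[OF a b elim])
    have "1 / pi * (\<integral>v. f n v \<partial>lborel) = (\<alpha> n * \<beta> n) * (complex_of_real (1 / pi) * ?I)"
      unfolding A by (simp only: mult.left_commute)
    then show ?case
      unfolding B[symmetric] by (simp only: of_real_mult mult.assoc)
  qed
  moreover have "(\<integral>v. complex_of_real (exp (- \<theta>\<^sup>2 * \<tau> / 18)) * complex_of_real (exp (- \<tau> * v\<^sup>2 / 2) * (F v * G v)) \<partial>lborel) =
      complex_of_real (exp (- \<theta>\<^sup>2 * \<tau> / 18)) * complex_of_real (\<integral>v. exp (- \<tau> * v\<^sup>2 / 2) * (F v * G v) \<partial>lborel)"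
    by (simp only: integral_mult_right_zero integral_complex_of_real)
  ultimately show ?thesis
    by (simp add: Lim_transform_eventually mult.left_commute)
qed

section \<open>Gaussian integrals that produce the excursion kernels\<close>

lemma
  assumes \<tau>: "0 < \<tau>"
  shows integrable_gaussian_cos: "integrable lborel (\<lambda>v. exp (- \<tau> * v\<^sup>2 / 2) * cos (k * v))"
    and integral_gaussian_cos:
      "(\<integral>v. exp (- \<tau> * v\<^sup>2 / 2) * cos (k * v) \<partial>lborel) = sqrt (2 * pi / \<tau>) * exp (- k\<^sup>2 / (2 * \<tau>))"
proof -
  have gauss: "integrable lborel (\<lambda>v. exp (- \<tau> * v\<^sup>2 / 2))"
    using integrable_power_gaussian[of "\<tau> / 2" 0] \<tau> by simp
  show "integrable lborel (\<lambda>v. exp (- \<tau> * v\<^sup>2 / 2) * cos (k * v))"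
    by (rule Bochner_Integration.integrable_bound[OF gauss]) (auto simp: abs_mult mult_left_le)
  \<comment> \<open>The integral is the real part of the standard normal characteristic function at
    \<open>s\<close>, after the substitution x = sqrt \<tau> v.\<close>
  define s where "s = k / sqrt \<tau>"
  have std: "integrable std_normal_distribution (\<lambda>x. iexp (s * x))"
    by (intro prob_space.integrable_iexp prob_space_normal_density) auto
  have "exp (- s\<^sup>2 / 2) = Re (char std_normal_distribution s)"
    by (simp only: char_std_normal_distribution) (simp only: Re_complex_of_real)
  also have "\<dots> = (\<integral>x. cos (s * x) \<partial>std_normal_distribution)"
    unfolding char_def by (subst integral_Re[OF std, symmetric]) (simp add: Re_exp)
  also have "\<dots> = (\<integral>x. std_normal_density x * cos (s * x) \<partial>lborel)"
    by (subst integral_density) auto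
  also have "\<dots> = \<bar>sqrt \<tau>\<bar> *\<^sub>R (\<integral>v. std_normal_density (0 + sqrt \<tau> * v) * cos (s * (0 + sqrt \<tau> * v)) \<partial>lborel)"
    using \<tau> by (intro lborel_integral_real_affine) auto
  also have "\<dots> = sqrt \<tau> * (\<integral>v. 1 / sqrt (2 * pi) * (exp (- \<tau> * v\<^sup>2 / 2) * cos (k * v)) \<partial>lborel)"
    using \<tau> by (simp add: std_normal_density_def s_def power_mult_distrib mult.assoc)
  also have "\<dots> = sqrt \<tau> / sqrt (2 * pi) * (\<integral>v. exp (- \<tau> * v\<^sup>2 / 2) * cos (k * v) \<partial>lborel)"
    by simp
  finally have "(\<integral>v. exp (- \<tau> * v\<^sup>2 / 2) * cos (k * v) \<partial>lborel) = sqrt (2 * pi) / sqrt \<tau> * exp (- s\<^sup>2 / 2)"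
    using \<tau> by (simp add: field_simps)
  then show "(\<integral>v. exp (- \<tau> * v\<^sup>2 / 2) * cos (k * v) \<partial>lborel) = sqrt (2 * pi / \<tau>) * exp (- k\<^sup>2 / (2 * \<tau>))"
    using \<tau> by (simp add: s_def power_divide real_sqrt_divide mult.commute)
qed

text \<open>The product formula for sines yields two Gaussians, at x - y and at x + y: the direct
  term and the mirror image of the heat kernel killed at 0.\<close>

lemma integral_gaussian_sin_sin:
  assumes \<tau>: "0 < \<tau>"
  shows "1 / pi * (\<integral>v. exp (- \<tau> * v\<^sup>2 / 2) * (sin (x * v) * sin (y * v)) \<partial>lborel) = ex_g \<tau> x y"
proof -
  have "exp (- \<tau> * v\<^sup>2 / 2) * (sin (x * v) * sin (y * v)) =
      1 / 2 * (exp (- \<tau> * v\<^sup>2 / 2) * cos ((x - y) * v) - exp (- \<tau> * v\<^sup>2 / 2) * cos ((x + y) * v))" for v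
    unfolding sin_times_sin left_diff_distrib distrib_right by (simp add: right_diff_distrib)
  then have 1: "(\<integral>v. exp (- \<tau> * v\<^sup>2 / 2) * (sin (x * v) * sin (y * v)) \<partial>lborel) =
      1 / 2 * sqrt (2 * pi / \<tau>) * (exp (- (x - y)\<^sup>2 / (2 * \<tau>)) - exp (- (x + y)\<^sup>2 / (2 * \<tau>)))"
    using integrable_gaussian_cos[OF \<tau>] \<tau>
    by (simp only: integral_mult_right_zero Bochner_Integration.integral_diff integral_gaussian_cos)
      (simp add: right_diff_distrib)
  have 2: "1 / pi * (1 / 2 * sqrt (2 * pi / \<tau>)) = 1 / sqrt (2 * pi * \<tau>)"
    using \<tau> by (simp add: real_sqrt_divide real_sqrt_mult field_simps)
  show ?thesis
    unfolding 1 ex_g_def 2[symmetric] by (simp only: mult.assoc)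
qed

text \<open>Integrate by parts: \<open>g\<close> is the derivative of
  \<open>E v * sin (y * v)\<close>, which vanishes at both infinities. The factor 2 is the one in
  the derivative of \<open>ex_g \<tau> x y\<close> at x = 0, which equals
  \<open>2 * ex_ell \<tau> y\<close>.\<close>

lemma integral_gaussian_id_sin:
  assumes \<tau>: "0 < \<tau>"
  shows "1 / pi * (\<integral>v. exp (- \<tau> * v\<^sup>2 / 2) * (v * sin (y * v)) \<partial>lborel) = 2 * ex_ell \<tau> y"
proof -
  define E where "E v = exp (- \<tau> * v\<^sup>2 / 2)" for v :: real
  define g where "g v = - (\<tau> * (E v * (v * sin (y * v)))) + y * (E v * cos (y * v))" for v
  have int1: "integrable lborel (\<lambda>v. E v * (v * sin (y * v)))"
  proof (rule Bochner_Integration.integrable_bound)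
    show "integrable lborel (\<lambda>v. v ^ 1 * exp (- (\<tau> / 2) * v\<^sup>2))"
      using \<tau> by (intro integrable_power_gaussian) auto
    show "AE v in lborel. norm (E v * (v * sin (y * v))) \<le> norm (v ^ 1 * exp (- (\<tau> / 2) * v\<^sup>2))"
    proof (rule AE_I2)
      fix v :: real
      have "\<bar>v * sin (y * v)\<bar> \<le> \<bar>v\<bar>"
        by (simp add: abs_mult mult_left_le)
      then have "E v * \<bar>v * sin (y * v)\<bar> \<le> E v * \<bar>v\<bar>"
        by (intro mult_left_mono) (auto simp: E_def)
      then show "norm (E v * (v * sin (y * v))) \<le> norm (v ^ 1 * exp (- (\<tau> / 2) * v\<^sup>2))"
        by (simp add: E_def abs_mult mult.commute)
    qed
  qed (auto simp: E_def)
  have int2: "integrable lborel (\<lambda>v. E v * cos (y * v))"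
    unfolding E_def by (rule integrable_gaussian_cos[OF \<tau>])
  have E_lim_top: "(E \<longlongrightarrow> 0) at_top"
    unfolding E_def using \<tau> by real_asymp
  have E_lim_bot: "(E \<longlongrightarrow> 0) at_bot"
    unfolding E_def using \<tau> by real_asymp
  have sin_lim: "((\<lambda>v. E v * sin (y * v)) \<longlongrightarrow> 0) F" if "(E \<longlongrightarrow> 0) F" for F :: "real filter"
    by (rule Lim_null_comparison[OF _ that]) (auto simp: E_def abs_mult mult_left_le)
  have "(LBINT v=-\<infinity>..\<infinity>. g v) = 0 - 0"
  proof (rule interval_integral_FTC_integrable)
    show "((\<lambda>v. E v * sin (y * v)) has_vector_derivative g v) (at v)" for v
      unfolding has_real_derivative_iff_has_vector_derivative[symmetric] E_def g_def
      by (auto intro!: derivative_eq_intros simp: field_simps)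
    show "isCont g v" for v
      unfolding g_def E_def by (intro continuous_intros) auto
    show "set_integrable lborel (einterval (-\<infinity>) \<infinity>) g"
      using int1 int2 by (auto simp: g_def set_integrable_def)
    show "(((\<lambda>v. E v * sin (y * v)) \<circ> real_of_ereal) \<longlongrightarrow> 0) (at_right (-\<infinity>))"
      "(((\<lambda>v. E v * sin (y * v)) \<circ> real_of_ereal) \<longlongrightarrow> 0) (at_left \<infinity>)"
      by (simp_all add: ereal_tendsto_simps1 sin_lim E_lim_top E_lim_bot)
  qed auto
  then have "(\<integral>v. g v \<partial>lborel) = 0"
    by (simp add: interval_lebesgue_integral_def set_lebesgue_integral_def)
  then have "\<tau> * (\<integral>v. E v * (v * sin (y * v)) \<partial>lborel) = y * (\<integral>v. E v * cos (y * v) \<partial>lborel)"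
    using int1 int2 by (simp add: g_def)
  also have "\<dots> = y * (sqrt (2 * pi / \<tau>) * exp (- y\<^sup>2 / (2 * \<tau>)))"
    unfolding E_def by (simp only: integral_gaussian_cos[OF \<tau>])
  finally have 2: "(\<integral>v. E v * (v * sin (y * v)) \<partial>lborel) = sqrt (2 * pi / \<tau>) / \<tau> * (y * exp (- y\<^sup>2 / (2 * \<tau>)))"
    using \<tau> by (simp add: field_simps)
  have 3: "1 / pi * (sqrt (2 * pi / \<tau>) / \<tau>) = 2 * (1 / sqrt (2 * pi * \<tau> ^ 3))"
  proof -
    have "sqrt (2 * pi * \<tau> ^ 3) = sqrt (2 * pi / \<tau> * \<tau> ^ 4)"
      using \<tau> by (simp add: eval_nat_numeral)
    also have "\<dots> = sqrt (2 * pi / \<tau>) * \<tau>\<^sup>2"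
      using \<tau> real_sqrt_abs[of "\<tau>\<^sup>2"] by (simp only: real_sqrt_mult) (simp add: power_mult[symmetric])
    finally have 1: "sqrt (2 * pi * \<tau> ^ 3) = sqrt (2 * pi / \<tau>) * \<tau>\<^sup>2" .
    have "sqrt (2 * pi / \<tau>) * sqrt (2 * pi / \<tau>) = 2 * pi / \<tau>"
      using \<tau> by simp
    then show ?thesis
      unfolding 1 using \<tau> by (simp add: field_simps power2_eq_square)
  qed
  have "1 / pi * (\<integral>v. E v * (v * sin (y * v)) \<partial>lborel) =
      1 / pi * (sqrt (2 * pi / \<tau>) / \<tau>) * (y * exp (- y\<^sup>2 / (2 * \<tau>)))"
    unfolding 2 by (simp only: mult.assoc)
  also have "\<dots> = 2 * ex_ell \<tau> y"
    unfolding 3 ex_ell_def by (simp only: mult.assoc)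
  finally show ?thesis
    unfolding E_def .
qed

lemma integral_gaussian_square:
  "1 / pi * (\<integral>v. exp (- 1 * v\<^sup>2 / 2) * (v * v) \<partial>lborel) = sqrt (2 / pi)"
proof -
  have "(\<integral>v. exp (- 1 * v\<^sup>2 / 2) * (v * v) \<partial>lborel) =
      (\<integral>v. sqrt (2 * pi) * (std_normal_density v * v ^ (2 * 1)) \<partial>lborel)"
    by (intro Bochner_Integration.integral_cong) (auto simp: std_normal_density_def power2_eq_square)
  also have "\<dots> = sqrt (2 * pi)"
    by (simp only: integral_mult_right_zero integral_std_normal_moment_even) simp
  finally show ?thesis
    by (simp add: real_sqrt_divide real_sqrt_mult field_simps)
qed

section \<open>Local limits for endpoints at 0 and at the scale of the excursion\<close>

lemma abs_sin_div_scale: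
  "\<bar>height_scale n * sin ((real_of_int 0 + 1) * v / height_scale n)\<bar> \<le> 1 + \<bar>v\<bar>"
proof (cases "n = 0")
  case False
  then have c: "0 < height_scale n" by (simp add: height_scale_def)
  have "\<bar>height_scale n * sin (v / height_scale n)\<bar> \<le> height_scale n * \<bar>v / height_scale n\<bar>"
    using c mult_left_mono[OF abs_sin_x_le_abs_x[of "v / height_scale n"], of "height_scale n"]
    by (simp add: abs_mult)
  also have "\<dots> \<le> 1 + \<bar>v\<bar>" using c by (simp add: abs_divide)
  finally show ?thesis by simp
qed (simp add: height_scale_def)

text \<open>The unsimplified \<open>real_of_int 0 + 1\<close>, here and in the bound above, matches
  the hypotheses of \<open>local_limit\<close> for the constant endpoint 0.\<close>

lemma tendsto_sin_div_scale:
  "(\<lambda>n. height_scale n * sin ((real_of_int 0 + 1) * v / height_scale n)) \<longlonglongrightarrow> v"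
proof -
  have pos: "(\<lambda>n. height_scale n * sin (v / height_scale n)) \<longlonglongrightarrow> v" if "0 < v" for v
    unfolding height_scale_def using that by real_asymp
  show ?thesis
    using pos[of v] tendsto_minus[OF pos[of "- v"]]
    by (cases v "0 :: real" rule: linorder_cases) auto
qed

lemma tendsto_sin_scale:
  assumes "(\<lambda>n. (real_of_int (a n) + 1) / height_scale n) \<longlonglongrightarrow> x"
  shows "(\<lambda>n. 1 * sin ((real_of_int (a n) + 1) * v / height_scale n)) \<longlonglongrightarrow> sin (x * v)"
proof -
  have "(\<lambda>n. sin ((real_of_int (a n) + 1) / height_scale n * v)) \<longlonglongrightarrow> sin (x * v)"
    by (intro tendsto_intros assms)
  then show ?thesis by simp
qed

lemma abs_sin_le_one_plus: "\<bar>1 * sin w\<bar> \<le> 1 + \<bar>v :: real\<bar>"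
  unfolding mult_1 using abs_sin_le_one[of w] abs_ge_zero[of v] by linarith

lemma norm_kernel_tendsto:
  assumes m: "(\<lambda>n. real (m n) / real n) \<longlonglongrightarrow> \<tau>" "0 < \<tau>"
    and a: "\<And>n. 0 \<le> a n" "(\<lambda>n. (real_of_int (a n) + 1) / height_scale n) \<longlonglongrightarrow> x"
    and b: "\<And>n. 0 \<le> b n" "(\<lambda>n. (real_of_int (b n) + 1) / height_scale n) \<longlonglongrightarrow> y"
  shows "(\<lambda>n. height_scale n * norm_kernel \<theta> n (m n) (a n) (b n)) \<longlonglongrightarrow>
      exp (- \<theta>\<^sup>2 * \<tau> / 18) * ex_g \<tau> x y"
  using local_limit[where a=a and b=b and m=m and \<tau>=\<tau> and \<alpha>="\<lambda>_. 1" and \<beta>="\<lambda>_. 1"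
      and F="\<lambda>v. sin (x * v)" and G="\<lambda>v. sin (y * v)" and \<theta>=\<theta>,
      OF a(1) b(1) m tendsto_sin_scale[OF a(2)] abs_sin_le_one_plus
      tendsto_sin_scale[OF b(2)] abs_sin_le_one_plus]
  unfolding integral_gaussian_sin_sin[OF m(2)] by simp

text \<open>One power of \<open>height_scale\<close> turns a local weight into a density. Each
  endpoint at 0 costs a further power, since sin (v / c) is of order v / c there; hence the
  exponents 1, 2 and 3 in this group of lemmas.\<close>

lemma norm_kernel_from_0_tendsto:
  assumes m: "(\<lambda>n. real (m n) / real n) \<longlonglongrightarrow> \<tau>" "0 < \<tau>"
    and b: "\<And>n. 0 \<le> b n" "(\<lambda>n. (real_of_int (b n) + 1) / height_scale n) \<longlonglongrightarrow> y"
  shows "(\<lambda>n. height_scale n ^ 2 * norm_kernel \<theta> n (m n) 0 (b n)) \<longlonglongrightarrow>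
      exp (- \<theta>\<^sup>2 * \<tau> / 18) * (2 * ex_ell \<tau> y)"
  using local_limit[where a="\<lambda>_. 0" and b=b and m=m and \<tau>=\<tau> and \<alpha>=height_scale and \<beta>="\<lambda>_. 1"
      and F="\<lambda>v. v" and G="\<lambda>v. sin (y * v)" and \<theta>=\<theta>,
      OF order_refl b(1) m tendsto_sin_div_scale abs_sin_div_scale
      tendsto_sin_scale[OF b(2)] abs_sin_le_one_plus]
  unfolding integral_gaussian_id_sin[OF m(2)] by (simp add: power2_eq_square)

lemma norm_kernel_to_0_tendsto:
  assumes m: "(\<lambda>n. real (m n) / real n) \<longlonglongrightarrow> \<tau>" "0 < \<tau>"
    and a: "\<And>n. 0 \<le> a n" "(\<lambda>n. (real_of_int (a n) + 1) / height_scale n) \<longlonglongrightarrow> x"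
  shows "(\<lambda>n. height_scale n ^ 2 * norm_kernel \<theta> n (m n) (a n) 0) \<longlonglongrightarrow>
      exp (- \<theta>\<^sup>2 * \<tau> / 18) * (2 * ex_ell \<tau> x)"
proof -
  have "1 / pi * (\<integral>v. exp (- \<tau> * v\<^sup>2 / 2) * (sin (x * v) * v) \<partial>lborel) = 2 * ex_ell \<tau> x"
    using integral_gaussian_id_sin[OF m(2), of x] by (simp only: mult.commute[of "sin _"])
  note integral = this
  show ?thesis
    using local_limit[where a=a and b="\<lambda>_. 0" and m=m and \<tau>=\<tau> and \<alpha>="\<lambda>_. 1" and \<beta>=height_scale
        and F="\<lambda>v. sin (x * v)" and G="\<lambda>v. v" and \<theta>=\<theta>,
        OF a(1) order_refl m tendsto_sin_scale[OF a(2)] abs_sin_le_one_plus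
        tendsto_sin_div_scale abs_sin_div_scale]
    unfolding integral by (simp add: power2_eq_square)
qed

text \<open>The asymptotic number of Motzkin paths, which is the denominator of all
  expectations.\<close>

lemma norm_kernel_0_0_tendsto:
  "(\<lambda>n. height_scale n ^ 3 * norm_kernel 0 n n 0 0) \<longlonglongrightarrow> complex_of_real (sqrt (2 / pi))"
proof -
  have one: "(\<lambda>n. real n / real n) \<longlonglongrightarrow> 1" by real_asymp
  show ?thesis
    using local_limit[where a="\<lambda>_. 0" and b="\<lambda>_. 0" and m="\<lambda>n. n" and \<tau>=1 and \<alpha>=height_scale
        and \<beta>=height_scale and F="\<lambda>v. v" and G="\<lambda>v. v" and \<theta>=0,
        OF order_refl order_refl one zero_less_one tendsto_sin_div_scale abs_sin_div_scale
        tendsto_sin_div_scale abs_sin_div_scale]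
    unfolding integral_gaussian_square by (simp add: power3_eq_cube)
qed

subsection \<open>Decomposition of paths into blocks\<close>

lemma sum_PiE_insert:
  fixes f :: "('a \<Rightarrow> 'b) \<Rightarrow> 'c::comm_monoid_add"
  assumes "k \<notin> S"
  shows "(\<Sum>h\<in>Pi\<^sub>E (insert k S) (\<lambda>_. A). f h) = (\<Sum>c\<in>A. \<Sum>h\<in>Pi\<^sub>E S (\<lambda>_. A). f (h(k := c)))"
proof -
  have "(\<Sum>h\<in>Pi\<^sub>E (insert k S) (\<lambda>_. A). f h) = (\<Sum>(c, h)\<in>A \<times> Pi\<^sub>E S (\<lambda>_. A). f (h(k := c)))"
    unfolding PiE_insert_eq
    by (subst sum.reindex) (use inj_combinator[OF assms] in \<open>auto simp: case_prod_unfold\<close>)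
  then show ?thesis by (simp add: sum.cartesian_product)
qed

text \<open>The heights at the ends of the blocks of a path from \<open>0\<close> to \<open>b\<close> that is at height \<open>h i\<close> at
  the end of block \<open>i < k\<close>.\<close>

definition block_height :: "nat \<Rightarrow> (nat \<Rightarrow> int) \<Rightarrow> int \<Rightarrow> nat \<Rightarrow> int" where
  "block_height k h b j = (case j of 0 \<Rightarrow> 0 | Suc i \<Rightarrow> if i < k then h i else b)"

definition block_levels :: "(nat \<Rightarrow> nat) \<Rightarrow> nat \<Rightarrow> int list \<Rightarrow> nat" where
  "block_levels t j \<gamma> = count_list (drop (t j) (take (t (Suc j)) \<gamma>)) 0"

text \<open>Iterated Markov property: the induction cuts off the last block, so the end height
  \<open>b\<close> has to stay general. The factors \<open>v j\<close> depend on the heights at the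
  cuts only and pass through the sum.\<close>

lemma sum_nonneg_paths_blocks:
  fixes z :: "nat \<Rightarrow> complex" and v :: "nat \<Rightarrow> int \<Rightarrow> complex"
  assumes "t 0 = 0" and "mono_on {..Suc k} t" and "int (t k) \<le> N"
  shows "(\<Sum>\<gamma>\<in>nonneg_paths (t (Suc k)) 0 b. (\<Prod>j\<le>k. z j ^ block_levels t j \<gamma>) *
      (\<Prod>j<k. v j (sum_list (take (t (Suc j)) \<gamma>)))) =
    (\<Sum>h\<in>Pi\<^sub>E {..<k} (\<lambda>_. {0..N}).
      (\<Prod>j\<le>k. path_kernel (z j) (t (Suc j) - t j) (block_height k h b j) (block_height k h b (Suc j))) *
      (\<Prod>j<k. v j (h j)))"
  using assms(2,3)
proof (induction k arbitrary: b)
  case 0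
  have "block_levels t 0 \<gamma> = count_list \<gamma> 0" if "\<gamma> \<in> nonneg_paths (t (Suc 0)) 0 b" for \<gamma>
    using that assms(1) by (simp add: block_levels_def nonneg_paths_def)
  then show ?case
    using assms(1) by (simp add: path_kernel_def block_height_def PiE_empty_domain)
next
  case (Suc k)
  define l where "l = t (Suc (Suc k)) - t (Suc k)"
  have le: "t i \<le> t j" if "i \<le> j" "j \<le> Suc (Suc k)" for i j
    using mono_onD[OF Suc.prems(1), of i j] that by simp
  have l: "t (Suc (Suc k)) = t (Suc k) + l"
    using le[of "Suc k" "Suc (Suc k)"] by (simp add: l_def)
  have mono: "mono_on {..Suc k} t"
    using Suc.prems(1) by (rule mono_on_subset) auto
  have N: "int (t k) \<le> N"
    using Suc.prems le[of k "Suc k"] by simp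
  let ?\<phi> = "\<lambda>k \<gamma>. (\<Prod>j\<le>k. z j ^ block_levels t j \<gamma>) * (\<Prod>j<k. v j (sum_list (take (t (Suc j)) \<gamma>)))"
  \<comment> \<open>All blocks up to \<open>k\<close> and all cut heights are read off from the
    initial part, of length \<open>t (Suc k)\<close>; the final part contributes only the level
    steps of block \<open>Suc k\<close>.\<close>
  have append: "?\<phi> (Suc k) (\<gamma> @ \<delta>) = ?\<phi> k \<gamma> * v k c * z (Suc k) ^ count_list \<delta> 0"
    if \<gamma>: "\<gamma> \<in> nonneg_paths (t (Suc k)) 0 c" and \<delta>: "\<delta> \<in> nonneg_paths l c b" for \<gamma> \<delta> c
  proof -
    have len: "length \<gamma> = t (Suc k)" "length \<delta> = l" "sum_list \<gamma> = c"
      using \<gamma> \<delta> by (auto simp: nonneg_paths_def)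
    have B: "block_levels t j (\<gamma> @ \<delta>) = block_levels t j \<gamma>" if "j \<le> k" for j
      using le[of "Suc j" "Suc k"] that len by (simp add: block_levels_def)
    have B': "block_levels t (Suc k) (\<gamma> @ \<delta>) = count_list \<delta> 0"
      using len by (simp add: block_levels_def l)
    have T: "take (t (Suc j)) (\<gamma> @ \<delta>) = take (t (Suc j)) \<gamma>" if "j \<le> k" for j
      using le[of "Suc j" "Suc k"] that len by simp
    have "(\<Prod>j\<le>k. z j ^ block_levels t j (\<gamma> @ \<delta>)) = (\<Prod>j\<le>k. z j ^ block_levels t j \<gamma>)"
      by (intro prod.cong refl) (simp add: B)
    moreover have "(\<Prod>j<k. v j (sum_list (take (t (Suc j)) (\<gamma> @ \<delta>)))) =
        (\<Prod>j<k. v j (sum_list (take (t (Suc j)) \<gamma>)))"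
      by (intro prod.cong refl) (simp only: T lessThan_iff less_imp_le)
    moreover have "take (t (Suc k)) \<gamma> = \<gamma>" using len by simp
    ultimately show ?thesis
      unfolding prod.atMost_Suc prod.lessThan_Suc B' T[OF order_refl] by (simp add: len mult_ac)
  qed
  have "(\<Sum>\<gamma>\<in>nonneg_paths (t (Suc (Suc k))) 0 b. ?\<phi> (Suc k) \<gamma>) =
      (\<Sum>c\<in>{0..N}. \<Sum>\<gamma>\<in>nonneg_paths (t (Suc k)) 0 c. \<Sum>\<delta>\<in>nonneg_paths l c b. ?\<phi> (Suc k) (\<gamma> @ \<delta>))"
    unfolding l by (rule sum_nonneg_paths_split) (use Suc.prems in simp)
  also have "\<dots> = (\<Sum>c\<in>{0..N}. \<Sum>\<gamma>\<in>nonneg_paths (t (Suc k)) 0 c. \<Sum>\<delta>\<in>nonneg_paths l c b.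
      ?\<phi> k \<gamma> * v k c * z (Suc k) ^ count_list \<delta> 0)"
    by (intro sum.cong append refl)
  also have "\<dots> = (\<Sum>c\<in>{0..N}. (\<Sum>\<gamma>\<in>nonneg_paths (t (Suc k)) 0 c. ?\<phi> k \<gamma>) * v k c *
      path_kernel (z (Suc k)) l c b)"
    unfolding path_kernel_def sum_distrib_right unfolding sum_distrib_left ..
  also have "\<dots> = (\<Sum>c\<in>{0..N}. \<Sum>h\<in>Pi\<^sub>E {..<k} (\<lambda>_. {0..N}).
      (\<Prod>j\<le>k. path_kernel (z j) (t (Suc j) - t j) (block_height k h c j) (block_height k h c (Suc j))) *
      (\<Prod>j<k. v j (h j)) * v k c * path_kernel (z (Suc k)) l c b)"
    by (simp only: Suc.IH[OF mono N] sum_distrib_right)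
  also have "\<dots> = (\<Sum>c\<in>{0..N}. \<Sum>h\<in>Pi\<^sub>E {..<k} (\<lambda>_. {0..N}).
      (\<Prod>j\<le>Suc k. path_kernel (z j) (t (Suc j) - t j) (block_height (Suc k) (h(k := c)) b j)
        (block_height (Suc k) (h(k := c)) b (Suc j))) * (\<Prod>j<Suc k. v j ((h(k := c)) j)))"
  proof (intro sum.cong refl)
    fix c h
    \<comment> \<open>The height \<open>c\<close> is the final height of the shorter path and an
      inner cut height of the longer one; both readings give the same block ends up to index
      \<open>Suc k\<close>.\<close>
    have 1: "block_height (Suc k) (h(k := c)) b j = block_height k h c j" if "j \<le> Suc k" for j
      using that by (auto simp: block_height_def split: nat.splits)
    have "block_height (Suc k) (h(k := c)) b (Suc k) = c"
      "block_height (Suc k) (h(k := c)) b (Suc (Suc k)) = b"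
      by (simp_all add: block_height_def)
    then show "(\<Prod>j\<le>k. path_kernel (z j) (t (Suc j) - t j) (block_height k h c j) (block_height k h c (Suc j))) *
        (\<Prod>j<k. v j (h j)) * v k c * path_kernel (z (Suc k)) l c b =
        (\<Prod>j\<le>Suc k. path_kernel (z j) (t (Suc j) - t j) (block_height (Suc k) (h(k := c)) b j)
        (block_height (Suc k) (h(k := c)) b (Suc j))) * (\<Prod>j<Suc k. v j ((h(k := c)) j))"
      by (simp add: 1 l_def mult_ac)
  qed
  also have "\<dots> = (\<Sum>h\<in>Pi\<^sub>E {..<Suc k} (\<lambda>_. {0..N}).
      (\<Prod>j\<le>Suc k. path_kernel (z j) (t (Suc j) - t j) (block_height (Suc k) h b j)
        (block_height (Suc k) h b (Suc j))) * (\<Prod>j<Suc k. v j (h j)))"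
    unfolding lessThan_Suc by (rule sum_PiE_insert[symmetric]) simp
  finally show ?case .
qed

text \<open>Turns a sum over lattice heights into an integral. Space is tiled by cells of volume
  c^(-d) on which the floors are constant, and \<open>F\<close> vanishes on all but finitely many of
  them.\<close>

lemma
  fixes F :: "(nat \<Rightarrow> int) \<Rightarrow> complex" and c :: real
  assumes c: "0 < c" and A: "finite A"
    and F: "\<And>h. h \<in> extensional {..<d} \<Longrightarrow> h \<notin> Pi\<^sub>E {..<d} (\<lambda>_. A) \<Longrightarrow> F h = 0"
  defines "G \<equiv> (\<lambda>x. F (\<lambda>k\<in>{..<d}. \<lfloor>x k * c\<rfloor>))"
  shows integrable_step_function: "integrable (\<Pi>\<^sub>M k\<in>{..<d}. lborel) G"
    and integral_step_function:
      "integral\<^sup>L (\<Pi>\<^sub>M k\<in>{..<d}. lborel) G = (1 / c) ^ d * (\<Sum>h\<in>Pi\<^sub>E {..<d} (\<lambda>_. A). F h)"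
proof -
  interpret product_sigma_finite "\<lambda>_::nat. lborel :: real measure" ..
  let ?M = "\<Pi>\<^sub>M k\<in>{..<d}. lborel :: real measure"
  define cell where "cell h = Pi\<^sub>E {..<d} (\<lambda>k. {real_of_int (h k) / c..<(real_of_int (h k) + 1) / c})"
    for h :: "nat \<Rightarrow> int"
  have fin: "finite (Pi\<^sub>E {..<d} (\<lambda>_. A))"
    using A by (intro finite_PiE) auto
  have cell_sets: "cell h \<in> sets ?M" for h
    unfolding cell_def by (intro sets_PiM_I_finite) auto
  have cell_emeasure: "emeasure ?M (cell h) = ennreal ((1 / c) ^ d)" for h
  proof -
    have "emeasure ?M (cell h) = (\<Prod>k<d. ennreal (1 / c))"
      unfolding cell_def using c
      by (subst emeasure_PiM) (auto simp: divide_right_mono diff_divide_distrib[symmetric])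
    then show ?thesis using c by (simp add: ennreal_power)
  qed
  have in_cell: "x \<in> cell h \<longleftrightarrow> h = (\<lambda>k\<in>{..<d}. \<lfloor>x k * c\<rfloor>)"
    if "x \<in> space ?M" "h \<in> extensional {..<d}" for x h
  proof -
    have "x \<in> cell h \<longleftrightarrow> (\<forall>k<d. h k = \<lfloor>x k * c\<rfloor>)"
    proof -
      have "h k = \<lfloor>x k * c\<rfloor> \<longleftrightarrow> real_of_int (h k) / c \<le> x k \<and> x k < (real_of_int (h k) + 1) / c" for k
        using c by (subst eq_commute) (simp add: floor_eq_iff pos_divide_le_eq pos_less_divide_eq)
      with that(1) show ?thesis by (auto simp: cell_def PiE_iff space_PiM)
    qed
    also have "\<dots> \<longleftrightarrow> h = (\<lambda>k\<in>{..<d}. \<lfloor>x k * c\<rfloor>)"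
      using that(2) by (auto simp: extensional_def fun_eq_iff)
    finally show ?thesis .
  qed
  have G_eq: "G x = (\<Sum>h\<in>Pi\<^sub>E {..<d} (\<lambda>_. A). indicator (cell h) x *\<^sub>R F h)" if x: "x \<in> space ?M" for x
  proof -
    let ?h = "\<lambda>k\<in>{..<d}. \<lfloor>x k * c\<rfloor>"
    have "(\<Sum>h\<in>Pi\<^sub>E {..<d} (\<lambda>_. A). indicator (cell h) x *\<^sub>R F h) =
        (\<Sum>h\<in>Pi\<^sub>E {..<d} (\<lambda>_. A). if h = ?h then F ?h else 0)"
      using in_cell[OF x] by (intro sum.cong) (auto simp: PiE_def indicator_def)
    also have "\<dots> = (if ?h \<in> Pi\<^sub>E {..<d} (\<lambda>_. A) then F ?h else 0)"
      by (rule sum.delta[OF fin])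
    also have "\<dots> = F ?h"
      using F[of ?h] by auto
    finally show ?thesis by (simp add: G_def)
  qed
  have int: "integrable ?M (\<lambda>x. indicator (cell h) x *\<^sub>R F h)" for h
    using cell_sets cell_emeasure by (intro integrable_scaleR_left) (auto simp: integrable_indicator_iff)
  have "integrable ?M (\<lambda>x. \<Sum>h\<in>Pi\<^sub>E {..<d} (\<lambda>_. A). indicator (cell h) x *\<^sub>R F h)"
    using int by (rule Bochner_Integration.integrable_sum)
  then show "integrable ?M G"
    using G_eq by (simp cong: Bochner_Integration.integrable_cong)
  have "integral\<^sup>L ?M G = (\<integral>x. (\<Sum>h\<in>Pi\<^sub>E {..<d} (\<lambda>_. A). indicator (cell h) x *\<^sub>R F h) \<partial>?M)"
    by (intro Bochner_Integration.integral_cong G_eq) auto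
  also have "\<dots> = (\<Sum>h\<in>Pi\<^sub>E {..<d} (\<lambda>_. A). (1 / c) ^ d * F h)"
    using cell_sets cell_emeasure c
    by (subst Bochner_Integration.integral_sum[OF int])
      (auto intro!: sum.cong simp: measure_def scaleR_conv_of_real)
  finally show "integral\<^sup>L ?M G = (1 / c) ^ d * (\<Sum>h\<in>Pi\<^sub>E {..<d} (\<lambda>_. A). F h)"
    by (simp add: sum_distrib_left)
qed

section \<open>Block weights and the exact characteristic function of a uniform Motzkin path\<close>

definition count_kernel :: "nat \<Rightarrow> int \<Rightarrow> int \<Rightarrow> real" where
  "count_kernel m a b = card (nonneg_paths m a b) / 3 ^ m"

lemma norm_kernel_0: "norm_kernel 0 n m a b = of_real (count_kernel m a b)"
  by (simp add: norm_kernel_def count_kernel_def path_kernel_def level_weight_def)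

lemma count_kernel_nonneg: "0 \<le> count_kernel m a b"
  by (simp add: count_kernel_def)

text \<open>Level weights and centring phases have modulus 1. This is the domination by the value at
  \<theta> = 0 that Scheffe's lemma requires.\<close>

lemma cmod_norm_kernel_le: "cmod (norm_kernel \<theta> n m a b) \<le> count_kernel m a b"
proof -
  have "cmod (path_kernel (level_weight \<theta> n) m a b) \<le> (\<Sum>\<gamma>\<in>nonneg_paths m a b. 1)"
    unfolding path_kernel_def
    by (rule sum_norm_le) (simp add: norm_power level_weight_def norm_exp_i_times)
  moreover have "cmod (iexp (- \<theta> * real m / (3 * sqrt (2 * real n)))) = 1"
    by (rule norm_exp_i_times)
  ultimately show ?thesis
    unfolding norm_kernel_def count_kernel_def norm_divide norm_mult
    by (simp add: norm_power divide_right_mono)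
qed

lemma count_kernel_pos: "0 < count_kernel n 0 0"
  using motzkin_paths_nonempty[of n] finite_motzkin_paths[of n]
  by (simp add: count_kernel_def motzkin_paths_eq[symmetric] card_gt_0_iff)

lemma norm_kernel_nonzero:
  assumes "norm_kernel \<theta> n m a b \<noteq> 0"
  shows "0 \<le> b" "b \<le> a + int m"
proof -
  have "nonneg_paths m a b \<noteq> {}"
    using assms by (auto simp: norm_kernel_def path_kernel_def)
  then show "0 \<le> b" "b \<le> a + int m"
    using nonneg_paths_end_nonneg nonneg_paths_end_le by blast+
qed

definition block_time :: "(nat \<Rightarrow> real) \<Rightarrow> nat \<Rightarrow> nat \<Rightarrow> nat" where
  "block_time s n j = nat \<lfloor>real n * s j\<rfloor>"

definition block_weight :: "(nat \<Rightarrow> real) \<Rightarrow> nat \<Rightarrow> (nat \<Rightarrow> real) \<Rightarrow> nat \<Rightarrow> (nat \<Rightarrow> int) \<Rightarrow> complex" where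
  "block_weight s d \<theta> n h = (\<Prod>j\<le>d. norm_kernel (\<theta> j) n (block_time s n (Suc j) - block_time s n j)
     (block_height d h 0 j) (block_height d h 0 (Suc j)))"

text \<open>The exponent of the characteristic function of the centred level counts in the blocks and of
  the heights at the ends of the blocks.\<close>

definition block_phase ::
    "(nat \<Rightarrow> real) \<Rightarrow> nat \<Rightarrow> (nat \<Rightarrow> real) \<Rightarrow> (nat \<Rightarrow> real) \<Rightarrow> nat \<Rightarrow> int list \<Rightarrow> real" where
  "block_phase s d \<theta> \<eta> n \<gamma> =
    ((\<Sum>j\<le>d. \<theta> j * (real (block_levels (block_time s n) j \<gamma>)
        - real (block_time s n (Suc j) - block_time s n j) / 3))
      + (\<Sum>k<d. \<eta> k * real_of_int (sum_list (take (block_time s n (Suc k)) \<gamma>)))) / sqrt (2 * real n)"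

lemma iexp_sum: "finite A \<Longrightarrow> iexp (\<Sum>i\<in>A. f i) = (\<Prod>i\<in>A. iexp (f i))"
  by (simp add: sum_distrib_left exp_sum)

text \<open>The interior times are \<open>s 1, ..., s d\<close>. Blocks are numbered from 0 to
  \<open>d\<close>, but cut heights from 0 to \<open>d - 1\<close>, the k-th one belonging to time
  \<open>s (Suc k)\<close>; this accounts for \<open>\<lambda>k. s (Suc k)\<close> in the excursion
  densities.\<close>

locale partition_of_unit_interval =
  fixes s :: "nat \<Rightarrow> real" and d :: nat
  assumes s_0: "s 0 = 0" and s_last: "s (Suc d) = 1" and s_mono: "strict_mono_on {..Suc d} s"
begin

lemma s_less: "i < j \<Longrightarrow> j \<le> Suc d \<Longrightarrow> s i < s j"
  using s_mono by (auto simp: strict_mono_on_def)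

lemma s_nonneg: "j \<le> Suc d \<Longrightarrow> 0 \<le> s j"
  using s_less[of 0 j] s_0 by (cases j) auto

lemma s_le_1: "j \<le> Suc d \<Longrightarrow> s j \<le> 1"
  using s_less[of j "Suc d"] s_last by (cases "j = Suc d") auto

lemma block_time_0: "block_time s n 0 = 0"
  by (simp add: block_time_def s_0)

lemma block_time_last: "block_time s n (Suc d) = n"
  by (simp add: block_time_def s_last)

lemma block_time_mono: "mono_on {..Suc d} (block_time s n)"
proof (rule mono_onI)
  fix i j assume "i \<in> {..Suc d}" "j \<in> {..Suc d}" "i \<le> j"
  then have "s i \<le> s j"
    using s_less[of i j] by (cases "i = j") auto
  then show "block_time s n i \<le> block_time s n j"
    unfolding block_time_def by (intro nat_mono floor_mono mult_left_mono) auto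
qed

lemma block_time_le: "j \<le> Suc d \<Longrightarrow> block_time s n j \<le> n"
  using mono_onD[OF block_time_mono, of j "Suc d" n] by (simp add: block_time_last)

lemma block_time_tendsto:
  assumes "j \<le> Suc d"
  shows "(\<lambda>n. real (block_time s n j) / real n) \<longlonglongrightarrow> s j"
proof (rule tendsto_sandwich)
  show "\<forall>\<^sub>F n in sequentially. s j - 1 / real n \<le> real (block_time s n j) / real n"
    using eventually_gt_at_top[of "0 :: nat"]
  proof eventually_elim
    case (elim n)
    have "real n * s j - 1 \<le> real_of_int \<lfloor>real n * s j\<rfloor>" by linarith
    from divide_right_mono[OF this, of "real n"] show ?case
      using elim s_nonneg[OF assms] by (simp add: block_time_def diff_divide_distrib)
  qed
  show "\<forall>\<^sub>F n in sequentially. real (block_time s n j) / real n \<le> s j"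
    using eventually_gt_at_top[of "0 :: nat"]
  proof eventually_elim
    case (elim n)
    have "real_of_int \<lfloor>real n * s j\<rfloor> \<le> real n * s j" by linarith
    then show ?case using elim s_nonneg[OF assms] by (simp add: block_time_def field_simps)
  qed
  show "(\<lambda>n. s j - 1 / real n) \<longlonglongrightarrow> s j"
    using tendsto_diff[OF tendsto_const lim_1_over_n, of "s j"] by simp
qed auto

lemma block_length_tendsto:
  assumes "j \<le> d"
  shows "(\<lambda>n. real (block_time s n (Suc j) - block_time s n j) / real n) \<longlonglongrightarrow> s (Suc j) - s j"
proof -
  have "block_time s n j \<le> block_time s n (Suc j)" for n
    using mono_onD[OF block_time_mono, of j "Suc j"] assms by simp
  then have "real (block_time s n (Suc j) - block_time s n j) / real n =
      real (block_time s n (Suc j)) / real n - real (block_time s n j) / real n" for n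
    by (simp add: of_nat_diff diff_divide_distrib)
  then show ?thesis
    using tendsto_diff[OF block_time_tendsto block_time_tendsto, of "Suc j" j] assms by simp
qed

lemma sum_block_length: "(\<Sum>j\<le>d. block_time s n (Suc j) - block_time s n j) = n"
proof -
  have "(\<Sum>j\<le>k. block_time s n (Suc j) - block_time s n j) = block_time s n (Suc k)" if "k \<le> d" for k
    using that
  proof (induction k)
    case (Suc k)
    then show ?case
      using mono_onD[OF block_time_mono, of "Suc k" "Suc (Suc k)" n] by simp
  qed (simp add: block_time_0)
  then show ?thesis by (simp add: block_time_last)
qed

text \<open>The character of a path factors into the centring constant \<open>C\<close>, one level
  weight power per block and one factor per cut height, so the block decomposition applies. The
  block lengths add up to \<open>n\<close>; the powers of 3 in the kernels thus match the single
  \<open>3 ^ n\<close> in the denominator.\<close>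

lemma characteristic_function_motzkin:
  "(\<integral>\<gamma>. iexp (block_phase s d \<theta> \<eta> n \<gamma>) \<partial>measure_pmf (pmf_of_set (motzkin_paths n))) =
    (\<Sum>h\<in>Pi\<^sub>E {..<d} (\<lambda>_. {0..int n}). block_weight s d \<theta> n h *
      (\<Prod>k<d. iexp (\<eta> k * h k / sqrt (2 * real n)))) / norm_kernel 0 n n 0 0"
proof -
  let ?t = "block_time s n"
  define m where "m j = ?t (Suc j) - ?t j" for j
  define r where "r = sqrt (2 * real n)"
  define C where "C = (\<Prod>j\<le>d. iexp (- \<theta> j * real (m j) / (3 * r)))"
  define v where "v k h = iexp (\<eta> k * real_of_int h / r)" for k h
  have phase: "iexp (block_phase s d \<theta> \<eta> n \<gamma>) = C * ((\<Prod>j\<le>d. level_weight (\<theta> j) n ^ block_levels ?t j \<gamma>) *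
      (\<Prod>k<d. v k (sum_list (take (?t (Suc k)) \<gamma>))))" for \<gamma>
  proof -
    have "block_phase s d \<theta> \<eta> n \<gamma> = (\<Sum>j\<le>d. - \<theta> j * real (m j) / (3 * r))
        + (\<Sum>j\<le>d. real (block_levels ?t j \<gamma>) * (\<theta> j / r))
        + (\<Sum>k<d. \<eta> k * real_of_int (sum_list (take (?t (Suc k)) \<gamma>)) / r)"
      unfolding sum.distrib[symmetric] block_phase_def r_def[symmetric] m_def[symmetric] add_divide_distrib sum_divide_distrib
      by (intro arg_cong2[where f="(+)"] sum.cong refl) (simp add: right_diff_distrib diff_divide_distrib)
    then have "iexp (block_phase s d \<theta> \<eta> n \<gamma>) = iexp (\<Sum>j\<le>d. - \<theta> j * real (m j) / (3 * r))
        * iexp (\<Sum>j\<le>d. real (block_levels ?t j \<gamma>) * (\<theta> j / r))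
        * iexp (\<Sum>k<d. \<eta> k * real_of_int (sum_list (take (?t (Suc k)) \<gamma>)) / r)"
      by (simp only: of_real_add distrib_left exp_add)
    moreover have "iexp (real (block_levels ?t j \<gamma>) * (\<theta> j / r)) = level_weight (\<theta> j) n ^ block_levels ?t j \<gamma>" for j
      unfolding level_weight_def r_def[symmetric] exp_of_nat_mult[symmetric] by (simp add: mult_ac)
    ultimately show ?thesis
      by (simp only: iexp_sum[OF finite_atMost] iexp_sum[OF finite_lessThan] C_def v_def mult.assoc)
  qed
  have prod3: "(\<Prod>j\<le>d. (3 :: complex) ^ m j) = 3 ^ n"
    using sum_block_length[of n] by (simp add: m_def flip: power_sum)
  have weight: "C * (\<Prod>j\<le>d. path_kernel (level_weight (\<theta> j) n) (m j) (block_height d h 0 j) (block_height d h 0 (Suc j)))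
      = block_weight s d \<theta> n h * 3 ^ n" for h
    unfolding C_def block_weight_def norm_kernel_def r_def[symmetric] m_def[symmetric] prod3[symmetric]
      prod.distrib[symmetric] by simp
  have "(\<integral>\<gamma>. iexp (block_phase s d \<theta> \<eta> n \<gamma>) \<partial>measure_pmf (pmf_of_set (motzkin_paths n))) =
      (\<Sum>\<gamma>\<in>motzkin_paths n. iexp (block_phase s d \<theta> \<eta> n \<gamma>)) / card (motzkin_paths n)"
    using motzkin_paths_nonempty finite_motzkin_paths
    by (subst integral_measure_pmf[of "motzkin_paths n"])
      (auto simp: sum_distrib_left scaleR_conv_of_real divide_inverse mult.commute intro!: sum.cong)
  also have "(\<Sum>\<gamma>\<in>motzkin_paths n. iexp (block_phase s d \<theta> \<eta> n \<gamma>)) =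
      C * (\<Sum>\<gamma>\<in>nonneg_paths (?t (Suc d)) 0 0. (\<Prod>j\<le>d. level_weight (\<theta> j) n ^ block_levels ?t j \<gamma>) *
      (\<Prod>k<d. v k (sum_list (take (?t (Suc k)) \<gamma>))))"
    unfolding phase motzkin_paths_eq block_time_last by (rule sum_distrib_left[symmetric])
  also have "\<dots> = C * (\<Sum>h\<in>Pi\<^sub>E {..<d} (\<lambda>_. {0..int n}).
      (\<Prod>j\<le>d. path_kernel (level_weight (\<theta> j) n) (m j) (block_height d h 0 j) (block_height d h 0 (Suc j))) *
      (\<Prod>k<d. v k (h k)))"
    unfolding m_def using block_time_le[of d n]
    by (subst sum_nonneg_paths_blocks[OF block_time_0 block_time_mono, where N="int n"]) auto
  also have "\<dots> = (\<Sum>h\<in>Pi\<^sub>E {..<d} (\<lambda>_. {0..int n}). block_weight s d \<theta> n h * (\<Prod>k<d. v k (h k))) * 3 ^ n"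
    unfolding sum_distrib_left sum_distrib_right mult.assoc[symmetric] weight
    by (simp add: mult_ac)
  finally show ?thesis
    by (simp add: norm_kernel_0 count_kernel_def motzkin_paths_eq v_def r_def)
qed

text \<open>A nonzero weight means that every block is realised by a path, so the heights lie
  between 0 and the elapsed time. This provides the finite box for the step function and disposes of
  points with a negative coordinate.\<close>

lemma block_weight_eq_0:
  assumes "h \<in> extensional {..<d}" "h \<notin> Pi\<^sub>E {..<d} (\<lambda>_. {0..int n})"
  shows "block_weight s d \<theta> n h = 0"
proof (rule ccontr)
  assume "block_weight s d \<theta> n h \<noteq> 0"
  then have nz: "norm_kernel (\<theta> j) n (block_time s n (Suc j) - block_time s n j)
     (block_height d h 0 j) (block_height d h 0 (Suc j)) \<noteq> 0" if "j \<le> d" for j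
    using that by (auto simp: block_weight_def)
  have le: "block_height d h 0 j \<le> int (block_time s n j)" if "j \<le> Suc d" for j
    using that
  proof (induction j)
    case (Suc j)
    then show ?case
      using norm_kernel_nonzero(2)[OF nz[of j]] mono_onD[OF block_time_mono, of j "Suc j" n]
      by (simp add: of_nat_diff)
  qed (simp add: block_height_def)
  have "h k \<in> {0..int n}" if "k < d" for k
    using norm_kernel_nonzero(1)[OF nz[of k]] le[of "Suc k"] block_time_le[of "Suc k" n] that
    by (simp add: block_height_def)
  with assms show False by (auto simp: PiE_def Pi_def)
qed

end

section \<open>Boundary values and signs of the kernels, and rounding of heights\<close>

lemma ex_ell_0: "ex_ell t 0 = 0"
  by (simp add: ex_ell_def)

lemma ex_g_0: "ex_g t x 0 = 0"
  by (simp add: ex_g_def)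

lemma ex_ell_nonneg: "0 \<le> y \<Longrightarrow> 0 \<le> t \<Longrightarrow> 0 \<le> ex_ell t y"
  by (simp add: ex_ell_def)

lemma ex_g_nonneg:
  assumes "0 \<le> y" "0 \<le> z" "0 < t"
  shows "0 \<le> ex_g t y z"
proof -
  have "(y - z)\<^sup>2 \<le> (y + z)\<^sup>2"
    using assms by (simp add: power2_diff power2_sum)
  then show ?thesis
    using assms by (simp add: ex_g_def divide_right_mono)
qed

lemma height_scale_pos: "0 < n \<Longrightarrow> 0 < height_scale n"
  by (simp add: height_scale_def)

lemma floor_div_scale_tendsto:
  "(\<lambda>n. (real_of_int \<lfloor>x * height_scale n\<rfloor> + 1) / height_scale n) \<longlonglongrightarrow> x"
proof (rule tendsto_sandwich)
  show "\<forall>\<^sub>F n in sequentially. x \<le> (real_of_int \<lfloor>x * height_scale n\<rfloor> + 1) / height_scale n"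
    using eventually_gt_at_top[of "0 :: nat"]
  proof eventually_elim
    case (elim n)
    have "x * height_scale n \<le> real_of_int \<lfloor>x * height_scale n\<rfloor> + 1" by linarith
    then show ?case using height_scale_pos[OF elim] by (simp add: pos_le_divide_eq)
  qed
  show "\<forall>\<^sub>F n in sequentially. (real_of_int \<lfloor>x * height_scale n\<rfloor> + 1) / height_scale n \<le> x + 1 / height_scale n"
    using eventually_gt_at_top[of "0 :: nat"]
  proof eventually_elim
    case (elim n)
    have "real_of_int \<lfloor>x * height_scale n\<rfloor> + 1 \<le> x * height_scale n + 1" by linarith
    from divide_right_mono[OF this, of "height_scale n"] show ?case
      using height_scale_pos[OF elim] by (simp add: add_divide_distrib)
  qed
  have "(\<lambda>n. 1 / height_scale n) \<longlonglongrightarrow> 0"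
    unfolding height_scale_def by real_asymp
  from tendsto_add[OF tendsto_const this, of x]
  show "(\<lambda>n. x + 1 / height_scale n) \<longlonglongrightarrow> x" by simp
qed auto

text \<open>Heights are rounded in units of \<open>height_scale\<close>, while the theorem divides
  by \<open>sqrt (2 * real n)\<close>, which is sqrt 3 times larger; hence the factor 1 / sqrt 3 of
  the excursion.\<close>

lemma floor_div_sqrt_tendsto:
  "(\<lambda>n. real_of_int \<lfloor>x * height_scale n\<rfloor> / sqrt (2 * real n)) \<longlonglongrightarrow> x / sqrt 3"
proof -
  have "(\<lambda>n. (real_of_int \<lfloor>x * height_scale n\<rfloor> + 1) / height_scale n * (1 / sqrt 3) - 1 / sqrt (2 * real n))
      \<longlonglongrightarrow> x * (1 / sqrt 3) - 0"
    by (intro tendsto_diff tendsto_mult floor_div_scale_tendsto tendsto_const) real_asymp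
  moreover have "\<forall>\<^sub>F n in sequentially.
      (real_of_int \<lfloor>x * height_scale n\<rfloor> + 1) / height_scale n * (1 / sqrt 3) - 1 / sqrt (2 * real n) =
      real_of_int \<lfloor>x * height_scale n\<rfloor> / sqrt (2 * real n)"
    using eventually_gt_at_top[of "0 :: nat"]
  proof eventually_elim
    case (elim n)
    have "height_scale n * sqrt 3 = sqrt (2 * real n)"
      by (simp add: height_scale_def real_sqrt_divide)
    then show ?case
      by (simp add: add_divide_distrib)
  qed
  ultimately show ?thesis
    by (auto intro: Lim_transform_eventually)
qed

section \<open>Convergence of the rescaled block weights and of the characteristic functions\<close>

context partition_of_unit_interval
begin

definition grid :: "nat \<Rightarrow> (nat \<Rightarrow> real) \<Rightarrow> nat \<Rightarrow> int" where
  "grid n x = (\<lambda>k\<in>{..<d}. \<lfloor>x k * height_scale n\<rfloor>)"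

text \<open>The step function whose integral is the characteristic function: the power of
  \<open>height_scale\<close> cancels the volume of a lattice cell. For positive \<open>n\<close>
  and zero frequencies it is a probability density.\<close>

definition scaled_weight :: "(nat \<Rightarrow> real) \<Rightarrow> (nat \<Rightarrow> real) \<Rightarrow> nat \<Rightarrow> (nat \<Rightarrow> real) \<Rightarrow> complex" where
  "scaled_weight \<theta> \<eta> n x = of_real (height_scale n ^ d) * (block_weight s d \<theta> n (grid n x) *
     (\<Prod>k<d. iexp (\<eta> k * grid n x k / sqrt (2 * real n)))) / norm_kernel 0 n n 0 0"

text \<open>Product of the characteristic functions at \<open>\<theta> j\<close> of the increments
  of -B/3, whose variances are \<open>(s (Suc j) - s j) / 9\<close>.\<close>

definition gaussian_factor :: "(nat \<Rightarrow> real) \<Rightarrow> real" where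
  "gaussian_factor \<theta> = (\<Prod>j\<le>d. exp (- (\<theta> j)\<^sup>2 * (s (Suc j) - s j) / 18))"

text \<open>Counting powers of \<open>height_scale\<close> with \<open>d = e + 1\<close>: 2 for the
  first block, 2 for the last, 1 for each of the \<open>e\<close> middle blocks, minus 3 for the
  denominator, in total \<open>d\<close>. The factors 2 of the two outer kernels, divided by sqrt (2
  / \<pi>), give the constant sqrt (8 \<pi>) of the excursion density.\<close>

lemma block_weight_tendsto:
  assumes d: "0 < d" and x: "\<And>k. k < d \<Longrightarrow> 0 \<le> x k"
  shows "(\<lambda>n. of_real (height_scale n ^ d) * block_weight s d \<theta> n (grid n x) / norm_kernel 0 n n 0 0)
    \<longlonglongrightarrow> complex_of_real (gaussian_factor \<theta> * excursion_density d (\<lambda>k. s (Suc k)) x)"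
proof -
  obtain e where e: "d = Suc e" using d by (cases d) auto
  define c where "c n = complex_of_real (height_scale n)" for n
  define m where "m j n = block_time s n (Suc j) - block_time s n j" for j n
  define D where "D j = s (Suc j) - s j" for j
  have D: "0 < D j" if "j \<le> d" for j
    using s_less[of j "Suc j"] that by (simp add: D_def)
  have m: "(\<lambda>n. real (m j n) / real n) \<longlonglongrightarrow> D j" if "j \<le> d" for j
    unfolding m_def D_def by (rule block_length_tendsto[OF that])
  define K where "K j n = norm_kernel (\<theta> j) n (m j n) (block_height d (grid n x) 0 j)
      (block_height d (grid n x) 0 (Suc j))" for j n
  define E where "E j = exp (- (\<theta> j)\<^sup>2 * D j / 18)" for j
  have grid_nonneg: "0 \<le> \<lfloor>x k * height_scale n\<rfloor>" if "k < d" for k n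
    using x[OF that] by (simp add: height_scale_def)
  have grid: "grid n x k = \<lfloor>x k * height_scale n\<rfloor>" if "k < d" for k n
    using that by (simp add: grid_def)
  have less: "e < d" "\<not> Suc e < d" and less': "j < e \<Longrightarrow> j < d \<and> Suc j < d" for j
    using e by auto
  have first: "(\<lambda>n. c n ^ 2 * K 0 n) \<longlonglongrightarrow> complex_of_real (E 0 * (2 * ex_ell (D 0) (x 0)))"
    using norm_kernel_from_0_tendsto[OF m D grid_nonneg floor_div_scale_tendsto, of 0 0 "\<theta> 0"] d
    by (simp add: c_def K_def E_def block_height_def grid)
  have last: "(\<lambda>n. c n ^ 2 * K (Suc e) n) \<longlonglongrightarrow> complex_of_real (E (Suc e) * (2 * ex_ell (D (Suc e)) (x e)))"
    using norm_kernel_to_0_tendsto[OF m D grid_nonneg floor_div_scale_tendsto, of "Suc e" e "\<theta> (Suc e)"] less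
    by (simp add: c_def K_def E_def block_height_def grid)
  have middle: "(\<lambda>n. c n * K (Suc j) n) \<longlonglongrightarrow> complex_of_real (E (Suc j) * ex_g (D (Suc j)) (x j) (x (Suc j)))"
    if "j < e" for j
    using norm_kernel_tendsto[OF m D grid_nonneg floor_div_scale_tendsto
        grid_nonneg floor_div_scale_tendsto, of "Suc j" j "Suc j" "\<theta> (Suc j)"] less'[OF that]
    by (simp add: c_def K_def E_def block_height_def grid)
  have total: "(\<lambda>n. c n ^ 3 * norm_kernel 0 n n 0 0) \<longlonglongrightarrow> complex_of_real (sqrt (2 / pi))"
    unfolding c_def using norm_kernel_0_0_tendsto by simp
  have "(\<lambda>n. (c n ^ 2 * K 0 n) * (\<Prod>j<e. c n * K (Suc j) n) * (c n ^ 2 * K (Suc e) n) /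
      (c n ^ 3 * norm_kernel 0 n n 0 0)) \<longlonglongrightarrow>
      complex_of_real (E 0 * (2 * ex_ell (D 0) (x 0)))
        * (\<Prod>j<e. complex_of_real (E (Suc j) * ex_g (D (Suc j)) (x j) (x (Suc j))))
        * complex_of_real (E (Suc e) * (2 * ex_ell (D (Suc e)) (x e))) / complex_of_real (sqrt (2 / pi))"
    by (intro tendsto_divide tendsto_mult tendsto_prod first last middle total) auto
  also have "complex_of_real (E 0 * (2 * ex_ell (D 0) (x 0)))
        * (\<Prod>j<e. complex_of_real (E (Suc j) * ex_g (D (Suc j)) (x j) (x (Suc j))))
        * complex_of_real (E (Suc e) * (2 * ex_ell (D (Suc e)) (x e))) / complex_of_real (sqrt (2 / pi)) =
      complex_of_real ((E 0 * (\<Prod>j<e. E (Suc j)) * E (Suc e)) * (4 / sqrt (2 / pi) * ex_ell (D 0) (x 0) *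
        ex_ell (D (Suc e)) (x e) * (\<Prod>j<e. ex_g (D (Suc j)) (x j) (x (Suc j)))))"
    by (simp add: prod.distrib)
  also have "E 0 * (\<Prod>j<e. E (Suc j)) * E (Suc e) = gaussian_factor \<theta>"
    unfolding gaussian_factor_def unfolding e prod.atMost_Suc_shift
    by (simp add: E_def D_def lessThan_Suc_atMost[symmetric] mult.assoc)
  also have "4 / sqrt (2 / pi) = sqrt (8 * pi)"
  proof -
    have "sqrt (8 * pi) * sqrt (2 / pi) = sqrt 16"
      unfolding real_sqrt_mult[symmetric] by simp
    also have "sqrt 16 = 4"
      using real_sqrt_abs[of 4] by simp
    finally show ?thesis
      by (simp add: field_simps)
  qed
  also have "sqrt (8 * pi) * ex_ell (D 0) (x 0) * ex_ell (D (Suc e)) (x e) *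
      (\<Prod>j<e. ex_g (D (Suc j)) (x j) (x (Suc j))) = excursion_density d (\<lambda>k. s (Suc k)) x"
  proof (cases "\<forall>k<d. 0 < x k")
    case True
    then show ?thesis
      using s_0 s_last by (simp add: excursion_density_def e D_def)
  next
    case False
    then obtain k where k: "k < d" "x k = 0"
      using x by (auto simp: not_less order_antisym)
    \<comment> \<open>At a point with a zero coordinate the density is 0 by definition, and so is
      the limit: coordinate 0 annihilates the first kernel, a later one the kernel of the middle
      block that ends there.\<close>
    have "ex_ell (D 0) (x 0) = 0 \<or> (\<Prod>j<e. ex_g (D (Suc j)) (x j) (x (Suc j))) = 0"
    proof (cases k)
      case (Suc j)
      then show ?thesis using k e by (auto simp: ex_g_0 intro!: bexI[of _ j])
    qed (use k in \<open>simp add: ex_ell_0\<close>)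
    then show ?thesis
      using False by (auto simp: excursion_density_def)
  qed
  finally have lim: "(\<lambda>n. (c n ^ 2 * K 0 n) * (\<Prod>j<e. c n * K (Suc j) n) * (c n ^ 2 * K (Suc e) n) /
      (c n ^ 3 * norm_kernel 0 n n 0 0)) \<longlonglongrightarrow>
      complex_of_real (gaussian_factor \<theta> * excursion_density d (\<lambda>k. s (Suc k)) x)" .
  have "\<forall>\<^sub>F n in sequentially. (c n ^ 2 * K 0 n) * (\<Prod>j<e. c n * K (Suc j) n) * (c n ^ 2 * K (Suc e) n) /
      (c n ^ 3 * norm_kernel 0 n n 0 0) =
      of_real (height_scale n ^ d) * block_weight s d \<theta> n (grid n x) / norm_kernel 0 n n 0 0"
    using eventually_gt_at_top[of "0 :: nat"]
  proof eventually_elim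
    case (elim n)
    have c: "c n \<noteq> 0" using height_scale_pos[OF elim] by (simp add: c_def)
    have "block_weight s d \<theta> n (grid n x) = K 0 n * (\<Prod>j<e. K (Suc j) n) * K (Suc e) n"
      unfolding block_weight_def e prod.atMost_Suc_shift
      by (simp add: K_def m_def e lessThan_Suc_atMost[symmetric] mult.assoc)
    then show ?case
      using c by (simp add: prod.distrib e c_def[symmetric] power2_eq_square power3_eq_cube field_simps)
  qed
  from Lim_transform_eventually[OF lim this] show ?thesis .
qed

lemma scaled_weight_tendsto:
  assumes d: "0 < d"
  shows "(\<lambda>n. scaled_weight \<theta> \<eta> n x) \<longlonglongrightarrow>
    complex_of_real (gaussian_factor \<theta> * excursion_density d (\<lambda>k. s (Suc k)) x) *
      (\<Prod>k<d. iexp (\<eta> k * (x k / sqrt 3)))"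
proof (cases "\<forall>k<d. 0 \<le> x k")
  case True
  have "(\<lambda>n. complex_of_real (\<eta> k * (real_of_int \<lfloor>x k * height_scale n\<rfloor> / sqrt (2 * real n))))
      \<longlonglongrightarrow> complex_of_real (\<eta> k * (x k / sqrt 3))" for k
    by (intro tendsto_of_real tendsto_mult tendsto_const floor_div_sqrt_tendsto)
  then have phase: "(\<lambda>n. \<Prod>k<d. iexp (\<eta> k * (real_of_int \<lfloor>x k * height_scale n\<rfloor> / sqrt (2 * real n))))
      \<longlonglongrightarrow> (\<Prod>k<d. iexp (\<eta> k * (x k / sqrt 3)))"
    by (intro tendsto_prod tendsto_exp tendsto_mult tendsto_const)
  have eq: "scaled_weight \<theta> \<eta> n x = of_real (height_scale n ^ d) * block_weight s d \<theta> n (grid n x) / norm_kernel 0 n n 0 0 *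
      (\<Prod>k<d. iexp (\<eta> k * (real_of_int \<lfloor>x k * height_scale n\<rfloor> / sqrt (2 * real n))))" for n
    by (simp add: scaled_weight_def grid_def)
  show ?thesis
    unfolding eq using block_weight_tendsto[OF d] True phase by (intro tendsto_mult) auto
next
  case False
  then obtain k where k: "k < d" "x k < 0" by (auto simp: not_le)
  \<comment> \<open>A negative coordinate is rounded to a negative height, which no path reaches.
    Convergence thus holds at every point of the space.\<close>
  have "scaled_weight \<theta> \<eta> n x = 0" if "0 < n" for n
  proof -
    have "x k * height_scale n < 0"
      using k height_scale_pos[OF that] by (simp add: mult_neg_pos)
    then have "grid n x k < 0" using k by (simp add: grid_def)
    then have "grid n x \<notin> Pi\<^sub>E {..<d} (\<lambda>_. {0..int n})"
      using k(1) by (auto simp: PiE_iff dest!: bspec[of _ _ k])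
    then have "block_weight s d \<theta> n (grid n x) = 0"
      by (intro block_weight_eq_0) (auto simp: grid_def)
    then show ?thesis by (simp add: scaled_weight_def)
  qed
  then have "\<forall>\<^sub>F n in sequentially. scaled_weight \<theta> \<eta> n x = 0"
    by (intro eventually_mono[OF eventually_gt_at_top[of "0 :: nat"]])
  moreover have "excursion_density d (\<lambda>k. s (Suc k)) x = 0"
    using k by (auto simp: excursion_density_def)
  ultimately show ?thesis
    by (simp add: tendsto_eventually)
qed

lemma
  assumes n: "0 < n"
  shows integrable_scaled_weight: "integrable (\<Pi>\<^sub>M k\<in>{..<d}. lborel) (scaled_weight \<theta> \<eta> n)"
    and integral_scaled_weight: "integral\<^sup>L (\<Pi>\<^sub>M k\<in>{..<d}. lborel) (scaled_weight \<theta> \<eta> n) =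
      (\<integral>\<gamma>. iexp (block_phase s d \<theta> \<eta> n \<gamma>) \<partial>measure_pmf (pmf_of_set (motzkin_paths n)))"
proof -
  define F where "F h = of_real (height_scale n ^ d) * (block_weight s d \<theta> n h *
     (\<Prod>k<d. iexp (\<eta> k * h k / sqrt (2 * real n)))) / norm_kernel 0 n n 0 0" for h
  have eq: "scaled_weight \<theta> \<eta> n = (\<lambda>x. F (\<lambda>k\<in>{..<d}. \<lfloor>x k * height_scale n\<rfloor>))"
    by (simp add: fun_eq_iff scaled_weight_def F_def grid_def)
  have F: "F h = 0" if "h \<in> extensional {..<d}" "h \<notin> Pi\<^sub>E {..<d} (\<lambda>_. {0..int n})" for h
    using block_weight_eq_0[OF that] by (simp add: F_def)
  show "integrable (\<Pi>\<^sub>M k\<in>{..<d}. lborel) (scaled_weight \<theta> \<eta> n)"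
    unfolding eq by (rule integrable_step_function[OF height_scale_pos[OF n] finite_atLeastAtMost_int F])
  have step: "integral\<^sup>L (\<Pi>\<^sub>M k\<in>{..<d}. lborel) (scaled_weight \<theta> \<eta> n) =
      (1 / height_scale n) ^ d * (\<Sum>h\<in>Pi\<^sub>E {..<d} (\<lambda>_. {0..int n}). F h)"
    unfolding eq by (rule integral_step_function[OF height_scale_pos[OF n] finite_atLeastAtMost_int F])
  have "(\<Sum>h\<in>Pi\<^sub>E {..<d} (\<lambda>_. {0..int n}). F h) = of_real (height_scale n ^ d) *
      (\<integral>\<gamma>. iexp (block_phase s d \<theta> \<eta> n \<gamma>) \<partial>measure_pmf (pmf_of_set (motzkin_paths n)))"
    unfolding characteristic_function_motzkin F_def by (simp add: sum_distrib_left sum_divide_distrib)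
  then show "integral\<^sup>L (\<Pi>\<^sub>M k\<in>{..<d}. lborel) (scaled_weight \<theta> \<eta> n) =
      (\<integral>\<gamma>. iexp (block_phase s d \<theta> \<eta> n \<gamma>) \<partial>measure_pmf (pmf_of_set (motzkin_paths n)))"
    unfolding step using less_imp_neq[OF height_scale_pos[OF n]] by (simp add: power_divide)
qed

lemma scaled_weight_0_eq:
  "scaled_weight (\<lambda>_. 0) (\<lambda>_. 0) n x = of_real (height_scale n ^ d * (\<Prod>j\<le>d.
     count_kernel (block_time s n (Suc j) - block_time s n j)
       (block_height d (grid n x) 0 j) (block_height d (grid n x) 0 (Suc j))) / count_kernel n 0 0)"
  by (simp add: scaled_weight_def block_weight_def norm_kernel_0)

lemma scaled_weight_0_nonneg:
  "scaled_weight (\<lambda>_. 0) (\<lambda>_. 0) n x = of_real (Re (scaled_weight (\<lambda>_. 0) (\<lambda>_. 0) n x))"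
  "0 \<le> Re (scaled_weight (\<lambda>_. 0) (\<lambda>_. 0) n x)"
  unfolding scaled_weight_0_eq Re_complex_of_real
  by (auto intro!: divide_nonneg_nonneg mult_nonneg_nonneg prod_nonneg count_kernel_nonneg simp: height_scale_def)

lemma cmod_scaled_weight_le:
  "cmod (scaled_weight \<theta> \<eta> n x) \<le> Re (scaled_weight (\<lambda>_. 0) (\<lambda>_. 0) n x)"
proof -
  have "cmod (block_weight s d \<theta> n (grid n x)) \<le> (\<Prod>j\<le>d.
     count_kernel (block_time s n (Suc j) - block_time s n j)
       (block_height d (grid n x) 0 j) (block_height d (grid n x) 0 (Suc j)))"
    unfolding block_weight_def prod_norm[symmetric]
    by (intro prod_mono) (auto intro: cmod_norm_kernel_le)
  moreover have "cmod (\<Prod>k<d. iexp (\<eta> k * grid n x k / sqrt (2 * real n))) = 1"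
    unfolding prod_norm[symmetric] by (intro prod.neutral ballI norm_exp_i_times)
  ultimately show ?thesis
    unfolding scaled_weight_0_eq Re_complex_of_real scaled_weight_def norm_divide norm_mult norm_kernel_0
    using count_kernel_pos[of n]
    by (auto intro!: divide_right_mono mult_left_mono simp: height_scale_def norm_power)
qed

text \<open>Scheffe's lemma applies without any tail estimate because the excursion densities are known
  to have mass one.\<close>

lemma characteristic_function_tendsto:
  fixes Y :: "nat \<Rightarrow> 'a \<Rightarrow> real"
  assumes d: "0 < d" and M: "prob_space M"
    and Y: "distributed M (\<Pi>\<^sub>M k\<in>{..<d}. lborel) (\<lambda>\<omega>. \<lambda>k\<in>{..<d}. Y k \<omega>)
      (excursion_density d (\<lambda>k. s (Suc k)))"
  shows "(\<lambda>n. \<integral>\<gamma>. iexp (block_phase s d \<theta> \<eta> n \<gamma>) \<partial>measure_pmf (pmf_of_set (motzkin_paths n))) \<longlonglongrightarrow>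
    of_real (gaussian_factor \<theta>) * (\<integral>\<omega>. iexp (\<Sum>k<d. \<eta> k * (Y k \<omega> / sqrt 3)) \<partial>M)"
proof -
  let ?N = "\<Pi>\<^sub>M k\<in>{..<d}. lborel :: real measure"
  let ?f = "excursion_density d (\<lambda>k. s (Suc k))"
  let ?e = "\<lambda>x. \<Prod>k<d. iexp (\<eta> k * (x k / sqrt 3))"
  interpret M: prob_space M by fact
  have f_nonneg: "0 \<le> ?f x" for x
  proof -
    have "0 \<le> s (Suc 0)" "0 \<le> 1 - s d" "\<And>k. k < d - 1 \<Longrightarrow> 0 < s (Suc (Suc k)) - s (Suc k)"
      using s_nonneg[of "Suc 0"] s_le_1[of d] s_less d by auto
    then have "0 \<le> sqrt (8 * pi) * ex_ell (s (Suc 0)) (x 0) * ex_ell (1 - s (Suc (d - 1))) (x (d - 1)) *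
        (\<Prod>k<d - 1. ex_g (s (Suc (k + 1)) - s (Suc k)) (x k) (x (k + 1)))" if "\<forall>k<d. 0 < x k"
      using d that
      by (intro mult_nonneg_nonneg prod_nonneg ex_ell_nonneg ex_g_nonneg) (auto intro: less_imp_le)
    then show ?thesis
      by (simp add: excursion_density_def)
  qed
  have f_meas [measurable]: "?f \<in> borel_measurable ?N"
    using distributed_real_measurable[OF _ Y] f_nonneg by auto
  have Y_meas [measurable]: "(\<lambda>\<omega>. \<lambda>k\<in>{..<d}. Y k \<omega>) \<in> measurable M ?N"
    using distributed_measurable[OF Y] .
  have distr: "distr M ?N (\<lambda>\<omega>. \<lambda>k\<in>{..<d}. Y k \<omega>) = density ?N ?f"
    using Y by (simp add: distributed_def)
  \<comment> \<open>The mass of the density is read off from the random vector \<open>Y\<close> that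
    has this density, without evaluating an integral.\<close>
  have f_mass: "(\<integral>\<^sup>+x. ennreal (?f x) \<partial>?N) = 1"
  proof -
    interpret D: prob_space "distr M ?N (\<lambda>\<omega>. \<lambda>k\<in>{..<d}. Y k \<omega>)"
      by (rule M.prob_space_distr) measurable
    have "emeasure (density ?N ?f) (space ?N) = 1"
      using D.emeasure_space_1 unfolding distr by simp
    then show ?thesis
      by (simp add: emeasure_density cong: nn_integral_cong_simp)
  qed
  have f_int: "integrable ?N ?f"
    using f_mass f_nonneg by (intro integrableI_nonneg) auto
  have e_meas [measurable]: "?e \<in> borel_measurable ?N"
    by measurable
  \<comment> \<open>The shift to \<open>Suc n\<close> excludes n = 0, where
    \<open>height_scale\<close> is 0 and the step functions have mass 0 instead of 1.\<close>
  have lim: "(\<lambda>n. integral\<^sup>L ?N (scaled_weight \<theta> \<eta> (Suc n))) \<longlonglongrightarrow>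
      (\<integral>x. complex_of_real (gaussian_factor \<theta> * ?f x) * ?e x \<partial>?N)"
  proof (rule scheffe_dominated)
    have int0: "integrable ?N (scaled_weight (\<lambda>_. 0) (\<lambda>_. 0) (Suc n))" for n
      by (rule integrable_scaled_weight) simp
    then show "(\<lambda>x. Re (scaled_weight (\<lambda>_. 0) (\<lambda>_. 0) (Suc n) x)) \<in> borel_measurable ?N" for n
      by measurable
    show "scaled_weight \<theta> \<eta> (Suc n) \<in> borel_measurable ?N" for n
      using integrable_scaled_weight[of "Suc n"] by auto
    show "(\<lambda>x. complex_of_real (gaussian_factor \<theta> * ?f x) * ?e x) \<in> borel_measurable ?N"
      by measurable
    show "(\<integral>\<^sup>+x. ennreal (Re (scaled_weight (\<lambda>_. 0) (\<lambda>_. 0) (Suc n) x)) \<partial>?N) = (\<integral>\<^sup>+x. ennreal (?f x) \<partial>?N)" for n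
    proof -
      \<comment> \<open>The mass of the approximating density is a characteristic function at
        frequency zero, hence exactly 1.\<close>
      have "complex_of_real (\<integral>x. Re (scaled_weight (\<lambda>_. 0) (\<lambda>_. 0) (Suc n) x) \<partial>?N) =
          integral\<^sup>L ?N (scaled_weight (\<lambda>_. 0) (\<lambda>_. 0) (Suc n))"
        unfolding integral_complex_of_real[symmetric] scaled_weight_0_nonneg(1)[symmetric] ..
      also have "\<dots> = 1"
        by (subst integral_scaled_weight) (simp_all add: block_phase_def)
      finally have "(\<integral>x. Re (scaled_weight (\<lambda>_. 0) (\<lambda>_. 0) (Suc n) x) \<partial>?N) = 1"
        by (simp only: of_real_eq_1_iff)
      then show ?thesis
        using int0[of n] f_mass
        by (subst nn_integral_eq_integral) (auto simp: scaled_weight_0_nonneg(2))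
    qed
    show "AE x in ?N. (\<lambda>n. Re (scaled_weight (\<lambda>_. 0) (\<lambda>_. 0) (Suc n) x)) \<longlonglongrightarrow> ?f x"
    proof (rule AE_I2)
      fix x
      from LIMSEQ_Suc[OF tendsto_Re[OF scaled_weight_tendsto[OF d, of "\<lambda>_. 0" "\<lambda>_. 0" x]]]
      show "(\<lambda>n. Re (scaled_weight (\<lambda>_. 0) (\<lambda>_. 0) (Suc n) x)) \<longlonglongrightarrow> ?f x"
        by (simp add: gaussian_factor_def)
    qed
    show "AE x in ?N. (\<lambda>n. scaled_weight \<theta> \<eta> (Suc n) x) \<longlonglongrightarrow> complex_of_real (gaussian_factor \<theta> * ?f x) * ?e x"
      by (rule AE_I2, rule LIMSEQ_Suc, rule scaled_weight_tendsto[OF d])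
  qed (use f_int f_nonneg cmod_scaled_weight_le in auto)
  also have "(\<integral>x. complex_of_real (gaussian_factor \<theta> * ?f x) * ?e x \<partial>?N) =
      of_real (gaussian_factor \<theta>) * (\<integral>x. ?f x *\<^sub>R ?e x \<partial>?N)"
    unfolding integral_mult_right_zero[symmetric] by (simp add: scaleR_conv_of_real mult.assoc)
  also have "(\<integral>x. ?f x *\<^sub>R ?e x \<partial>?N) = (\<integral>x. ?e x \<partial>distr M ?N (\<lambda>\<omega>. \<lambda>k\<in>{..<d}. Y k \<omega>))"
    unfolding distr by (subst integral_density) (auto simp: f_nonneg)
  also have "\<dots> = (\<integral>\<omega>. ?e (\<lambda>k\<in>{..<d}. Y k \<omega>) \<partial>M)"
    by (rule integral_distr) measurable
  also have "\<dots> = (\<integral>\<omega>. iexp (\<Sum>k<d. \<eta> k * (Y k \<omega> / sqrt 3)) \<partial>M)"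
    unfolding iexp_sum[OF finite_lessThan] by (intro Bochner_Integration.integral_cong prod.cong) auto
  finally have "(\<lambda>n. \<integral>\<gamma>. iexp (block_phase s d \<theta> \<eta> (Suc n) \<gamma>) \<partial>measure_pmf (pmf_of_set (motzkin_paths (Suc n)))) \<longlonglongrightarrow>
    of_real (gaussian_factor \<theta>) * (\<integral>\<omega>. iexp (\<Sum>k<d. \<eta> k * (Y k \<omega> / sqrt 3)) \<partial>M)"
    by (simp only: integral_scaled_weight[OF zero_less_Suc])
  then show ?thesis
    by (rule LIMSEQ_imp_Suc)
qed

end

subsection \<open>Reduction to sorted times\<close>

text \<open>The prescribed times may be unsorted, may coincide and may be 0 or 1, whereas the
  densities concern strictly increasing interior times; \<open>idx\<close> locates each prescribed
  time among the sorted ones.\<close>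

lemma obtain_partition_of_unit_interval:
  fixes \<tau> :: "'d::finite \<Rightarrow> real"
  assumes "\<And>i. \<tau> i \<in> {0..1}"
  obtains s d idx where "partition_of_unit_interval s d" "0 < d" "\<And>i. idx i \<le> Suc d" "\<And>i. \<tau> i = s (idx i)"
proof -
  \<comment> \<open>The time 1/2 is added so that there is at least one interior time, that is,
    \<open>0 < d\<close>.\<close>
  define T where "T = {0, 1 / 2, 1} \<union> range \<tau>"
  have T: "finite T" "T \<subseteq> {0..1}" using assms by (auto simp: T_def)
  define xs where "xs = sorted_list_of_set T"
  have set: "set xs = T" and sorted: "sorted_wrt (<) xs"
    using T by (simp_all add: xs_def)
  have "card {0, 1 / 2, 1 :: real} \<le> card T"
    using T by (intro card_mono) (auto simp: T_def)
  then have "3 \<le> length xs"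
    using T by (simp add: xs_def)
  define d where "d = length xs - 2"
  have len: "length xs = Suc (Suc d)" and d: "0 < d"
    using \<open>3 \<le> length xs\<close> by (auto simp: d_def)
  define s where "s = (!) xs"
  have less: "s i < s j" if "i < j" "j \<le> Suc d" for i j
    using sorted_wrt_nth_less[OF sorted that(1)] that len by (simp add: s_def)
  have sT: "s i \<in> T" if "i \<le> Suc d" for i
    using that len nth_mem[of i xs] by (simp add: s_def set)
  have surj: "\<exists>i\<le>Suc d. x = s i" if "x \<in> T" for x
    using that len unfolding set[symmetric] in_set_conv_nth s_def by (metis less_Suc_eq_le)
  have "s 0 = 0"
  proof -
    obtain i where "i \<le> Suc d" "0 = s i" using surj[of 0] by (auto simp: T_def)
    moreover have "0 \<le> s 0" using sT[of 0] T by auto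
    ultimately show ?thesis using less[of 0 i] by (cases "i = 0") auto
  qed
  moreover have "s (Suc d) = 1"
  proof -
    obtain i where "i \<le> Suc d" "1 = s i" using surj[of 1] by (auto simp: T_def)
    moreover have "s (Suc d) \<le> 1" using sT[of "Suc d"] T by auto
    ultimately show ?thesis using less[of i "Suc d"] by (cases "i = Suc d") auto
  qed
  ultimately have "partition_of_unit_interval s d"
    by unfold_locales (auto simp: strict_mono_on_def less)
  moreover have "\<forall>i. \<exists>k\<le>Suc d. \<tau> i = s k"
    using surj by (auto simp: T_def)
  then obtain idx where "\<And>i. idx i \<le> Suc d" "\<And>i. \<tau> i = s (idx i)"
    by metis
  ultimately show ?thesis using that d by blast
qed

text \<open>Collects the coefficients of equal times. Meant for the heights and the excursion, which
  vanish at both ends of the time interval.\<close>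

lemma sum_by_index:
  fixes \<alpha> :: "'d::finite \<Rightarrow> real"
  assumes "\<And>i. idx i \<le> Suc d" "f 0 = 0" "f (Suc d) = 0"
  shows "(\<Sum>i\<in>UNIV. \<alpha> i * f (idx i)) = (\<Sum>k<d. (\<Sum>i\<in>UNIV. if idx i = Suc k then \<alpha> i else 0) * f (Suc k))"
proof -
  have "\<alpha> i * f (idx i) = (\<Sum>k<d. (if idx i = Suc k then \<alpha> i else 0) * f (Suc k))" for i
  proof (cases "idx i = 0 \<or> idx i = Suc d")
    case False
    then obtain k where k: "idx i = Suc k" "k < d"
      using assms(1)[of i] by (cases "idx i") auto
    have "(\<Sum>k'<d. (if idx i = Suc k' then \<alpha> i else 0) * f (Suc k')) = (\<Sum>k'<d. if k' = k then \<alpha> i * f (Suc k) else 0)"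
      by (intro sum.cong) (auto simp: k)
    then show ?thesis using k by simp
  qed (use assms in \<open>auto intro!: sum.neutral[symmetric]\<close>)
  then show ?thesis
    by (simp add: sum_distrib_right sum.swap[of _ UNIV])
qed

text \<open>Summation by parts. Meant for the level counts and the Brownian motion, which start at 0
  and are controlled through their increments over the blocks.\<close>

lemma sum_by_increments:
  fixes \<beta> :: "'d::finite \<Rightarrow> real"
  assumes "\<And>i. idx i \<le> Suc d" "g 0 = 0"
  shows "(\<Sum>i\<in>UNIV. \<beta> i * g (idx i)) = (\<Sum>j\<le>d. (\<Sum>i\<in>UNIV. if j < idx i then \<beta> i else 0) * (g (Suc j) - g j))"
proof -
  have "\<beta> i * g (idx i) = (\<Sum>j\<le>d. (if j < idx i then \<beta> i else 0) * (g (Suc j) - g j))" for i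
  proof -
    have "(\<Sum>j\<le>d. (if j < idx i then \<beta> i else 0) * (g (Suc j) - g j)) =
        (\<Sum>j\<in>{..d} \<inter> {..<idx i}. \<beta> i * (g (Suc j) - g j))"
      by (subst sum.inter_restrict) (auto intro!: sum.cong)
    also have "{..d} \<inter> {..<idx i} = {..<idx i}"
      using assms(1)[of i] by auto
    also have "(\<Sum>j<idx i. \<beta> i * (g (Suc j) - g j)) = \<beta> i * g (idx i)"
      using assms(2) by (simp add: sum_distrib_left[symmetric] sum_lessThan_telescope)
    finally show ?thesis ..
  qed
  then show ?thesis
    by (simp add: sum_distrib_right sum.swap[of _ UNIV])
qed

text \<open>The three counts add up to \<open>m\<close>, and ascents minus descents is the height
  \<open>S\<close>; solving for the counts leaves only the rounding error
  \<open>real m - real n * t\<close>.\<close>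

lemma steps_eq:
  assumes \<gamma>: "\<gamma> \<in> motzkin_paths n" and t: "0 \<le> t" "t \<le> 1"
  defines "m \<equiv> nat \<lfloor>real n * t\<rfloor>"
  defines "S \<equiv> real_of_int (sum_list (take m \<gamma>))" and "L \<equiv> real (count_list (take m \<gamma>) 0) - real m / 3"
  shows "ascents n \<gamma> t - real n * t / 3 = S / 2 - L / 2 + (real m - real n * t) / 3"
    and "levels n \<gamma> t - real n * t / 3 = L + (real m - real n * t) / 3"
    and "descents n \<gamma> t - real n * t / 3 = - S / 2 - L / 2 + (real m - real n * t) / 3"
proof -
  have len: "length \<gamma> = n" and set: "set \<gamma> \<subseteq> {-1, 0, 1}"
    using \<gamma> by (auto simp: motzkin_paths_def)
  have "real n * t \<le> real n" using t by (simp add: mult_left_le)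
  then have m: "m \<le> n" by (simp add: m_def) linarith
  have steps: "steps e n \<gamma> t = sum_list (map (\<lambda>x. of_bool (x = e)) (take m \<gamma>))" for e
    unfolding steps_def m_def[symmetric] using m len by (intro sum_nth_eq_sum_list_take) simp
  have counts:
    "2 * sum_list (map (\<lambda>x. of_bool (x = 1)) \<delta>) = real (length \<delta>) - real (count_list \<delta> 0) + real_of_int (sum_list \<delta>)"
    "sum_list (map (\<lambda>x. of_bool (x = 0)) \<delta>) = real (count_list \<delta> 0)"
    "2 * sum_list (map (\<lambda>x. of_bool (x = -1)) \<delta>) = real (length \<delta>) - real (count_list \<delta> 0) - real_of_int (sum_list \<delta>)"
    if "set \<delta> \<subseteq> {-1, 0, 1}" for \<delta> :: "int list"
    using that by (induction \<delta>) auto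
  have "set (take m \<gamma>) \<subseteq> {-1, 0, 1}" "length (take m \<gamma>) = m"
    using set set_take_subset[of m \<gamma>] m len by auto
  note c = counts[OF this(1), unfolded this(2)]
  show "ascents n \<gamma> t - real n * t / 3 = S / 2 - L / 2 + (real m - real n * t) / 3"
    "levels n \<gamma> t - real n * t / 3 = L + (real m - real n * t) / 3"
    "descents n \<gamma> t - real n * t / 3 = - S / 2 - L / 2 + (real m - real n * t) / 3"
    unfolding steps S_def L_def using c by (simp_all add: diff_divide_distrib add_divide_distrib)
qed

section \<open>Linear combinations over the given times, and the characteristic function of the
  limit\<close>

lemma (in prob_space) integral_iexp_normal:
  assumes X: "distributed M lborel X (normal_density 0 \<sigma>)" and \<sigma>: "0 < \<sigma>"
  shows "(\<integral>\<omega>. iexp (a * X \<omega>) \<partial>M) = of_real (exp (- a\<^sup>2 * \<sigma>\<^sup>2 / 2))"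
proof -
  have Z: "distributed M lborel (\<lambda>\<omega>. (X \<omega> - 0) / \<sigma>) std_normal_density"
    using X normal_standard_normal_convert[OF \<sigma>, of X 0] by simp
  then have Z_meas [measurable]: "(\<lambda>\<omega>. X \<omega> / \<sigma>) \<in> measurable M lborel"
    by (simp add: distributed_def)
  have "(\<integral>\<omega>. iexp (a * X \<omega>) \<partial>M) = (\<integral>\<omega>. iexp (a * \<sigma> * (X \<omega> / \<sigma>)) \<partial>M)"
    using \<sigma> by simp
  also have "\<dots> = (\<integral>x. iexp (a * \<sigma> * x) \<partial>distr M lborel (\<lambda>\<omega>. X \<omega> / \<sigma>))"
    by (subst integral_distr[OF Z_meas]) auto
  also have "distr M lborel (\<lambda>\<omega>. X \<omega> / \<sigma>) = std_normal_distribution"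
    using Z by (simp add: distributed_def)
  also have "(\<integral>x. iexp (a * \<sigma> * x) \<partial>std_normal_distribution) = char std_normal_distribution (a * \<sigma>)"
    by (simp add: char_def)
  also have "\<dots> = of_real (exp (- a\<^sup>2 * \<sigma>\<^sup>2 / 2))"
    by (simp add: char_std_normal_distribution power_mult_distrib exp_of_real[symmetric])
  finally show ?thesis .
qed

context partition_of_unit_interval
begin

text \<open>Heights are grouped by time, using that a Motzkin path starts and ends at 0; centred
  level counts are split into the contributions of the blocks.\<close>

lemma block_phase_eq:
  fixes \<alpha> \<beta> :: "'d::finite \<Rightarrow> real"
  assumes \<gamma>: "\<gamma> \<in> motzkin_paths n" and idx: "\<And>i. idx i \<le> Suc d"
  shows "(\<Sum>i\<in>UNIV. \<alpha> i * real_of_int (sum_list (take (block_time s n (idx i)) \<gamma>)) +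
      \<beta> i * (real (count_list (take (block_time s n (idx i)) \<gamma>) 0) - real (block_time s n (idx i)) / 3)) / sqrt (2 * real n) =
    block_phase s d (\<lambda>j. \<Sum>i\<in>UNIV. if j < idx i then \<beta> i else 0)
      (\<lambda>k. \<Sum>i\<in>UNIV. if idx i = Suc k then \<alpha> i else 0) n \<gamma>"
proof -
  define f where "f j = real_of_int (sum_list (take (block_time s n j) \<gamma>))" for j
  define g where "g j = real (count_list (take (block_time s n j) \<gamma>) 0) - real (block_time s n j) / 3" for j
  have "f 0 = 0" "g 0 = 0"
    by (simp_all add: f_def g_def block_time_0)
  have "f (Suc d) = 0"
    using \<gamma> by (simp add: f_def block_time_last motzkin_paths_eq nonneg_paths_def)
  have incr: "real (block_levels (block_time s n) j \<gamma>) - real (block_time s n (Suc j) - block_time s n j) / 3 = g (Suc j) - g j"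
    if "j \<le> d" for j
  proof -
    have le: "block_time s n j \<le> block_time s n (Suc j)"
      using mono_onD[OF block_time_mono, of j "Suc j"] that by simp
    then have "take (block_time s n (Suc j)) \<gamma> =
        take (block_time s n j) \<gamma> @ drop (block_time s n j) (take (block_time s n (Suc j)) \<gamma>)"
      using append_take_drop_id[of "block_time s n j" "take (block_time s n (Suc j)) \<gamma>"] by (simp add: min_absorb1)
    then have "count_list (take (block_time s n (Suc j)) \<gamma>) 0 =
        count_list (take (block_time s n j) \<gamma>) 0 + block_levels (block_time s n) j \<gamma>"
      unfolding block_levels_def by (metis count_list_append)
    then show ?thesis
      using le by (simp add: g_def of_nat_diff diff_divide_distrib)
  qed
  have "(\<Sum>i\<in>UNIV. \<alpha> i * f (idx i) + \<beta> i * g (idx i)) = (\<Sum>i\<in>UNIV. \<beta> i * g (idx i)) + (\<Sum>i\<in>UNIV. \<alpha> i * f (idx i))"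
    by (simp add: sum.distrib)
  also have "\<dots> = (\<Sum>j\<le>d. (\<Sum>i\<in>UNIV. if j < idx i then \<beta> i else 0) *
        (real (block_levels (block_time s n) j \<gamma>) - real (block_time s n (Suc j) - block_time s n j) / 3))
      + (\<Sum>k<d. (\<Sum>i\<in>UNIV. if idx i = Suc k then \<alpha> i else 0) * f (Suc k))"
    unfolding sum_by_index[of idx d f, OF idx \<open>f 0 = 0\<close> \<open>f (Suc d) = 0\<close>] sum_by_increments[of idx d g, OF idx \<open>g 0 = 0\<close>]
    by (simp add: incr)
  finally show ?thesis
    by (simp add: block_phase_def f_def g_def)
qed

text \<open>The coefficient -1/3 comes from the level component -B/3 of the limit; independence of
  the increments gives the product.\<close>

lemma brownian_increments_characteristic_function:
  assumes B: "brownian_motion M B"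
  shows "(\<integral>\<omega>. iexp (\<Sum>j\<le>d. - \<theta> j / 3 * (B (s (Suc j)) \<omega> - B (s j) \<omega>)) \<partial>M) = of_real (gaussian_factor \<theta>)"
proof -
  interpret prob_space M using B by (simp add: brownian_motion_def)
  define X where "X j \<omega> = iexp (- \<theta> j / 3 * (B (s (Suc j)) \<omega> - B (s j) \<omega>))" for j \<omega>
  have "s ` {..Suc d} \<subseteq> {0..1}"
    using s_nonneg s_le_1 by auto
  then have "indep_vars (\<lambda>_. borel) (\<lambda>j \<omega>. B (s (Suc j)) \<omega> - B (s j) \<omega>) {..<Suc d}"
    using B s_mono unfolding brownian_motion_def by blast
  then have indep: "indep_vars (\<lambda>_. borel) X {..<Suc d}"
    unfolding X_def by (rule indep_vars_compose2) measurable
  have char: "(\<integral>\<omega>. X j \<omega> \<partial>M) = of_real (exp (- (\<theta> j)\<^sup>2 * (s (Suc j) - s j) / 18))" if "j \<le> d" for j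
  proof -
    have less: "s j < s (Suc j)" using s_less that by simp
    then have "distributed M lborel (\<lambda>\<omega>. B (s (Suc j)) \<omega> - B (s j) \<omega>) (normal_density 0 (sqrt (s (Suc j) - s j)))"
      using B that s_nonneg[of j] s_le_1[of "Suc j"] unfolding brownian_motion_def by auto
    from integral_iexp_normal[OF this, of "- \<theta> j / 3"] less
    show ?thesis by (simp add: X_def power_divide)
  qed
  have "iexp (\<Sum>j\<le>d. - \<theta> j / 3 * (B (s (Suc j)) \<omega> - B (s j) \<omega>)) = (\<Prod>j<Suc d. X j \<omega>)" for \<omega>
    unfolding iexp_sum[OF finite_atMost] X_def lessThan_Suc_atMost ..
  then have "(\<integral>\<omega>. iexp (\<Sum>j\<le>d. - \<theta> j / 3 * (B (s (Suc j)) \<omega> - B (s j) \<omega>)) \<partial>M) = (\<integral>\<omega>. (\<Prod>j<Suc d. X j \<omega>) \<partial>M)"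
    by simp
  also have "\<dots> = (\<Prod>j<Suc d. \<integral>\<omega>. X j \<omega> \<partial>M)"
  proof (rule indep_vars_lebesgue_integral[OF finite_lessThan indep])
    fix j assume j: "j \<in> {..<Suc d}"
    have "X j \<in> borel_measurable M"
      using indep j by (auto simp: indep_vars_def)
    then show "integrable M (X j)"
      by (intro integrable_const_bound[of _ 1]) (auto simp: X_def norm_exp_i_times)
  qed
  also have "\<dots> = of_real (gaussian_factor \<theta>)"
    by (simp add: char gaussian_factor_def lessThan_Suc_atMost)
  finally show ?thesis .
qed

lemma limit_characteristic_function:
  assumes B: "brownian_motion M B" and X: "brownian_excursion M X" and indep: "indep_processes M B X"
  shows "(\<integral>\<omega>. iexp ((\<Sum>j\<le>d. - \<theta> j / 3 * (B (s (Suc j)) \<omega> - B (s j) \<omega>)) +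
      (\<Sum>k<d. \<eta> k * (X (s (Suc k)) \<omega> / sqrt 3))) \<partial>M) =
    of_real (gaussian_factor \<theta>) * (\<integral>\<omega>. iexp (\<Sum>k<d. \<eta> k * (X (s (Suc k)) \<omega> / sqrt 3)) \<partial>M)"
proof -
  interpret prob_space M using B by (simp add: brownian_motion_def)
  \<comment> \<open>Independence is formulated for whole sample paths on [0,1], so both exponentials
    are written as functionals of a path; restricting the path to [0,1] does not change them because
    all \<open>s j\<close> lie there.\<close>
  define F where "F w = iexp (\<Sum>j\<le>d. - \<theta> j / 3 * (w (s (Suc j)) - w (s j)))" for w :: "real \<Rightarrow> real"
  define G where "G w = iexp (\<Sum>k<d. \<eta> k * (w (s (Suc k)) / sqrt 3))" for w :: "real \<Rightarrow> real"
  have s01: "s j \<in> {0..1}" if "j \<le> Suc d" for j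
    using s_nonneg s_le_1 that by auto
  have F_meas: "F \<in> borel_measurable (\<Pi>\<^sub>M t\<in>{0..1}. borel)"
  proof -
    have "(\<lambda>w. w (s j)) \<in> borel_measurable (\<Pi>\<^sub>M t\<in>{0..1}. borel :: real measure)" if "j \<le> Suc d" for j
      using s01[OF that] by (rule measurable_component_singleton)
    then show ?thesis
      unfolding F_def by (intro borel_measurable_exp[THEN measurable_compose[rotated]] borel_measurable_times borel_measurable_of_real borel_measurable_sum borel_measurable_diff) auto
  qed
  have G_meas: "G \<in> borel_measurable (\<Pi>\<^sub>M t\<in>{0..1}. borel)"
  proof -
    have "(\<lambda>w. w (s j)) \<in> borel_measurable (\<Pi>\<^sub>M t\<in>{0..1}. borel :: real measure)" if "j \<le> Suc d" for j
      using s01[OF that] by (rule measurable_component_singleton)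
    then show ?thesis
      unfolding G_def by (intro borel_measurable_exp[THEN measurable_compose[rotated]] borel_measurable_times borel_measurable_of_real borel_measurable_sum borel_measurable_divide) auto
  qed
  have "indep_var borel (F \<circ> (\<lambda>\<omega>. \<lambda>t\<in>{0..1}. B t \<omega>)) borel (G \<circ> (\<lambda>\<omega>. \<lambda>t\<in>{0..1}. X t \<omega>))"
    using indep F_meas G_meas unfolding indep_processes_def by (rule indep_var_compose)
  moreover have "F \<circ> (\<lambda>\<omega>. \<lambda>t\<in>{0..1}. B t \<omega>) = (\<lambda>\<omega>. F (\<lambda>t. B t \<omega>))" "G \<circ> (\<lambda>\<omega>. \<lambda>t\<in>{0..1}. X t \<omega>) = (\<lambda>\<omega>. G (\<lambda>t. X t \<omega>))"
    using s01 by (auto simp: F_def G_def fun_eq_iff intro!: sum.cong)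
  ultimately have ind: "indep_var borel (\<lambda>\<omega>. F (\<lambda>t. B t \<omega>)) borel (\<lambda>\<omega>. G (\<lambda>t. X t \<omega>))"
    by simp
  have int: "integrable M (\<lambda>\<omega>. F (\<lambda>t. B t \<omega>))" "integrable M (\<lambda>\<omega>. G (\<lambda>t. X t \<omega>))"
    using indep_var_rv1[OF ind] indep_var_rv2[OF ind]
    by (auto intro!: integrable_const_bound[of _ 1] simp: F_def G_def norm_exp_i_times simp del: of_real_sum)
  have "(\<integral>\<omega>. F (\<lambda>t. B t \<omega>) * G (\<lambda>t. X t \<omega>) \<partial>M) = (\<integral>\<omega>. F (\<lambda>t. B t \<omega>) \<partial>M) * (\<integral>\<omega>. G (\<lambda>t. X t \<omega>) \<partial>M)"
    by (rule indep_var_lebesgue_integral[OF ind int])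
  then show ?thesis
    unfolding F_def G_def brownian_increments_characteristic_function[OF B]
    by (simp only: exp_add[symmetric] distrib_left[symmetric] of_real_add[symmetric])
qed

end

section \<open>Joint convergence at the given times\<close>

lemma borel_measurable_vec_vector_3:
  fixes f g h :: "'d::finite \<Rightarrow> 'a \<Rightarrow> real"
  assumes "\<And>i. f i \<in> borel_measurable M" "\<And>i. g i \<in> borel_measurable M" "\<And>i. h i \<in> borel_measurable M"
  shows "(\<lambda>\<omega>. (\<chi> i. vector [f i \<omega>, g i \<omega>, h i \<omega>]) :: (real ^ 3) ^ 'd) \<in> borel_measurable M"
  unfolding borel_measurable_euclidean_space[where 'c="(real ^ 3) ^ 'd"]
proof
  fix b :: "(real ^ 3) ^ 'd" assume "b \<in> Basis"
  have "(\<chi> i. vector [f i \<omega>, g i \<omega>, h i \<omega>]) \<bullet> b =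
      (\<Sum>i\<in>UNIV. f i \<omega> * b $ i $ 1 + g i \<omega> * b $ i $ 2 + h i \<omega> * b $ i $ 3)" for \<omega>
    by (simp add: inner_vec_def sum_3)
  then show "(\<lambda>\<omega>. (\<chi> i. vector [f i \<omega>, g i \<omega>, h i \<omega>]) \<bullet> b) \<in> borel_measurable M"
    using assms by simp
qed

theorem theorem1p1:
  fixes M :: "'a measure" and B Bex :: "real \<Rightarrow> 'a \<Rightarrow> real"
    and \<tau> :: "'d::finite \<Rightarrow> real"
  assumes "brownian_motion M B"
    and "brownian_excursion M Bex"
    and "indep_processes M B Bex"
    and "\<And>i. \<tau> i \<in> {0..1}"
  shows "conv_in_distribution
    (\<lambda>n. measure_pmf (pmf_of_set (motzkin_paths n)))
    (\<lambda>n \<gamma>. (\<chi> i. (1 / sqrt (2 * real n)) *\<^sub>R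
        vector [ascents n \<gamma> (\<tau> i) - real n * \<tau> i / 3,
                levels n \<gamma> (\<tau> i) - real n * \<tau> i / 3,
                descents n \<gamma> (\<tau> i) - real n * \<tau> i / 3]) :: (real ^ 3) ^ 'd)
    M
    (\<lambda>\<omega>. (\<chi> i.
        vector [1 / (2 * sqrt 3) * Bex (\<tau> i) \<omega> + 1 / 6 * B (\<tau> i) \<omega>,
                - (1 / 3) * B (\<tau> i) \<omega>,
                1 / 6 * B (\<tau> i) \<omega> - 1 / (2 * sqrt 3) * Bex (\<tau> i) \<omega>]) :: (real ^ 3) ^ 'd)"
proof -
  interpret M: prob_space M using assms(1) by (simp add: brownian_motion_def)
  obtain s d idx where "partition_of_unit_interval s d" and d: "0 < d"
    and idx: "\<And>i. idx i \<le> Suc d" and \<tau>: "\<And>i. \<tau> i = s (idx i)"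
    using obtain_partition_of_unit_interval[of \<tau>, OF assms(4)] by blast
  then interpret partition_of_unit_interval s d by blast
  let ?P = "\<lambda>n. measure_pmf (pmf_of_set (motzkin_paths n))"
  define Z :: "nat \<Rightarrow> int list \<Rightarrow> (real ^ 3) ^ 'd" where "Z n \<gamma> = (\<chi> i. (1 / sqrt (2 * real n)) *\<^sub>R
        vector [ascents n \<gamma> (\<tau> i) - real n * \<tau> i / 3,
                levels n \<gamma> (\<tau> i) - real n * \<tau> i / 3,
                descents n \<gamma> (\<tau> i) - real n * \<tau> i / 3])" for n \<gamma>
  define W :: "'a \<Rightarrow> (real ^ 3) ^ 'd" where "W \<omega> = (\<chi> i.
        vector [1 / (2 * sqrt 3) * Bex (\<tau> i) \<omega> + 1 / 6 * B (\<tau> i) \<omega>,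
                - (1 / 3) * B (\<tau> i) \<omega>,
                1 / 6 * B (\<tau> i) \<omega> - 1 / (2 * sqrt 3) * Bex (\<tau> i) \<omega>])" for \<omega>
  have meas [measurable]: "B (\<tau> i) \<in> borel_measurable M" "Bex (\<tau> i) \<in> borel_measurable M" for i
    using assms by (auto simp: brownian_motion_def brownian_excursion_def)
  have W_meas [measurable]: "W \<in> borel_measurable M"
    unfolding W_def by (rule borel_measurable_vec_vector_3) measurable
  have "weak_conv (\<lambda>n. distr (?P n) borel (Z n)) (distr M borel W)"
  proof (rule levy_continuity_euclidean)
    show "prob_space (distr (?P n) borel (Z n))" for n
      by (intro prob_space.prob_space_distr) (auto simp: prob_space_measure_pmf)
    show "prob_space (distr M borel W)"
      by (rule M.prob_space_distr) measurable
    fix u :: "(real ^ 3) ^ 'd"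
    \<comment> \<open>The pairing of \<open>u\<close> with the three centred counts, expressed
      through the height (coefficient \<open>\<alpha> i\<close>) and the centred level count
      (coefficient \<open>\<beta> i\<close>) as in \<open>steps_eq\<close>; \<open>\<theta>\<close>
      and \<open>\<eta>\<close> are these coefficients regrouped by blocks and by cuts.\<close>
    define \<alpha> where "\<alpha> i = (u $ i $ 1 - u $ i $ 3) / 2" for i
    define \<beta> where "\<beta> i = u $ i $ 2 - (u $ i $ 1 + u $ i $ 3) / 2" for i
    define \<theta> where "\<theta> j = (\<Sum>i\<in>UNIV. if j < idx i then \<beta> i else 0)" for j
    define \<eta> where "\<eta> k = (\<Sum>i\<in>UNIV. if idx i = Suc k then \<alpha> i else 0)" for k
    \<comment> \<open>The rounding error of the times is the same for all paths, so it leaves the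
      expectation as a phase tending to 1.\<close>
    define r where "r n = (\<Sum>i\<in>UNIV. (u $ i $ 1 + u $ i $ 2 + u $ i $ 3) *
        ((real (block_time s n (idx i)) - real n * \<tau> i) / 3)) / sqrt (2 * real n)" for n
    have Z_phase: "u \<bullet> Z n \<gamma> = block_phase s d \<theta> \<eta> n \<gamma> + r n" if \<gamma>: "\<gamma> \<in> motzkin_paths n" for n \<gamma>
    proof -
      define S where "S i = real_of_int (sum_list (take (block_time s n (idx i)) \<gamma>))" for i
      define L where "L i = real (count_list (take (block_time s n (idx i)) \<gamma>) 0) - real (block_time s n (idx i)) / 3" for i
      define \<rho> where "\<rho> i = (real (block_time s n (idx i)) - real n * \<tau> i) / 3" for i
      have "ascents n \<gamma> (\<tau> i) - real n * \<tau> i / 3 = S i / 2 - L i / 2 + \<rho> i"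
        "levels n \<gamma> (\<tau> i) - real n * \<tau> i / 3 = L i + \<rho> i"
        "descents n \<gamma> (\<tau> i) - real n * \<tau> i / 3 = - S i / 2 - L i / 2 + \<rho> i" for i
        using steps_eq[OF \<gamma>, of "\<tau> i"] assms(4)[of i]
        by (simp_all add: S_def L_def \<rho>_def block_time_def \<tau>[symmetric])
      then have "u \<bullet> Z n \<gamma> = (\<Sum>i\<in>UNIV. (u $ i $ 1 * (S i / 2 - L i / 2 + \<rho> i) + u $ i $ 2 * (L i + \<rho> i) +
          u $ i $ 3 * (- S i / 2 - L i / 2 + \<rho> i)) / sqrt (2 * real n))"
        by (simp add: Z_def inner_vec_def sum_3 add_divide_distrib)
      also have "\<dots> = (\<Sum>i\<in>UNIV. \<alpha> i * S i + \<beta> i * L i) / sqrt (2 * real n) + r n"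
        unfolding r_def \<rho>_def[symmetric] sum_divide_distrib sum.distrib[symmetric] add_divide_distrib[symmetric]
        by (intro sum.cong refl arg_cong2[where f="(/)"]) (simp add: \<alpha>_def \<beta>_def field_simps)
      also have "(\<Sum>i\<in>UNIV. \<alpha> i * S i + \<beta> i * L i) / sqrt (2 * real n) = block_phase s d \<theta> \<eta> n \<gamma>"
        unfolding S_def L_def \<theta>_def \<eta>_def by (rule block_phase_eq[OF \<gamma> idx])
      finally show ?thesis .
    qed
    have r: "r \<longlonglongrightarrow> 0"
    proof (rule Lim_null_comparison)
      show "\<forall>\<^sub>F n in sequentially. norm (r n) \<le> (\<Sum>i\<in>UNIV. \<bar>u $ i $ 1 + u $ i $ 2 + u $ i $ 3\<bar>) * (1 / sqrt (2 * real n))"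
      proof (intro always_eventually allI)
        fix n
        have "\<bar>(real (block_time s n (idx i)) - real n * \<tau> i) / 3\<bar> \<le> 1" for i
        proof -
          have "0 \<le> real n * s (idx i)" using s_nonneg[OF idx] by simp
          then show ?thesis unfolding block_time_def \<tau> by (simp add: abs_if) linarith
        qed
        then have "\<bar>\<Sum>i\<in>UNIV. (u $ i $ 1 + u $ i $ 2 + u $ i $ 3) *
            ((real (block_time s n (idx i)) - real n * \<tau> i) / 3)\<bar> \<le> (\<Sum>i\<in>UNIV. \<bar>u $ i $ 1 + u $ i $ 2 + u $ i $ 3\<bar>)"
          by (intro sum_abs[THEN order_trans] sum_mono) (simp only: abs_mult mult_left_le abs_ge_zero)
        then show "norm (r n) \<le> (\<Sum>i\<in>UNIV. \<bar>u $ i $ 1 + u $ i $ 2 + u $ i $ 3\<bar>) * (1 / sqrt (2 * real n))"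
          unfolding r_def real_norm_def abs_divide by (simp add: divide_right_mono)
      qed
      show "(\<lambda>n. (\<Sum>i\<in>UNIV. \<bar>u $ i $ 1 + u $ i $ 2 + u $ i $ 3\<bar>) * (1 / sqrt (2 * real n))) \<longlonglongrightarrow> 0"
        by (rule tendsto_mult_right_zero) real_asymp
    qed
    have Z_char: "(\<integral>x. iexp (u \<bullet> x) \<partial>distr (?P n) borel (Z n)) =
        iexp (r n) * (\<integral>\<gamma>. iexp (block_phase s d \<theta> \<eta> n \<gamma>) \<partial>?P n)" for n
    proof -
      have "(\<integral>x. iexp (u \<bullet> x) \<partial>distr (?P n) borel (Z n)) = (\<integral>\<gamma>. iexp (u \<bullet> Z n \<gamma>) \<partial>?P n)"
        by (rule integral_distr) auto
      also have "\<dots> = (\<integral>\<gamma>. iexp (r n) * iexp (block_phase s d \<theta> \<eta> n \<gamma>) \<partial>?P n)"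
      proof (rule integral_cong_AE)
        show "AE \<gamma> in ?P n. iexp (u \<bullet> Z n \<gamma>) = iexp (r n) * iexp (block_phase s d \<theta> \<eta> n \<gamma>)"
          unfolding AE_measure_pmf_iff set_pmf_of_set[OF motzkin_paths_nonempty finite_motzkin_paths]
          by (simp add: Z_phase exp_add[symmetric] algebra_simps)
      qed auto
      finally show ?thesis by simp
    qed
    have W_char: "(\<integral>x. iexp (u \<bullet> x) \<partial>distr M borel W) =
        of_real (gaussian_factor \<theta>) * (\<integral>\<omega>. iexp (\<Sum>k<d. \<eta> k * (Bex (s (Suc k)) \<omega> / sqrt 3)) \<partial>M)"
    proof -
      have "AE \<omega> in M. B 0 \<omega> = 0 \<and> Bex 0 \<omega> = 0 \<and> Bex 1 \<omega> = 0"
        using assms(1,2) by (auto simp: brownian_motion_def brownian_excursion_def)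
      then have "AE \<omega> in M. u \<bullet> W \<omega> = (\<Sum>j\<le>d. - \<theta> j / 3 * (B (s (Suc j)) \<omega> - B (s j) \<omega>)) +
          (\<Sum>k<d. \<eta> k * (Bex (s (Suc k)) \<omega> / sqrt 3))"
      proof eventually_elim
        case (elim \<omega>)
        \<comment> \<open>The same coefficients appear in the limit, now in front of -B/3 and
          \<open>Bex / sqrt 3\<close>; this identification fixes the constants 1/6, 1/3 and 1 / (2
          sqrt 3) of the theorem.\<close>
        have "u \<bullet> W \<omega> = (\<Sum>i\<in>UNIV. \<beta> i * (- B (s (idx i)) \<omega> / 3) + \<alpha> i * (Bex (s (idx i)) \<omega> / sqrt 3))"
          unfolding W_def inner_vec_def
          by (intro sum.cong refl) (simp add: sum_3 \<tau> \<alpha>_def \<beta>_def field_simps)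
        also have "\<dots> = (\<Sum>j\<le>d. \<theta> j * (- B (s (Suc j)) \<omega> / 3 - - B (s j) \<omega> / 3)) +
            (\<Sum>k<d. \<eta> k * (Bex (s (Suc k)) \<omega> / sqrt 3))"
          unfolding sum.distrib \<theta>_def \<eta>_def
          using sum_by_increments[of idx d "\<lambda>j. - B (s j) \<omega> / 3" \<beta>, OF idx]
            sum_by_index[of idx d "\<lambda>j. Bex (s j) \<omega> / sqrt 3" \<alpha>, OF idx] elim s_0 s_last by simp
        also have "(\<Sum>j\<le>d. \<theta> j * (- B (s (Suc j)) \<omega> / 3 - - B (s j) \<omega> / 3)) =
            (\<Sum>j\<le>d. - \<theta> j / 3 * (B (s (Suc j)) \<omega> - B (s j) \<omega>))"
          by (intro sum.cong refl) (simp add: field_simps)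
        finally show ?case .
      qed
      moreover have s_meas: "B (s j) \<in> borel_measurable M" "Bex (s j) \<in> borel_measurable M" if "j \<le> Suc d" for j
        using assms(1,2) s_nonneg[OF that] s_le_1[OF that] by (auto simp: brownian_motion_def brownian_excursion_def)
      have "(\<integral>x. iexp (u \<bullet> x) \<partial>distr M borel W) = (\<integral>\<omega>. iexp (u \<bullet> W \<omega>) \<partial>M)"
        by (rule integral_distr) auto
      ultimately have "(\<integral>x. iexp (u \<bullet> x) \<partial>distr M borel W) =
          (\<integral>\<omega>. iexp ((\<Sum>j\<le>d. - \<theta> j / 3 * (B (s (Suc j)) \<omega> - B (s j) \<omega>)) +
          (\<Sum>k<d. \<eta> k * (Bex (s (Suc k)) \<omega> / sqrt 3))) \<partial>M)"
        using s_meas by (auto intro!: integral_cong_AE)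
      then show ?thesis
        by (simp only: limit_characteristic_function[OF assms(1-3)])
    qed
    have "distributed M (\<Pi>\<^sub>M k\<in>{..<d}. lborel) (\<lambda>\<omega>. \<lambda>k\<in>{..<d}. Bex (s (Suc k)) \<omega>)
        (excursion_density d (\<lambda>k. s (Suc k)))"
    proof -
      have "strict_mono_on {..<d} (\<lambda>k. s (Suc k))"
        by (auto simp: strict_mono_on_def intro!: s_less)
      moreover have "(\<lambda>k. s (Suc k)) ` {..<d} \<subseteq> {0<..<1}"
        using s_less[of 0 "Suc _"] s_less[of "Suc _" "Suc d"] s_0 s_last by auto
      ultimately show ?thesis
        using assms(2) d unfolding brownian_excursion_def by simp
    qed
    note lim = characteristic_function_tendsto[OF d M.prob_space_axioms this, of \<theta> \<eta>]
    have "(\<lambda>n. iexp (r n)) \<longlonglongrightarrow> iexp 0"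
      by (intro tendsto_intros r)
    from tendsto_mult[OF this lim]
    show "(\<lambda>n. \<integral>x. iexp (u \<bullet> x) \<partial>distr (?P n) borel (Z n)) \<longlonglongrightarrow> (\<integral>x. iexp (u \<bullet> x) \<partial>distr M borel W)"
      unfolding Z_char W_char by simp
  qed auto
  then show ?thesis
    unfolding conv_in_distribution_def Z_def W_def .
qed

end
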